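(* Let $X=\{Y(E_t),t\ge0\}$, where $Y=\{Y(x),x\ge0\}$ is a strictly stable Lévy motion of index $\alpha\in(0,2]$ with values in $\mathbb{R}^d$ and $E_t=\inf\{x\ge0:D(x)>t\}$ is the inverse of a subordinator $D(t)=\sum_{k=1}^n d_kD_k(t)$, where $d_k>0$ and $D_k(t)$ are independent stable subordinators of index $\beta_k$, with $0<\beta_1<\beta_2<\cdots<\beta_n<1$. Suppose also that $E=\{E_t,t\ge0\}$ is independent of $Y$. Then $$\dim_{\rm H}X([0,1])=\dim_{\rm P}X([0,1])=\min\{d,\alpha\}\quad\text{a.s.}$$ and $$\dim_{\rm H}{\rm Gr}X([0,1])=\dim_{\rm P}{\rm Gr}X([0,1])=\begin{cases}\max\{1,\alpha\}&\text{if }\alpha\le d,\\ 1+\beta_n\left(1-\frac1\alpha\right)&\text{if }\alpha>d=1,\end{cases}\quad\text{a.s.}$$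
   Context: $\dim_{\rm H}$ and $\dim_{\rm P}$ denote Hausdorff dimension and packing dimension of subsets of Euclidean space. $X([0,1])=\{X(t):t\in[0,1]\}$ is the range and ${\rm Gr}X([0,1])=\{(t,X(t)):t\in[0,1]\}$ is the graph, where $X(t)=Y(E_t)$. A strictly stable Lévy motion of index $\alpha$ is a Lévy process $Y$ with $Y(0)=0$ such that $\{Y(cx),x\ge0\}$ and $\{c^{1/\alpha}Y(x),x\ge0\}$ have the same law for every $c>0$. A stable subordinator of index $\beta\in(0,1)$ is a nondecreasing strictly $\beta$-stable real Lévy process started at $0$ that is not identically zero.
   Formalization: The strictly stable Lévy motion Y is additionally assumed to be genuinely d-dimensional (not almost surely contained in a proper linear subspace of R^d); without this the claim fails, e.g. for Y=0 or for Y=(B,0) in R^2 with B a Brownian motion. *)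

theory Defs
  imports "HOL-Probability.Probability"
begin

subsection \<open>Hausdorff dimension\<close>

text \<open>
  \<open>|U|^s\<close> with the usual conventions \<open>|U|^0 = 1\<close> for \<open>U \<noteq> {}\<close> and \<open>|{}|^s = 0\<close>
  (whereas \<^term>\<open>0 powr 0 = (0::real)\<close>).  Only meaningful for bounded \<open>U\<close>, since
  \<^const>\<open>diameter\<close> is unspecified for unbounded sets.
\<close>

definition diam_pow :: "real \<Rightarrow> 'a::metric_space set \<Rightarrow> ennreal" where
  "diam_pow s U = (if U = {} then 0 else if s = 0 then 1 else ennreal (diameter U powr s))"

definition hausdorff_premeasure :: "real \<Rightarrow> real \<Rightarrow> 'a::metric_space set \<Rightarrow> ennreal" where
  "hausdorff_premeasure s \<delta> A =
     (INF U \<in> {U :: nat \<Rightarrow> 'a set. A \<subseteq> (\<Union>i. U i) \<and> (\<forall>i. bounded (U i) \<and> diameter (U i) \<le> \<delta>)}.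
        \<Sum>i. diam_pow s (U i))"

definition hausdorff_measure :: "real \<Rightarrow> 'a::metric_space set \<Rightarrow> ennreal" where
  "hausdorff_measure s A = (SUP \<delta> \<in> {0<..}. hausdorff_premeasure s \<delta> A)"

definition hausdorff_dim :: "'a::metric_space set \<Rightarrow> ereal" where
  "hausdorff_dim A = Inf {ereal s | s. 0 \<le> s \<and> hausdorff_measure s A = 0}"


subsection \<open>Packing dimension\<close>

text \<open>
  A pair \<open>(x, r)\<close> encodes the closed ball of centre \<open>x\<close> and radius \<open>r\<close>, of diameter \<open>2 r\<close>.
  Taking the supremum over finite packings gives the same value as over countable ones.
\<close>

definition ball_packings :: "real \<Rightarrow> 'a::euclidean_space set \<Rightarrow> ('a \<times> real) set set" where
  "ball_packings \<delta> A =
     {B. finite B \<and> B \<subseteq> A \<times> {0<..\<delta>} \<and> disjoint_family_on (\<lambda>(x, r). cball x r) B}"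

definition packing_premeasure :: "real \<Rightarrow> 'a::euclidean_space set \<Rightarrow> ennreal" where
  "packing_premeasure s A =
     (INF \<delta> \<in> {0<..}. SUP B \<in> ball_packings \<delta> A. \<Sum>(x, r)\<in>B. ennreal ((2 * r) powr s))"

definition packing_measure :: "real \<Rightarrow> 'a::euclidean_space set \<Rightarrow> ennreal" where
  "packing_measure s A =
     (INF S \<in> {S :: nat \<Rightarrow> 'a set. A \<subseteq> (\<Union>i. S i)}. \<Sum>i. packing_premeasure s (S i))"

definition packing_dim :: "'a::euclidean_space set \<Rightarrow> ereal" where
  "packing_dim A = Inf {ereal s | s. 0 \<le> s \<and> packing_measure s A = 0}"


subsection \<open>Processes indexed by the nonnegative reals\<close>

text \<open>
  Processes are functions \<open>X t \<omega>\<close> of which only the times \<open>t \<ge> 0\<close> matter.  The path space carries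
  the product sigma-algebra, so that equality of laws on it is equality of all
  finite-dimensional distributions.
\<close>

abbreviation path_space :: "(real \<Rightarrow> 'a::euclidean_space) measure" where
  "path_space \<equiv> PiM {0..} (\<lambda>_. borel)"

definition path_of :: "(real \<Rightarrow> 'w \<Rightarrow> 'a) \<Rightarrow> 'w \<Rightarrow> (real \<Rightarrow> 'a)" where
  "path_of X \<omega> = (\<lambda>t\<in>{0..}. X t \<omega>)"

definition same_law ::
  "'w measure \<Rightarrow> (real \<Rightarrow> 'w \<Rightarrow> 'a::euclidean_space) \<Rightarrow> (real \<Rightarrow> 'w \<Rightarrow> 'a) \<Rightarrow> bool" where
  "same_law M X Y \<longleftrightarrow> distr M path_space (path_of X) = distr M path_space (path_of Y)"

text \<open>
  Spelled out through \<^const>\<open>prob_space.indep_set\<close> because \<^const>\<open>prob_space.indep_var\<close> forces both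
  variables to have the same type.  Note that \<^const>\<open>prob_space.indep_set\<close> includes the
  measurability of the two families of events.
\<close>

definition indep_processes ::
  "'w measure \<Rightarrow> (real \<Rightarrow> 'w \<Rightarrow> 'a::euclidean_space) \<Rightarrow> (real \<Rightarrow> 'w \<Rightarrow> 'b::euclidean_space) \<Rightarrow> bool"
where
  "indep_processes M X Y \<longleftrightarrow>
     prob_space.indep_set M
       {path_of X -` A \<inter> space M | A. A \<in> sets path_space}
       {path_of Y -` A \<inter> space M | A. A \<in> sets path_space}"

definition cadlag :: "(real \<Rightarrow> 'a::topological_space) \<Rightarrow> bool" where
  "cadlag f \<longleftrightarrow> (\<forall>t\<ge>0. continuous (at_right t) f) \<and> (\<forall>t>0. \<exists>l. (f \<longlongrightarrow> l) (at_left t))"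


subsection \<open>Stable processes\<close>

text \<open>
  Stochastic continuity is not listed, as it follows from stationary increments and right
  continuity of the paths.
\<close>

definition levy_process :: "'w measure \<Rightarrow> (real \<Rightarrow> 'w \<Rightarrow> 'a::euclidean_space) \<Rightarrow> bool" where
  "levy_process M Y \<longleftrightarrow>
     prob_space M \<and>
     (\<forall>t\<ge>0. Y t \<in> borel_measurable M) \<and>
     (AE \<omega> in M. Y 0 \<omega> = 0) \<and>
     (\<forall>n. \<forall>t :: nat \<Rightarrow> real. 0 \<le> t 0 \<and> mono_on {..n} t \<longrightarrow>
        prob_space.indep_vars M (\<lambda>_. borel) (\<lambda>i \<omega>. Y (t (Suc i)) \<omega> - Y (t i) \<omega>) {..<n}) \<and>
     (\<forall>s\<ge>0. \<forall>h\<ge>0. distr M borel (\<lambda>\<omega>. Y (s + h) \<omega> - Y s \<omega>) = distr M borel (Y h)) \<and>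
     (AE \<omega> in M. cadlag (\<lambda>t. Y t \<omega>))"

definition strictly_stable_levy ::
  "'w measure \<Rightarrow> real \<Rightarrow> (real \<Rightarrow> 'w \<Rightarrow> 'a::euclidean_space) \<Rightarrow> bool" where
  "strictly_stable_levy M \<alpha> Y \<longleftrightarrow>
     levy_process M Y \<and>
     (\<forall>c>0. same_law M (\<lambda>x. Y (c * x)) (\<lambda>x \<omega>. (c powr (1 / \<alpha>)) *\<^sub>R Y x \<omega>))"

text \<open>
  Needed because the scaling property alone is also satisfied by the zero process and by stable
  processes living in a proper linear subspace.
\<close>

definition genuinely_full_dim :: "'w measure \<Rightarrow> (real \<Rightarrow> 'w \<Rightarrow> 'a::euclidean_space) \<Rightarrow> bool" where
  "genuinely_full_dim M Y \<longleftrightarrow>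
     (\<forall>V. subspace V \<and> V \<noteq> UNIV \<longrightarrow> \<not> (AE \<omega> in M. \<forall>t\<ge>0. Y t \<omega> \<in> V))"

definition stable_subordinator :: "'w measure \<Rightarrow> real \<Rightarrow> (real \<Rightarrow> 'w \<Rightarrow> real) \<Rightarrow> bool" where
  "stable_subordinator M \<beta> D \<longleftrightarrow>
     0 < \<beta> \<and> \<beta> < 1 \<and> strictly_stable_levy M \<beta> D \<and>
     (AE \<omega> in M. mono_on {0..} (\<lambda>t. D t \<omega>)) \<and>
     \<not> (AE \<omega> in M. \<forall>t\<ge>0. D t \<omega> = 0)"

definition inverse_process :: "(real \<Rightarrow> 'w \<Rightarrow> real) \<Rightarrow> real \<Rightarrow> 'w \<Rightarrow> real" where
  "inverse_process D t \<omega> = Inf {x. 0 \<le> x \<and> D x \<omega> > t}"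

definition range_on :: "(real \<Rightarrow> 'w \<Rightarrow> 'a) \<Rightarrow> real set \<Rightarrow> 'w \<Rightarrow> 'a set" where
  "range_on X T \<omega> = (\<lambda>t. X t \<omega>) ` T"

definition graph_on :: "(real \<Rightarrow> 'w \<Rightarrow> 'a) \<Rightarrow> real set \<Rightarrow> 'w \<Rightarrow> (real \<times> 'a) set" where
  "graph_on X T \<omega> = (\<lambda>t. (t, X t \<omega>)) ` T"

end

theory Submission
  imports Defs "HOL-Real_Asymp.Real_Asymp"
begin

text \<open>
  Since \<open>D\<close> is strictly increasing and unbounded, the range of \<open>X\<close> on \<open>[0,1]\<close> is a piece of the range
  of \<open>Y\<close>, and the graph of \<open>X\<close> is a piece of the range of the process \<open>(D, Y)\<close> together with
  countably many horizontal segments.  As \<open>D\<close> is recovered from its inverse, it is independent of \<open>Y\<close>, so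
  \<open>(D, Y)\<close> has stationary independent increments.

  Upper bounds: applying the Markov property at the first visit to each cell of a grid of mesh \<open>r\<close>, the
  expected number of visited cells times the expected time spent within \<open>r\<close> of the origin is at most a
  constant times the time horizon.  Lower bounds: the energy integrals of the occupation measures are finite by
  small ball estimates
  \<open>P (|Y t| \<le> r) \<le> C * (r / t powr (1 / \<alpha>)) ^ d\<close>.  These follow from the decay of the
  characteristic function \<open>\<phi>\<close> of \<open>Y 1\<close>, which needs no Levy--Khintchine formula: for a unit vector \<open>u\<close>,
  scaling and infinite divisibility give \<open>|\<phi> (r u)| \<le> |\<phi> u| ^ \<lfloor>r powr \<alpha>\<rfloor>\<close>.
\<close>

subsection \<open>Comparison of Hausdorff and packing dimension\<close>

text \<open>The value 1 + \<beta> n * (1 - 1 / \<alpha>) comes from sojourn times. Near time 0 the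
  largest index dominates, so \<open>D\<close> stays within r of 0 for a time \<tau> of order
  r^(\<beta> n). Meanwhile \<open>Y\<close> spreads over a length \<tau>^(1/\<alpha>), which exceeds
  r when \<beta> n < 1 < \<alpha>, and so spends only a fraction r / \<tau>^(1/\<alpha>) of \<tau>
  near 0; the product is r^(1 + \<beta> n - \<beta> n / \<alpha>). Hausdorff dimension never exceeds
  packing dimension, so all four equalities follow from upper bounds for packing and lower bounds
  for Hausdorff dimension. Counting is done for walks on dyadic time grids: there a first visit is a
  countable family of events at fixed times, which takes the place of stopping times, and right
  continuity carries the counts over to the whole path. The small ball estimate of full dimension d
  can fail at \<alpha> = 1, where a direction may carry a pure drift. This forces a case split: for
  \<alpha> > 1 full dimensionality excludes drift, and for \<alpha> \<le> 1 the claimed dimension is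
  at most 1, so one coordinate is enough.\<close>

lemma le_ennreal_cmult_INF:
  assumes "0 < c" "\<And>a. a \<in> A \<Longrightarrow> x \<le> ennreal c * f a"
  shows "x \<le> ennreal c * (INF a\<in>A. f a)"
proof -
  have inv: "ennreal (1 / c) * (ennreal c * y) = y" "ennreal c * (ennreal (1 / c) * y) = y" for y
    using assms(1) by (simp_all add: mult.assoc[symmetric] flip: ennreal_mult)
  have "ennreal (1 / c) * x \<le> (INF a\<in>A. f a)"
    using mult_left_mono[OF assms(2), of _ "ennreal (1 / c)"] by (intro INF_greatest) (simp add: inv)
  then have "ennreal c * (ennreal (1 / c) * x) \<le> ennreal c * (INF a\<in>A. f a)" by (rule mult_left_mono) simp
  then show ?thesis by (simp add: inv)
qed

lemma hausdorff_premeasure_le: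
  assumes "A \<subseteq> (\<Union>i. U i)" "\<And>i. bounded (U i)" "\<And>i. diameter (U i) \<le> \<delta>"
  shows "hausdorff_premeasure s \<delta> A \<le> (\<Sum>i. diam_pow s (U i))"
  unfolding hausdorff_premeasure_def by (rule INF_lower) (use assms in auto)

lemma hausdorff_premeasure_lessE:
  assumes "hausdorff_premeasure s \<delta> A < e"
  obtains U :: "nat \<Rightarrow> 'a::metric_space set" where
    "A \<subseteq> (\<Union>i. U i)" "\<And>i. bounded (U i)" "\<And>i. diameter (U i) \<le> \<delta>" "(\<Sum>i. diam_pow s (U i)) < e"
  using assms unfolding hausdorff_premeasure_def by (auto simp: INF_less_iff)

lemma hausdorff_premeasure_le_measure:
  "0 < \<delta> \<Longrightarrow> hausdorff_premeasure s \<delta> A \<le> hausdorff_measure s A"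
  unfolding hausdorff_measure_def by (rule SUP_upper) auto

lemma hausdorff_premeasure_antimono:
  "\<delta> \<le> \<delta>' \<Longrightarrow> hausdorff_premeasure s \<delta>' A \<le> hausdorff_premeasure s \<delta> A"
  unfolding hausdorff_premeasure_def by (rule INF_superset_mono) (auto intro: order_trans)

text \<open>Covers of the pieces are taken optimal up to e / 2^(i+1) and merged into one sequence
  through \<open>prod_decode\<close>.\<close>

lemma hausdorff_premeasure_UN_le:
  "hausdorff_premeasure s \<delta> (\<Union>i. S i) \<le> (\<Sum>i. hausdorff_premeasure s \<delta> (S i))"
proof (rule ennreal_le_epsilon)
  fix e :: real assume fin: "(\<Sum>i. hausdorff_premeasure s \<delta> (S i)) < top" and e: "0 < e"
  have "\<exists>U. S i \<subseteq> (\<Union>j. U j) \<and> (\<forall>j. bounded (U j) \<and> diameter (U j) \<le> \<delta>) \<and>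
      (\<Sum>j. diam_pow s (U j)) \<le> hausdorff_premeasure s \<delta> (S i) + ennreal (e * (1/2) ^ Suc i)" for i
  proof -
    have "hausdorff_premeasure s \<delta> (S i) < top"
    proof -
      have "hausdorff_premeasure s \<delta> (S i) \<le> (\<Sum>i. hausdorff_premeasure s \<delta> (S i))"
        using sum_le_suminf[of "\<lambda>i. hausdorff_premeasure s \<delta> (S i)" "{i}"] by auto
      then show ?thesis using fin by (rule le_less_trans)
    qed
    then have "hausdorff_premeasure s \<delta> (S i) < hausdorff_premeasure s \<delta> (S i) + ennreal (e * (1/2) ^ Suc i)"
      using e by (cases "hausdorff_premeasure s \<delta> (S i)")
        (auto simp: ennreal_plus[symmetric] ennreal_less_iff simp del: ennreal_plus)
    then show ?thesis
      by (rule hausdorff_premeasure_lessE) (meson less_imp_le)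
  qed
  then obtain U where U: "\<And>i. S i \<subseteq> (\<Union>j. U i j)" "\<And>i j. bounded (U i j)" "\<And>i j. diameter (U i j) \<le> \<delta>"
      "\<And>i. (\<Sum>j. diam_pow s (U i j)) \<le> hausdorff_premeasure s \<delta> (S i) + ennreal (e * (1/2) ^ Suc i)"
    by metis
  define V where "V k = (case prod_decode k of (i, j) \<Rightarrow> U i j)" for k
  have "(\<Union>i. S i) \<subseteq> (\<Union>k. V k)"
  proof
    fix x assume "x \<in> (\<Union>i. S i)"
    then obtain i j where "x \<in> U i j" using U(1) by blast
    then have "x \<in> V (prod_encode (i, j))" by (simp add: V_def)
    then show "x \<in> (\<Union>k. V k)" by blast
  qed
  then have "hausdorff_premeasure s \<delta> (\<Union>i. S i) \<le> (\<Sum>k. diam_pow s (V k))"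
    by (rule hausdorff_premeasure_le) (auto simp: V_def U split: prod.split)
  also have "\<dots> = (\<Sum>k. (\<lambda>(i, j). diam_pow s (U i j)) (prod_decode k))"
    by (intro suminf_cong) (simp add: V_def split: prod.split)
  also have "\<dots> = (\<Sum>i. \<Sum>j. diam_pow s (U i j))"
    by (rule suminf_ennreal_2dimen) simp
  also have "\<dots> \<le> (\<Sum>i. hausdorff_premeasure s \<delta> (S i) + ennreal (e * (1/2) ^ Suc i))"
    by (intro suminf_le U) auto
  also have "\<dots> = (\<Sum>i. hausdorff_premeasure s \<delta> (S i)) + (\<Sum>i. ennreal (e * (1/2) ^ Suc i))"
    by (rule suminf_add[symmetric]) auto
  also have "(\<Sum>i. ennreal (e * (1/2) ^ Suc i)) = ennreal e"
    using sums_mult[OF power_half_series, of e] e by (intro suminf_ennreal_eq) auto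
  finally show "hausdorff_premeasure s \<delta> (\<Union>i. S i) \<le> (\<Sum>i. hausdorff_premeasure s \<delta> (S i)) + ennreal e" .
qed

text \<open>Covers are pushed forward by f after intersecting them with A, because f is controlled
  only on A. Applied to coordinate projections, this gives the lower bounds for the graph from its
  time and space components.\<close>

lemma hausdorff_measure_nonexpanding_le:
  fixes f :: "'a::metric_space \<Rightarrow> 'b::metric_space"
  assumes sub: "B \<subseteq> f ` A" and f: "\<And>x y. x \<in> A \<Longrightarrow> y \<in> A \<Longrightarrow> dist (f x) (f y) \<le> dist x y" and s: "0 \<le> s"
  shows "hausdorff_measure s B \<le> hausdorff_measure s A"
  unfolding hausdorff_measure_def
proof (rule SUP_mono)
  fix \<delta> :: real assume \<delta>: "\<delta> \<in> {0<..}"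
  have "hausdorff_premeasure s \<delta> B \<le> hausdorff_premeasure s \<delta> A"
    unfolding hausdorff_premeasure_def
  proof (rule INF_mono)
    fix U :: "nat \<Rightarrow> 'a set"
    assume "U \<in> {U. A \<subseteq> (\<Union>i. U i) \<and> (\<forall>i. bounded (U i) \<and> diameter (U i) \<le> \<delta>)}"
    then have U: "A \<subseteq> (\<Union>i. U i)" "\<And>i. bounded (U i)" "\<And>i. diameter (U i) \<le> \<delta>" by auto
    define V where "V i = f ` (U i \<inter> A)" for i
    have dV: "dist x y \<le> diameter (U i)" if xy: "x \<in> V i" "y \<in> V i" for x y i
    proof -
      obtain a b where "a \<in> U i \<inter> A" "b \<in> U i \<inter> A" "x = f a" "y = f b" using xy unfolding V_def by blast
      then show ?thesis using f[of a b] diameter_bounded_bound[OF U(2)[of i], of a b] by force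
    qed
    have bV: "bounded (V i)" for i
      unfolding bounded_two_points using dV by blast
    have diV: "diameter (V i) \<le> diameter (U i)" for i
      using dV[of _ i] diameter_ge_0[OF U(2)[of i]] unfolding diameter_def[of "V i"] by (auto intro!: cSUP_least)
    have "B \<subseteq> (\<Union>i. V i)" using sub U(1) by (fastforce simp: V_def)
    moreover have "(\<Sum>i. diam_pow s (V i)) \<le> (\<Sum>i. diam_pow s (U i))"
    proof (rule suminf_le)
      fix i show "diam_pow s (V i) \<le> diam_pow s (U i)"
        using diV[of i] diameter_ge_0[OF bV[of i]] s
        by (auto simp: diam_pow_def V_def intro!: ennreal_leI powr_mono2)
    qed auto
    ultimately show "\<exists>V\<in>{V. B \<subseteq> (\<Union>i. V i) \<and> (\<forall>i. bounded (V i) \<and> diameter (V i) \<le> \<delta>)}.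
        (\<Sum>i. diam_pow s (V i)) \<le> (\<Sum>i. diam_pow s (U i))"
      using bV order_trans[OF diV U(3)] by (intro bexI[of _ V]) auto
  qed
  then show "\<exists>\<delta>'\<in>{0<..}. hausdorff_premeasure s \<delta> B \<le> hausdorff_premeasure s \<delta>' A" using \<delta> by blast
qed

lemma hausdorff_dim_nonexpanding_le:
  fixes f :: "'a::metric_space \<Rightarrow> 'b::metric_space"
  assumes "B \<subseteq> f ` A" "\<And>x y. x \<in> A \<Longrightarrow> y \<in> A \<Longrightarrow> dist (f x) (f y) \<le> dist x y"
  shows "hausdorff_dim B \<le> hausdorff_dim A"
  unfolding hausdorff_dim_def
proof (rule Inf_superset_mono, safe)
  fix s :: real assume "0 \<le> s" "hausdorff_measure s A = 0"
  then have "hausdorff_measure s B = 0" using hausdorff_measure_nonexpanding_le[OF assms, of s] by auto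
  then show "\<exists>t. ereal s = ereal t \<and> 0 \<le> t \<and> hausdorff_measure t B = 0" using \<open>0 \<le> s\<close> by blast
qed

lemma hausdorff_dim_mono: "A \<subseteq> B \<Longrightarrow> hausdorff_dim A \<le> hausdorff_dim B"
  by (rule hausdorff_dim_nonexpanding_le[where f = id]) auto

lemma hausdorff_measure_eq_0_mono:
  assumes "hausdorff_measure s A = 0" "0 \<le> s" "s \<le> s'"
  shows "hausdorff_measure s' A = 0"
proof -
  have "hausdorff_premeasure s' \<delta> A \<le> 0" if "0 < \<delta>" for \<delta>
  proof -
    \<comment> \<open>For diameters at most 1 the larger exponent gives the smaller power, hence the
      cap at 1.\<close>
    have "hausdorff_premeasure s' \<delta> A \<le> hausdorff_premeasure s' (min \<delta> 1) A"
      by (rule hausdorff_premeasure_antimono) simp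
    also have "\<dots> \<le> hausdorff_premeasure s (min \<delta> 1) A"
      unfolding hausdorff_premeasure_def
    proof (rule INF_mono, safe)
      fix U :: "nat \<Rightarrow> 'a set"
      assume U: "A \<subseteq> (\<Union>i. U i)" "\<forall>i. bounded (U i) \<and> diameter (U i) \<le> min \<delta> 1"
      have "diam_pow s' (U i) \<le> diam_pow s (U i)" for i
        using U(2) diameter_ge_0[of "U i"] assms(2,3)
        by (auto simp: diam_pow_def powr_le1 intro!: ennreal_leI powr_mono')
      then have "(\<Sum>i. diam_pow s' (U i)) \<le> (\<Sum>i. diam_pow s (U i))"
        by (intro suminf_le) auto
      then show "\<exists>V\<in>{V. A \<subseteq> (\<Union>i. V i) \<and> (\<forall>i. bounded (V i) \<and> diameter (V i) \<le> min \<delta> 1)}.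
        (\<Sum>i. diam_pow s' (V i)) \<le> (\<Sum>i. diam_pow s (U i))" using U by blast
    qed
    also have "\<dots> \<le> hausdorff_measure s A"
      using that by (intro hausdorff_premeasure_le_measure) auto
    finally show ?thesis using assms by simp
  qed
  then have "hausdorff_measure s' A \<le> 0"
    unfolding hausdorff_measure_def by (intro SUP_least) auto
  then show ?thesis by simp
qed

text \<open>Positive exponents suffice: a null exponent t < s, possibly 0, makes every exponent
  between t and s null.\<close>

lemma hausdorff_dim_geI:
  assumes "\<And>s'. 0 < s' \<Longrightarrow> s' < s \<Longrightarrow> hausdorff_measure s' A \<noteq> 0"
  shows "ereal s \<le> hausdorff_dim A"
  unfolding hausdorff_dim_def
proof (rule Inf_greatest, safe)
  fix t :: real assume t: "0 \<le> t" "hausdorff_measure t A = 0"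
  show "ereal s \<le> ereal t"
  proof (rule ccontr)
    assume "\<not> ereal s \<le> ereal t"
    then have "t < s" by simp
    then obtain s' where "t < s'" "s' < s" using dense by blast
    with hausdorff_measure_eq_0_mono[OF t(2,1), of s'] assms[of s'] t show False by simp
  qed
qed

text \<open>Packing measure is an infimum over countable decompositions, so the premeasure only has
  to vanish on each of countably many pieces. The pieces will be images of bounded time intervals,
  balls and horizontal segments.\<close>

lemma packing_dim_leI:
  fixes A :: "'a::euclidean_space set"
  assumes "0 \<le> s" "countable \<S>" "A \<subseteq> \<Union>\<S>"
    and null: "\<And>S s'. S \<in> \<S> \<Longrightarrow> s < s' \<Longrightarrow> packing_premeasure s' S = 0"
  shows "packing_dim A \<le> ereal s"
proof -
  have zero: "packing_measure s' A = 0" if "s < s'" for s'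
  proof -
    have e: "packing_premeasure s' ({}::'a set) = 0"
    proof -
      have "ball_packings 1 ({} :: 'a set) = {{}}" by (auto simp: ball_packings_def disjoint_family_on_def)
      moreover have "packing_premeasure s' ({} :: 'a set) \<le>
          (SUP B \<in> ball_packings 1 ({}::'a set). \<Sum>(x, r)\<in>B. ennreal ((2 * r) powr s'))"
        unfolding packing_premeasure_def by (rule INF_lower) auto
      ultimately show ?thesis by simp
    qed
    \<comment> \<open>Inserting the empty set, whose premeasure is 0, makes the enumeration
      legitimate when \<S> is empty.\<close>
    define S where "S = from_nat_into (insert {} \<S>)"
    have r: "range S = insert {} \<S>" unfolding S_def
      using assms(2) by (intro range_from_nat_into) auto
    have "packing_premeasure s' (S i) = 0" for i
    proof -
      have "S i \<in> insert {} \<S>" using r by blast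
      then show ?thesis using null[of "S i" s'] that e by auto
    qed
    moreover have "A \<subseteq> (\<Union>i. S i)" using r assms(3) by auto
    then have "packing_measure s' A \<le> (\<Sum>i. packing_premeasure s' (S i))"
      unfolding packing_measure_def by (intro INF_lower) auto
    ultimately show ?thesis by simp
  qed
  show ?thesis
  proof (rule ereal_le_epsilon2)
    fix e :: real assume "0 < e"
    then show "packing_dim A \<le> ereal s + ereal e"
      unfolding packing_dim_def using zero[of "s + e"] assms(1) by (intro Inf_lower) force
  qed
qed

text \<open>Take a disjoint family of \<delta>-balls centred in S with as many members as possible.
  By maximality the balls of doubled radius cover S; their diameters are 4 * \<delta> against 2 *
  \<delta> in the packing, whence the factor 2 powr s. If the packing sums are infinite there is
  nothing to show; otherwise they bound the cardinality, and a maximal family exists.\<close>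

lemma hausdorff_measure_le_packing_premeasure:
  fixes S :: "'a::euclidean_space set"
  assumes s: "0 \<le> s"
  shows "hausdorff_measure s S \<le> ennreal (2 powr s) * packing_premeasure s S"
proof -
  define P where "P \<delta> = (SUP B \<in> ball_packings \<delta> S. \<Sum>(x, r)\<in>B. ennreal ((2 * r) powr s))" for \<delta>
  have main: "hausdorff_premeasure s (4 * \<delta>) S \<le> ennreal (2 powr s) * P \<delta>" if \<delta>: "0 < \<delta>" for \<delta>
  proof -
    define \<C> where "\<C> = {C. finite C \<and> C \<subseteq> S \<and> (\<forall>x\<in>C. \<forall>y\<in>C. x \<noteq> y \<longrightarrow> cball x \<delta> \<inter> cball y \<delta> = {})}"
    have le: "ennreal (card C * (2 * \<delta>) powr s) \<le> P \<delta>" if "C \<in> \<C>" for C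
    proof -
      have "(\<lambda>x. (x, \<delta>)) ` C \<in> ball_packings \<delta> S"
        using that \<delta> by (auto simp: \<C>_def ball_packings_def disjoint_family_on_def)
      then have "(\<Sum>(x, r)\<in>(\<lambda>x. (x, \<delta>)) ` C. ennreal ((2 * r) powr s)) \<le> P \<delta>"
        unfolding P_def by (rule SUP_upper)
      also have "(\<Sum>(x, r)\<in>(\<lambda>x. (x, \<delta>)) ` C. ennreal ((2 * r) powr s)) = ennreal (card C * (2 * \<delta>) powr s)"
        by (subst sum.reindex) (auto simp: inj_on_def ennreal_mult ennreal_of_nat_eq_real_of_nat)
      finally show ?thesis .
    qed
    show ?thesis
    proof (cases "P \<delta> = top")
      case True then show ?thesis by (simp add: ennreal_mult_top)
    next
      case False
      then obtain p where p: "P \<delta> = ennreal p" "0 \<le> p" by (cases "P \<delta>") auto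
      have bd: "card C \<le> nat \<lfloor>p / (2 * \<delta>) powr s\<rfloor>" if "C \<in> \<C>" for C
      proof -
        have "card C * (2 * \<delta>) powr s \<le> p" using le[OF that] p by simp
        then have "real (card C) \<le> p / (2 * \<delta>) powr s" using \<delta> by (simp add: pos_le_divide_eq)
        then show ?thesis by linarith
      qed
      have "{} \<in> \<C>" by (auto simp: \<C>_def)
      then obtain C where C: "C \<in> \<C>" "\<And>C'. C' \<in> \<C> \<Longrightarrow> card C' \<le> card C"
        using ex_has_greatest_nat[of "\<lambda>C. C \<in> \<C>" "{}" card "Suc (nat \<lfloor>p / (2 * \<delta>) powr s\<rfloor>)"] bd
        by (metis less_Suc_eq_le)
      have fC: "finite C" using C(1) by (simp add: \<C>_def)
      have cov: "S \<subseteq> (\<Union>c\<in>C. cball c (2 * \<delta>))"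
      proof
        fix x assume x: "x \<in> S"
        show "x \<in> (\<Union>c\<in>C. cball c (2 * \<delta>))"
        proof (cases "x \<in> C")
          case True then show ?thesis using \<delta> by force
        next
          case False
          then have "insert x C \<notin> \<C>" using C(2)[of "insert x C"] fC by auto
          have "\<exists>c\<in>C. cball x \<delta> \<inter> cball c \<delta> \<noteq> {}"
          proof (rule ccontr)
            assume "\<not> ?thesis"
            then have "insert x C \<in> \<C>"
              using C(1) x unfolding \<C>_def by (simp add: Int_commute)
            with \<open>insert x C \<notin> \<C>\<close> show False by simp
          qed
          then obtain c where c: "c \<in> C" "cball x \<delta> \<inter> cball c \<delta> \<noteq> {}" by blast
          then obtain z where "dist x z \<le> \<delta>" "dist c z \<le> \<delta>" by auto
          then have "dist c x \<le> 2 * \<delta>" using dist_triangle2[of c x z] by linarith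
          then show ?thesis using c by auto
        qed
      qed
      obtain g where g: "bij_betw g {0..<card C} C" using ex_bij_betw_nat_finite[OF fC] by blast
      define U where "U i = (if i < card C then cball (g i) (2 * \<delta>) else {})" for i
      have "S \<subseteq> (\<Union>i. U i)"
      proof
        fix x assume "x \<in> S"
        then obtain c where c: "c \<in> C" "x \<in> cball c (2 * \<delta>)" using cov by blast
        then obtain i where "i < card C" "g i = c" using g unfolding bij_betw_def by force
        then show "x \<in> (\<Union>i. U i)" using c by (auto simp: U_def)
      qed
      moreover have dU: "diameter (U i) \<le> 4 * \<delta>" for i
        using \<delta> by (auto simp: U_def diameter_cball)
      ultimately have "hausdorff_premeasure s (4 * \<delta>) S \<le> (\<Sum>i. diam_pow s (U i))"
        by (intro hausdorff_premeasure_le) (auto simp: U_def)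
      also have "\<dots> = (\<Sum>i<card C. diam_pow s (U i))"
        by (intro suminf_finite) (auto simp: U_def diam_pow_def)
      also have "\<dots> \<le> (\<Sum>i<card C. ennreal ((4 * \<delta>) powr s))"
        using dU \<delta> s by (intro sum_mono) (auto simp: diam_pow_def U_def intro!: ennreal_leI powr_mono2 diameter_ge_0)
      also have "\<dots> = ennreal (2 powr s) * ennreal (card C * (2 * \<delta>) powr s)"
      proof -
        have "(4 * \<delta>) powr s = 2 powr s * (2 * \<delta>) powr s" using \<delta> by (simp flip: powr_mult)
        then show ?thesis by (simp add: ennreal_of_nat_eq_real_of_nat flip: ennreal_mult)
      qed
      also have "\<dots> \<le> ennreal (2 powr s) * P \<delta>" by (intro mult_left_mono le C) auto
      finally show ?thesis .
    qed
  qed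
  have Pmono: "P \<delta> \<le> P \<delta>'" if "\<delta> \<le> \<delta>'" for \<delta> \<delta>'
    unfolding P_def using that by (intro SUP_subset_mono) (auto simp: ball_packings_def)
  have "hausdorff_premeasure s \<delta> S \<le> ennreal (2 powr s) * packing_premeasure s S" if "0 < \<delta>" for \<delta>
  proof -
    have "hausdorff_premeasure s \<delta> S \<le> ennreal (2 powr s) * P \<delta>'" if \<delta>': "0 < \<delta>'" for \<delta>'
    proof -
      define \<eta> where "\<eta> = min (\<delta> / 4) \<delta>'"
      have "hausdorff_premeasure s \<delta> S \<le> hausdorff_premeasure s (4 * \<eta>) S"
        by (rule hausdorff_premeasure_antimono) (auto simp: \<eta>_def)
      also have "\<dots> \<le> ennreal (2 powr s) * P \<eta>" using \<open>0 < \<delta>\<close> \<delta>' by (intro main) (auto simp: \<eta>_def)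
      also have "\<dots> \<le> ennreal (2 powr s) * P \<delta>'" by (intro mult_left_mono Pmono) (auto simp: \<eta>_def)
      finally show ?thesis .
    qed
    then have "hausdorff_premeasure s \<delta> S \<le> ennreal (2 powr s) * (INF \<delta>'\<in>{0<..}. P \<delta>')"
      by (intro le_ennreal_cmult_INF) auto
    then show ?thesis unfolding packing_premeasure_def P_def .
  qed
  then show ?thesis unfolding hausdorff_measure_def by (intro SUP_least) auto
qed

text \<open>The comparison holds on each piece of a countable cover, and countable subadditivity of
  the Hausdorff premeasure adds the pieces up before the infimum over covers is taken.\<close>

lemma hausdorff_dim_le_packing_dim:
  fixes A :: "'a::euclidean_space set"
  shows "hausdorff_dim A \<le> packing_dim A"
  unfolding hausdorff_dim_def packing_dim_def
proof (rule Inf_superset_mono, safe)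
  fix s :: real assume s: "0 \<le> s" "packing_measure s A = 0"
  have "hausdorff_premeasure s \<delta> A \<le> 0" if \<delta>: "0 < \<delta>" for \<delta>
  proof -
    have "hausdorff_premeasure s \<delta> A \<le> ennreal (2 powr s) * packing_measure s A"
    proof -
      have "hausdorff_premeasure s \<delta> A \<le> ennreal (2 powr s) * (\<Sum>i. packing_premeasure s (S i))"
        if "A \<subseteq> (\<Union>i. S i)" for S
      proof -
        have "hausdorff_premeasure s \<delta> A \<le> hausdorff_premeasure s \<delta> (\<Union>i. S i)"
          unfolding hausdorff_premeasure_def using that by (intro INF_superset_mono) auto
        also have "\<dots> \<le> (\<Sum>i. hausdorff_premeasure s \<delta> (S i))" by (rule hausdorff_premeasure_UN_le)
        also have "\<dots> \<le> (\<Sum>i. ennreal (2 powr s) * packing_premeasure s (S i))"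
          by (intro suminf_le order_trans[OF hausdorff_premeasure_le_measure hausdorff_measure_le_packing_premeasure] \<delta> s) auto
        finally show ?thesis by simp
      qed
      then show ?thesis unfolding packing_measure_def by (intro le_ennreal_cmult_INF) auto
    qed
    then show ?thesis using s by simp
  qed
  then have "hausdorff_measure s A \<le> 0" unfolding hausdorff_measure_def by (intro SUP_least) auto
  then show "\<exists>t. ereal s = ereal t \<and> 0 \<le> t \<and> hausdorff_measure t A = 0" using s by auto
qed

subsection \<open>Box counting and energy estimates\<close>

text \<open>The point dividing the segment from x to y in the ratio r : r' would lie in both balls
  if the distance were at most r + r'. This uses segments and fails in general metric
  spaces.\<close>

lemma dist_gt_of_disjoint_cballs:
  fixes x y :: "'a::real_normed_vector"
  assumes "cball x r \<inter> cball y r' = {}" "0 < r" "0 < r'"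
  shows "r + r' < dist x y"
proof (rule ccontr)
  assume "\<not> r + r' < dist x y"
  then have le: "dist x y \<le> r + r'" by simp
  define z where "z = x + (r / (r + r')) *\<^sub>R (y - x)"
  have "dist x z = r / (r + r') * dist x y"
    using assms by (simp add: z_def dist_norm norm_minus_commute)
  also have "\<dots> \<le> r" using le assms mult_left_mono[OF le, of "r / (r + r')"] by simp
  finally have 1: "dist x z \<le> r" .
  have "y - z = (r' / (r + r')) *\<^sub>R (y - x)"
  proof -
    have "r' / (r + r') = 1 - r / (r + r')" using assms by (simp add: field_simps)
    then show ?thesis unfolding z_def by (simp add: scaleR_diff_left del: scaleR_diff_right)
  qed
  then have "dist y z = r' / (r + r') * dist x y"
    using assms by (simp add: dist_norm norm_minus_commute)
  also have "\<dots> \<le> r'" using le assms mult_left_mono[OF le, of "r' / (r + r')"] by simp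
  finally show False using 1 assms(1) by auto
qed

text \<open>The balls of a packing are sorted by the dyadic size of their radius. Centres at level k
  are more than 2^(-k) apart, so there are at most C * 2^(k s) of them, each of weight at most 2^s'
  * 2^(-k s'). Summing over k \<ge> K leaves the tail of a geometric series, which vanishes as K
  grows.\<close>

lemma packing_premeasure_eq_0I:
  fixes A :: "'a::euclidean_space set"
  assumes C: "0 \<le> C" and s: "0 \<le> s" "s < s'"
    and sep: "\<And>k F. kmin \<le> k \<Longrightarrow> finite F \<Longrightarrow> F \<subseteq> A \<Longrightarrow>
      (\<And>x y. x \<in> F \<Longrightarrow> y \<in> F \<Longrightarrow> x \<noteq> y \<Longrightarrow> (1/2) ^ k < dist x y) \<Longrightarrow>
      real (card F) \<le> C * 2 powr (real k * s)"
  shows "packing_premeasure s' A = 0"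
proof -
  define \<rho> :: real where "\<rho> = 2 powr (s - s')"
  have \<rho>: "0 < \<rho>" "\<rho> < 1" unfolding \<rho>_def using s powr_less_mono[of "s - s'" 0 2] by auto
  have half: "(1/2::real) ^ k = 2 powr (- real k)" for k
    by (simp add: powr_minus powr_realpow power_one_over inverse_eq_divide)
  have main: "(\<Sum>(x, r)\<in>B. ennreal ((2 * r) powr s')) \<le> ennreal (C * 2 powr s' * (\<rho> ^ K / (1 - \<rho>)))"
    if K: "kmin \<le> K" and B: "B \<in> ball_packings ((1/2) ^ K) A" for K B
  proof -
    \<comment> \<open>The level of r satisfies 2^(-kk r - 1) < r \<le> 2^(-kk r), so two radii of
      the same level k add up to more than 2^(-k).\<close>
    define kk where "kk r = nat \<lfloor>- log 2 r\<rfloor>" for r :: real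
    have finB: "finite B" and subB: "B \<subseteq> A \<times> {0<..(1/2) ^ K}"
      and disB: "disjoint_family_on (\<lambda>(x, r). cball x r) B"
      using B by (auto simp: ball_packings_def)
    have kk: "2 powr (- real (kk r) - 1) < r" "r \<le> 2 powr (- real (kk r))" "K \<le> kk r"
      if "(x, r) \<in> B" for x r
    proof -
      have r: "0 < r" "r \<le> 2 powr (- real K)" using that subB by (auto simp: half)
      then have l: "real K \<le> - log 2 r" using log_le_cancel_iff[of 2 r "2 powr (- real K)"] by simp
      have "real (kk r) = real_of_int \<lfloor>- log 2 r\<rfloor>" using l by (simp add: kk_def)
      then have "real (kk r) \<le> - log 2 r" "- log 2 r < real (kk r) + 1" by linarith+
      then have "- real (kk r) - 1 < log 2 r" "log 2 r \<le> - real (kk r)" by linarith+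
      then show "2 powr (- real (kk r) - 1) < r" "r \<le> 2 powr (- real (kk r))"
        using r by (simp_all add: less_log_iff log_le_iff)
      show "K \<le> kk r" using l by (simp add: kk_def le_nat_floor)
    qed
    have dist: "r + r' < dist x x'" if "(x, r) \<in> B" "(x', r') \<in> B" "(x, r) \<noteq> (x', r')" for x r x' r'
    proof (rule dist_gt_of_disjoint_cballs)
      show "cball x r \<inter> cball x' r' = {}" using disjoint_family_onD[OF disB that] by simp
    qed (use that subB in auto)
    \<comment> \<open>The packing is finite, so its levels are bounded and the sum over levels is
      finite.\<close>
    define N where "N = Suc (Max (insert 0 ((\<lambda>(x, r). kk r) ` B)))"
    have N: "kk r < K + N" if "(x, r) \<in> B" for x r
    proof -
      have "kk r \<le> Max (insert 0 ((\<lambda>(x, r). kk r) ` B))"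
        using finB that by (intro Max_ge) (auto simp: image_iff)
      then show ?thesis unfolding N_def by simp
    qed
    have level: "(\<Sum>p\<in>{p \<in> B. (\<lambda>(x, r). kk r) p = k}. (\<lambda>(x, r). (2 * r) powr s') p) \<le> C * 2 powr s' * \<rho> ^ k"
      if k: "k \<in> {K..<K + N}" for k
    proof -
      let ?L = "{p \<in> B. (\<lambda>(x, r). kk r) p = k}"
      have fL: "finite ?L" using finB by auto
      \<comment> \<open>Balls with a common centre intersect, so counting centres counts
        balls.\<close>
      have inj: "inj_on fst ?L"
      proof (rule inj_onI, rule ccontr)
        fix p q assume pq: "p \<in> ?L" "q \<in> ?L" "fst p = fst q" "p \<noteq> q"
        obtain x r r' where e: "p = (x, r)" "q = (x, r')" using pq(3) by (cases p, cases q) auto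
        have "r + r' < dist x x" using pq e by (intro dist) auto
        moreover have "0 < r" "0 < r'" using pq e subB by auto
        ultimately show False by simp
      qed
      have "real (card (fst ` ?L)) \<le> C * 2 powr (real k * s)"
      proof (rule sep)
        fix x y assume xy: "x \<in> fst ` ?L" "y \<in> fst ` ?L" "x \<noteq> y"
        then obtain r r' where e: "(x, r) \<in> B" "kk r = k" "(y, r') \<in> B" "kk r' = k" by auto
        then have "r + r' < dist x y" using xy by (intro dist) auto
        moreover have "2 powr (- real k - 1) < r" "2 powr (- real k - 1) < r'"
          using kk(1)[OF e(1)] kk(1)[OF e(3)] e by auto
        moreover have "2 powr (- real k) = 2 * 2 powr (- real k - 1)"
          by (simp add: powr_diff)
        ultimately show "(1/2) ^ k < dist x y" unfolding half by linarith
      qed (use fL subB K k in auto)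
      then have card: "real (card ?L) \<le> C * 2 powr (real k * s)" by (simp add: card_image[OF inj])
      have "(\<Sum>p\<in>?L. (\<lambda>(x, r). (2 * r) powr s') p) \<le> (\<Sum>p\<in>?L. 2 powr s' * 2 powr (- real k * s'))"
      proof (rule sum_mono)
        fix p assume p: "p \<in> ?L"
        obtain x r where e: "p = (x, r)" by (cases p)
        have "0 < r" using p e subB by auto
        moreover have "r \<le> 2 powr (- real k)" using kk(2)[of x r] p e by auto
        ultimately have "(2 * r) powr s' \<le> (2 * 2 powr (- real k)) powr s'" using s by (intro powr_mono2) auto
        also have "\<dots> = 2 powr s' * 2 powr (- real k * s')" by (simp add: powr_mult powr_powr)
        finally show "(\<lambda>(x, r). (2 * r) powr s') p \<le> 2 powr s' * 2 powr (- real k * s')" by (simp add: e)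
      qed
      also have "\<dots> = real (card ?L) * (2 powr s' * 2 powr (- real k * s'))" by simp
      also have "\<dots> \<le> (C * 2 powr (real k * s)) * (2 powr s' * 2 powr (- real k * s'))"
        by (intro mult_right_mono card) auto
      also have "\<dots> = C * 2 powr s' * (2 powr (real k * s) * 2 powr (- real k * s'))" by (simp add: mult_ac)
      also have "2 powr (real k * s) * 2 powr (- real k * s') = \<rho> ^ k"
        by (simp add: \<rho>_def powr_powr flip: powr_add powr_realpow) (simp add: algebra_simps)
      finally show ?thesis .
    qed
    have "(\<Sum>p\<in>B. (\<lambda>(x, r). (2 * r) powr s') p) =
        (\<Sum>k\<in>{K..<K + N}. \<Sum>p\<in>{p \<in> B. (\<lambda>(x, r). kk r) p = k}. (\<lambda>(x, r). (2 * r) powr s') p)"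
      using finB kk(3) N by (intro sum.group[symmetric]) auto
    also have "\<dots> \<le> (\<Sum>k\<in>{K..<K + N}. C * 2 powr s' * \<rho> ^ k)" by (intro sum_mono level)
    also have "\<dots> = C * 2 powr s' * (\<Sum>k\<in>{K..<K + N}. \<rho> ^ k)" by (simp add: sum_distrib_left)
    also have "(\<Sum>k\<in>{K..<K + N}. \<rho> ^ k) = \<rho> ^ K * (\<Sum>k<N. \<rho> ^ k)"
      by (simp add: sum.shift_bounds_nat_ivl[of _ 0 K N, simplified] atLeast0LessThan power_add sum_distrib_left
          add.commute[of K] mult.commute)
    also have "(\<Sum>k<N. \<rho> ^ k) = (1 - \<rho> ^ N) / (1 - \<rho>)" using \<rho> by (simp add: sum_gp_strict)
    also have "C * 2 powr s' * (\<rho> ^ K * ((1 - \<rho> ^ N) / (1 - \<rho>))) \<le> C * 2 powr s' * (\<rho> ^ K * (1 / (1 - \<rho>)))"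
      using \<rho> C by (intro mult_left_mono divide_right_mono) auto
    finally have "(\<Sum>p\<in>B. (\<lambda>(x, r). (2 * r) powr s') p) \<le> C * 2 powr s' * (\<rho> ^ K / (1 - \<rho>))" by simp
    moreover have "(\<Sum>(x, r)\<in>B. ennreal ((2 * r) powr s')) = ennreal (\<Sum>p\<in>B. (\<lambda>(x, r). (2 * r) powr s') p)"
      by (simp add: case_prod_beta flip: sum_ennreal)
    ultimately show ?thesis by (simp add: ennreal_leI)
  qed
  have le: "packing_premeasure s' A \<le> ennreal (C * 2 powr s' * (\<rho> ^ K / (1 - \<rho>)))" if "kmin \<le> K" for K
  proof -
    have "packing_premeasure s' A \<le> (SUP B \<in> ball_packings ((1/2) ^ K) A. \<Sum>(x, r)\<in>B. ennreal ((2 * r) powr s'))"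
      unfolding packing_premeasure_def by (rule INF_lower) auto
    also have "\<dots> \<le> ennreal (C * 2 powr s' * (\<rho> ^ K / (1 - \<rho>)))" by (intro SUP_least main that)
    finally show ?thesis .
  qed
  have "(\<lambda>K. ennreal (C * 2 powr s' * (\<rho> ^ K / (1 - \<rho>)))) \<longlonglongrightarrow> ennreal (C * 2 powr s' * (0 / (1 - \<rho>)))"
    using \<rho> by (intro tendsto_ennrealI tendsto_intros LIMSEQ_realpow_zero) auto
  then have "packing_premeasure s' A \<le> ennreal (C * 2 powr s' * (0 / (1 - \<rho>)))"
    by (rule LIMSEQ_le_const) (use le in blast)
  then show ?thesis by simp
qed

text \<open>The index of the half-open grid cube of side r that contains x. Restricting the function
  to \<open>Basis\<close> makes equality of indices a coordinatewise statement and lets indices be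
  counted in a finite \<open>PiE\<close>.\<close>

definition cell :: "real \<Rightarrow> 'a::euclidean_space \<Rightarrow> 'a \<Rightarrow> int" where
  "cell r x = (\<lambda>b\<in>Basis. \<lfloor>(x \<bullet> b) / r\<rfloor>)"

lemma cell_eq_imp_dist_less:
  fixes x y :: "'a::euclidean_space"
  assumes r: "0 < r" and eq: "cell r x = cell r y"
  shows "dist x y < real DIM('a) * r"
proof -
  have "\<bar>(x - y) \<bullet> b\<bar> < r" if "b \<in> Basis" for b
  proof -
    have "\<lfloor>(x \<bullet> b) / r\<rfloor> = \<lfloor>(y \<bullet> b) / r\<rfloor>" using fun_cong[OF eq, of b] that by (simp add: cell_def)
    then have "\<bar>(x \<bullet> b) / r - (y \<bullet> b) / r\<bar> < 1" by linarith
    then have "\<bar>(x \<bullet> b) - (y \<bullet> b)\<bar> / r < 1" using r by (simp add: diff_divide_distrib[symmetric] abs_divide)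
    then show ?thesis using r by (simp add: inner_diff_left)
  qed
  then have "(\<Sum>b\<in>Basis. \<bar>(x - y) \<bullet> b\<bar>) < (\<Sum>b\<in>(Basis::'a set). r)" by (intro sum_strict_mono) auto
  then show ?thesis unfolding dist_norm using norm_le_l1[of "x - y"] by simp
qed

text \<open>In each coordinate the floor takes at most 2 * R / r + 3 values, so the count is that of
  a product of integer intervals.\<close>

lemma card_cell_cball_le:
  fixes A :: "'a::euclidean_space set"
  assumes r: "0 < r" "0 \<le> R" and "\<And>x. x \<in> A \<Longrightarrow> norm (x - y) \<le> R" and "inj_on (cell r) A"
  shows "real (card A) \<le> (2 * R / r + 3) ^ DIM('a)"
proof -
  define I where "I b = {\<lfloor>(y \<bullet> b) / r - R / r\<rfloor>..\<lfloor>(y \<bullet> b) / r + R / r\<rfloor>}" for b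
  have sub: "cell r ` A \<subseteq> (\<Pi>\<^sub>E b\<in>Basis. I b)"
  proof (rule image_subsetI)
    fix x assume x: "x \<in> A"
    have "\<lfloor>(x \<bullet> b) / r\<rfloor> \<in> I b" if b: "b \<in> Basis" for b
    proof -
      have "\<bar>(x - y) \<bullet> b\<bar> \<le> R" using Basis_le_norm[OF b, of "x - y"] assms(3)[OF x] by linarith
      then have "(y \<bullet> b) - R \<le> x \<bullet> b" "x \<bullet> b \<le> (y \<bullet> b) + R" by (auto simp: inner_diff_left)
      then have "(y \<bullet> b) / r - R / r \<le> (x \<bullet> b) / r" "(x \<bullet> b) / r \<le> (y \<bullet> b) / r + R / r"
        using r by (auto simp flip: add_divide_distrib diff_divide_distrib intro: divide_right_mono)
      then show ?thesis by (auto simp: I_def intro: floor_mono)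
    qed
    then show "cell r x \<in> (\<Pi>\<^sub>E b\<in>Basis. I b)" by (auto simp: cell_def)
  qed
  have fin: "finite (\<Pi>\<^sub>E b\<in>(Basis::'a set). I b)" by (intro finite_PiE) (auto simp: I_def)
  have "card A = card (cell r ` A)" using assms(4) by (simp add: card_image)
  also have "\<dots> \<le> card (\<Pi>\<^sub>E b\<in>(Basis::'a set). I b)" by (rule card_mono[OF fin sub])
  also have "\<dots> = (\<Prod>b\<in>(Basis::'a set). card (I b))" by (rule card_PiE) simp
  finally have "real (card A) \<le> (\<Prod>b\<in>(Basis::'a set). real (card (I b)))" by (simp flip: of_nat_prod)
  also have "\<dots> \<le> (\<Prod>b\<in>(Basis::'a set). 2 * R / r + 3)"
  proof (intro prod_mono conjI)
    fix b :: 'a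
    have "0 \<le> R / r" using r by simp
    then show "real (card (I b)) \<le> 2 * R / r + 3" by (auto simp: I_def nat_le_iff) linarith
  qed auto
  finally show "real (card A) \<le> (2 * R / r + 3) ^ DIM('a)" by simp
qed

lemma packing_premeasure_bounded_eq_0:
  fixes A :: "'a::euclidean_space set"
  assumes A: "\<And>x. x \<in> A \<Longrightarrow> norm x \<le> R" and R: "0 \<le> R" and s: "real DIM('a) < s"
  shows "packing_premeasure s A = 0"
proof (rule packing_premeasure_eq_0I[where kmin = 0 and C = "(2 * R * DIM('a) + 3) ^ DIM('a)"])
  fix k :: nat and F assume F: "finite F" "F \<subseteq> A" and sep: "\<And>x y. x \<in> F \<Longrightarrow> y \<in> F \<Longrightarrow> x \<noteq> y \<Longrightarrow> (1/2) ^ k < dist x y"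
  \<comment> \<open>With this mesh the crude cell diameter DIM * r equals 2^(-k), so the points of F
    lie in different cells.\<close>
  define r :: real where "r = (1/2) ^ k / DIM('a)"
  have r: "0 < r" by (simp add: r_def)
  have "inj_on (cell r) F"
  proof (rule inj_onI, rule ccontr)
    fix x y assume xy: "x \<in> F" "y \<in> F" "cell r x = cell r y" "x \<noteq> y"
    with cell_eq_imp_dist_less[OF r xy(3)] sep[OF xy(1,2,4)] show False by (simp add: r_def)
  qed
  then have "real (card F) \<le> (2 * R / r + 3) ^ DIM('a)"
    using A F r R by (intro card_cell_cball_le[where y = 0]) auto
  also have "\<dots> \<le> ((2 * R * DIM('a) + 3) * 2 ^ k) ^ DIM('a)"
  proof (rule power_mono)
    have "2 * R / r = 2 * R * DIM('a) * 2 ^ k" by (simp add: r_def power_one_over field_simps)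
    moreover have "(3::real) \<le> 3 * 2 ^ k" by simp
    ultimately show "2 * R / r + 3 \<le> (2 * R * DIM('a) + 3) * 2 ^ k" by (simp add: distrib_right)
    show "0 \<le> 2 * R / r + 3" using r R by simp
  qed
  also have "\<dots> = (2 * R * DIM('a) + 3) ^ DIM('a) * 2 powr (real k * real DIM('a))"
    by (simp add: power_mult_distrib powr_powr[symmetric] powr_realpow)
  finally show "real (card F) \<le> (2 * R * DIM('a) + 3) ^ DIM('a) * 2 powr (real k * real DIM('a))" .
qed (use R s in auto)

text \<open>The inverse of \<open>D\<close> is constant across each jump of \<open>D\<close>, so the
  graph of X contains horizontal pieces; they lie in such segments and are one-dimensional.\<close>

lemma packing_premeasure_horizontal_segment_eq_0:
  fixes y :: "'a::euclidean_space"
  assumes "1 < s"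
  shows "packing_premeasure s ({0..1::real} \<times> {y}) = 0"
proof (rule packing_premeasure_eq_0I[where kmin = 0 and C = 5 and s = 1])
  fix k :: nat and F :: "(real \<times> 'a) set"
  assume F: "finite F" "F \<subseteq> {0..1} \<times> {y}" and sep: "\<And>x y. x \<in> F \<Longrightarrow> y \<in> F \<Longrightarrow> x \<noteq> y \<Longrightarrow> (1/2) ^ k < dist x y"
  have inj: "inj_on fst F" using F by (auto simp: inj_on_def)
  have "inj_on (cell ((1/2) ^ k)) (fst ` F)"
  proof (rule inj_onI, rule ccontr)
    fix a b :: real assume ab: "a \<in> fst ` F" "b \<in> fst ` F" "cell ((1/2) ^ k) a = cell ((1/2) ^ k) b" "a \<noteq> b"
    then have "(a, y) \<in> F" "(b, y) \<in> F" using F by auto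
    then have "(1/2) ^ k < dist (a, y) (b, y)" using ab by (intro sep) auto
    then show False using cell_eq_imp_dist_less[OF _ ab(3)] by (simp add: dist_Pair_Pair)
  qed
  then have "real (card (fst ` F)) \<le> (2 * 1 / (1/2) ^ k + 3) ^ DIM(real)"
    using F by (intro card_cell_cball_le[where y = 0]) auto
  then have "real (card F) \<le> 2 * 2 ^ k + 3" by (simp add: card_image[OF inj] power_one_over)
  also have "\<dots> \<le> 5 * 2 ^ k" by simp
  finally show "real (card F) \<le> 5 * 2 powr (real k * 1)" by (simp add: powr_realpow)
qed (use assms in auto)

text \<open>A dyadic substitute for x powr (-s): for s > 0 it is comparable to it on {0<..1}, zero
  above 1 and infinite at 0. As a sum of indicators it has an expectation that involves nothing but
  small ball probabilities.\<close>

definition riesz_kernel :: "real \<Rightarrow> real \<Rightarrow> ennreal" where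
  "riesz_kernel s x = (\<Sum>k. ennreal (2 powr (real k * s)) * indicator {..(1/2) ^ k} x)"

lemma riesz_kernel_measurable [measurable]: "riesz_kernel s \<in> borel_measurable borel"
  unfolding riesz_kernel_def by measurable

lemma le_riesz_kernel:
  assumes "x \<le> (1/2) ^ k"
  shows "ennreal (2 powr (real k * s)) \<le> riesz_kernel s x"
  unfolding riesz_kernel_def
  using sum_le_suminf[of "\<lambda>k. ennreal (2 powr (real k * s)) * indicator {..(1/2) ^ k} x" "{k}"] assms by auto

text \<open>The mass distribution principle, applied to the occupation measure of \<open>f\<close>.\<close>

lemma hausdorff_measure_image_pos:
  fixes f :: "real \<Rightarrow> 'b::euclidean_space"
  assumes [measurable]: "f \<in> borel_measurable borel" and T: "0 < T" and s: "0 < s"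
    and fin: "(\<integral>\<^sup>+t\<in>{0..T}. (\<integral>\<^sup>+u\<in>{0..T}. riesz_kernel s (dist (f t) (f u)) \<partial>lborel) \<partial>lborel) < \<infinity>"
  shows "hausdorff_measure s (f ` {0..T}) \<noteq> 0"
proof
  assume zero: "hausdorff_measure s (f ` {0..T}) = 0"
  define h where "h t = (\<integral>\<^sup>+u\<in>{0..T}. riesz_kernel s (dist (f t) (f u)) \<partial>lborel)" for t
  have h_meas [measurable]: "h \<in> borel_measurable borel" unfolding h_def by measurable
  \<comment> \<open>Times at which the potential of the occupation measure is at most n. They
    exhaust almost all of the interval, so some G n has positive length, and the occupation measure
    restricted to it satisfies a Frostman condition.\<close>
  define G where "G n = {t \<in> {0..T}. h t \<le> ennreal (real n)}" for n :: nat
  have G_meas [measurable]: "G n \<in> sets borel" for n unfolding G_def by measurable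
  have "AE t in lborel. h t * indicator {0..T} t \<noteq> \<infinity>"
    using fin unfolding h_def[symmetric] by (intro nn_integral_PInf_AE) auto
  then have "AE t in lborel. t \<in> {0..T} \<longrightarrow> t \<in> (\<Union>n. G n)"
  proof eventually_elim
    case (elim t)
    show ?case
    proof
      assume t: "t \<in> {0..T}"
      then have "h t < \<infinity>" using elim by (simp add: less_top)
      then obtain n :: nat where "h t \<le> of_nat n"
        using ennreal_Ex_less_of_nat[of "h t"] by (auto intro: less_imp_le)
      then show "t \<in> (\<Union>n. G n)" using t by (auto simp: G_def ennreal_of_nat_eq_real_of_nat)
    qed
  qed
  then have "emeasure lborel {0..T} \<le> emeasure lborel (\<Union>n. G n)"
    by (intro emeasure_mono_AE) auto
  then have "emeasure lborel (\<Union>n. G n) \<noteq> 0" using T by auto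
  then obtain n where n: "emeasure lborel (G n) \<noteq> 0"
    using emeasure_UN_eq_0[of lborel G] G_meas by fastforce
  have "emeasure lborel (G n) \<le> emeasure lborel {0..T}"
    by (intro emeasure_mono) (auto simp: G_def)
  then have finG: "emeasure lborel (G n) < \<infinity>" using T by (auto intro: le_less_trans)
  \<comment> \<open>Covering sets need not be measurable; their closures are Borel and have the same
    diameter.\<close>
  have [measurable]: "closure U \<in> sets borel" for U :: "'b set" by (simp add: borel_closed)
  \<comment> \<open>The factor 2 powr s pays for rounding a diameter to a dyadic scale, and adding 1
    keeps c positive when n = 0.\<close>
  define c where "c = real n * 2 powr s + 1"
  have c: "0 < c" unfolding c_def by (simp add: add_nonneg_pos)
  have mass: "emeasure lborel {t \<in> G n. f t \<in> closure U} \<le> ennreal c * diam_pow s U"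
    if U: "bounded U" "diameter U \<le> 1" for U
  proof (cases "U = {}")
    case True
    then show ?thesis by simp
  next
    case False
    define B where "B = {t \<in> G n. f t \<in> closure U}"
    have B_meas [measurable]: "B \<in> sets borel" unfolding B_def by measurable
    have key: "ennreal (2 powr (real k * s)) * emeasure lborel B \<le> ennreal (real n)"
      if "diameter U \<le> (1/2) ^ k" for k
    proof (cases "B = {}")
      case False
      then obtain t where t: "t \<in> B" by blast
      have "ennreal (2 powr (real k * s)) * emeasure lborel B = (\<integral>\<^sup>+u. ennreal (2 powr (real k * s)) * indicator B u \<partial>lborel)"
        by (simp add: nn_integral_cmult_indicator)
      also have "\<dots> \<le> h t" unfolding h_def
      proof (rule nn_integral_mono)
        fix u
        show "ennreal (2 powr (real k * s)) * indicator B u \<le> riesz_kernel s (dist (f t) (f u)) * indicator {0..T} u"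
        proof (cases "u \<in> B")
          case True
          have "dist (f t) (f u) \<le> diameter (closure U)"
            using True t U by (intro diameter_bounded_bound) (auto simp: B_def)
          also have "\<dots> \<le> (1/2) ^ k" using \<open>diameter U \<le> (1/2) ^ k\<close> U by (simp add: diameter_closure)
          finally show ?thesis using le_riesz_kernel[of "dist (f t) (f u)" k s] True
            by (simp add: B_def G_def indicator_def)
        qed auto
      qed
      also have "h t \<le> ennreal (real n)" using t by (simp add: B_def G_def)
      finally show ?thesis .
    qed simp
    have "emeasure lborel B \<le> emeasure lborel (G n)" by (intro emeasure_mono) (auto simp: B_def)
    then obtain m where m: "emeasure lborel B = ennreal m" "0 \<le> m"
      using finG by (cases "emeasure lborel B") (auto simp: top_unique)
    have key': "2 powr (real k * s) * m \<le> real n" if "diameter U \<le> (1/2) ^ k" for k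
      using key[OF that] m by (simp flip: ennreal_mult)
    show ?thesis
    \<comment> \<open>A set of diameter 0 obeys the bound at every scale k at once, which forces its
      mass to be 0.\<close>
    proof (cases "diameter U = 0")
      case True
      have "m = 0"
      proof (rule ccontr)
        assume "m \<noteq> 0"
        have "1 < 2 powr s" using s powr_less_mono[of 0 s 2] by simp
        then obtain k where "real n / m < (2 powr s) ^ k" using real_arch_pow by blast
        moreover have "(2 powr s) ^ k = 2 powr (real k * s)" by (simp add: powr_powr mult.commute flip: powr_realpow)
        ultimately show False using key'[of k] True m \<open>m \<noteq> 0\<close> by (simp add: divide_less_eq)
      qed
      then show ?thesis using m by (simp flip: B_def)
    next
      case False
      then have d: "0 < diameter U" using diameter_ge_0[OF U(1)] by simp
      define k where "k = nat \<lfloor>- log 2 (diameter U)\<rfloor>"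
      have "0 \<le> - log 2 (diameter U)" using d U(2) by simp
      then have "real k \<le> - log 2 (diameter U)" "- log 2 (diameter U) < real k + 1" unfolding k_def by linarith+
      then have lo: "- real k - 1 < log 2 (diameter U)" and hi: "log 2 (diameter U) \<le> - real k" by linarith+
      have "diameter U \<le> 2 powr (- real k)" using hi d by (simp add: log_le_iff)
      then have "diameter U \<le> (1/2) ^ k" by (simp add: powr_minus powr_realpow power_one_over inverse_eq_divide)
      from key'[OF this] have "m \<le> real n * 2 powr (- real k * s)"
        by (simp add: powr_minus field_simps)
      also have "\<dots> \<le> real n * (2 powr s * diameter U powr s)"
      proof (rule mult_left_mono)
        have "2 powr (- real k) \<le> 2 * diameter U" using lo d by (simp add: less_log_iff powr_diff)
        then have "(2 powr (- real k)) powr s \<le> (2 * diameter U) powr s" using s by (intro powr_mono2) auto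
        then show "2 powr (- real k * s) \<le> 2 powr s * diameter U powr s" using d by (simp add: powr_powr powr_mult)
      qed simp
      also have "\<dots> \<le> c * diameter U powr s" by (simp add: c_def algebra_simps)
      finally have "ennreal m \<le> ennreal (c * diameter U powr s)" by (rule ennreal_leI)
      also have "\<dots> = ennreal c * diam_pow s U" using c s \<open>U \<noteq> {}\<close> by (simp add: diam_pow_def ennreal_mult)
      finally show ?thesis using m by (simp flip: B_def)
    qed
  qed
  have "hausdorff_premeasure s 1 (f ` {0..T}) = 0"
    using hausdorff_premeasure_le_measure[of 1 s "f ` {0..T}"] zero by simp
  moreover have "0 < ennreal (1 / c) * emeasure lborel (G n)"
    using n c by (simp add: ennreal_zero_less_mult_iff zero_less_iff_neq_zero)
  ultimately have "hausdorff_premeasure s 1 (f ` {0..T}) < ennreal (1 / c) * emeasure lborel (G n)" by simp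
  then obtain U where U: "f ` {0..T} \<subseteq> (\<Union>i. U i)" "\<And>i. bounded (U i)" "\<And>i. diameter (U i) \<le> 1"
      and small: "(\<Sum>i. diam_pow s (U i)) < ennreal (1 / c) * emeasure lborel (G n)"
    using hausdorff_premeasure_lessE by metis
  have "emeasure lborel (G n) \<le> emeasure lborel (\<Union>i. {t \<in> G n. f t \<in> closure (U i)})"
  proof (rule emeasure_mono)
    show "G n \<subseteq> (\<Union>i. {t \<in> G n. f t \<in> closure (U i)})"
    proof
      fix t assume t: "t \<in> G n"
      then have "f t \<in> f ` {0..T}" by (simp add: G_def)
      then have "f t \<in> (\<Union>i. U i)" using U(1) by blast
      then show "t \<in> (\<Union>i. {t \<in> G n. f t \<in> closure (U i)})" using t closure_subset by blast
    qed
  qed measurable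
  also have "\<dots> \<le> (\<Sum>i. emeasure lborel {t \<in> G n. f t \<in> closure (U i)})"
    by (intro emeasure_subadditive_countably) auto
  also have "\<dots> \<le> (\<Sum>i. ennreal c * diam_pow s (U i))"
    by (intro suminf_le mass U) auto
  also have "\<dots> = ennreal c * (\<Sum>i. diam_pow s (U i))" by simp
  finally have "ennreal (1 / c) * emeasure lborel (G n) \<le> ennreal (1 / c) * (ennreal c * (\<Sum>i. diam_pow s (U i)))"
    by (rule mult_left_mono) simp
  also have "\<dots> = (\<Sum>i. diam_pow s (U i))" using c by (simp add: mult.assoc[symmetric] flip: ennreal_mult)
  finally show False using small by simp
qed

subsection \<open>Dimension lower bound for random images\<close>

text \<open>F is approximated by F at the next dyadic time q n t, which takes countably many values.
  The added 1 makes q n t strictly larger than t, so the limit is one along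
  \<open>at_right t\<close>.\<close>

lemma right_continuous_imp_jointly_measurable:
  fixes F :: "real \<Rightarrow> 'w \<Rightarrow> 'b::{metric_space, second_countable_topology}"
  assumes meas: "\<And>t. F t \<in> borel_measurable M"
    and rc: "\<And>t \<omega>. \<omega> \<in> space M \<Longrightarrow> continuous (at_right t) (\<lambda>t. F t \<omega>)"
  shows "(\<lambda>(t, \<omega>). F t \<omega>) \<in> borel_measurable (borel \<Otimes>\<^sub>M M)"
proof (rule borel_measurable_LIMSEQ_metric)
  define q where "q n t = (of_int (\<lfloor>2 ^ n * t\<rfloor> + 1) / 2 ^ n :: real)" for n :: nat and t :: real
  show "(\<lambda>(t, \<omega>). F (q n t) \<omega>) \<in> borel_measurable (borel \<Otimes>\<^sub>M M)" for n
  proof -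
    have "(\<lambda>p. F (of_int (\<lfloor>2 ^ n * (fst p :: real)\<rfloor> + 1) / 2 ^ n) (snd p)) \<in> borel_measurable (borel \<Otimes>\<^sub>M M)"
    proof (rule measurable_compose_countable[where f = "\<lambda>i p. F (of_int (i + 1) / 2 ^ n) (snd p)" and g = "\<lambda>p. \<lfloor>2 ^ n * (fst p :: real)\<rfloor>"])
      show "(\<lambda>p. F (of_int (i + 1) / 2 ^ n) (snd p)) \<in> borel_measurable (borel \<Otimes>\<^sub>M M)" for i
        using meas by (intro measurable_compose[OF measurable_snd]) auto
      show "(\<lambda>p. \<lfloor>2 ^ n * (fst p :: real)\<rfloor>) \<in> (borel \<Otimes>\<^sub>M M) \<rightarrow>\<^sub>M count_space UNIV" by measurable
    qed
    then show ?thesis by (simp add: q_def case_prod_beta)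
  qed
  fix p :: "real \<times> 'w" assume "p \<in> space (borel \<Otimes>\<^sub>M M)"
  then obtain t \<omega> where p: "p = (t, \<omega>)" and \<omega>: "\<omega> \<in> space M" by (auto simp: space_pair_measure)
  have q: "t < q n t" "q n t \<le> t + (1/2) ^ n" for n
  proof -
    have "2 ^ n * t < of_int (\<lfloor>2 ^ n * t\<rfloor> + 1)" "of_int (\<lfloor>2 ^ n * t\<rfloor> + 1) \<le> 2 ^ n * t + 1" by linarith+
    then show "t < q n t" "q n t \<le> t + (1/2) ^ n" by (simp_all add: q_def field_simps power_one_over)
  qed
  have "(\<lambda>n. q n t) \<longlonglongrightarrow> t"
  proof (rule tendsto_sandwich[of "\<lambda>_. t"])
    have "(\<lambda>n. t + (1/2) ^ n) \<longlonglongrightarrow> t + 0" by (intro tendsto_intros LIMSEQ_realpow_zero) auto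
    then show "(\<lambda>n. t + (1/2) ^ n) \<longlonglongrightarrow> t" by simp
  qed (use q in \<open>auto intro!: always_eventually less_imp_le\<close>)
  then have "filterlim (\<lambda>n. q n t) (at_right t) sequentially"
    using q(1) less_imp_neq[OF q(1), THEN not_sym] by (auto simp: filterlim_at intro!: always_eventually)
  moreover have "((\<lambda>t. F t \<omega>) \<longlongrightarrow> F t \<omega>) (at_right t)" using rc[OF \<omega>, of t] by (simp add: continuous_within)
  ultimately have "(\<lambda>n. F (q n t) \<omega>) \<longlonglongrightarrow> F t \<omega>" by (rule filterlim_compose[rotated])
  then show "(\<lambda>n. (\<lambda>(t, \<omega>). F (q n t) \<omega>) p) \<longlonglongrightarrow> (\<lambda>(t, \<omega>). F t \<omega>) p" by (simp add: p)
qed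

text \<open>Each side of the singularity contributes at most the integral of v powr (-\<eta>) over
  {0..T}; the bound does not depend on t.\<close>

lemma nn_integral_abs_diff_powr_le:
  fixes \<eta> T t :: real
  assumes \<eta>: "\<eta> < 1" and T: "0 < T" and t: "t \<in> {0..T}"
  shows "(\<integral>\<^sup>+u\<in>{0..T}. ennreal (\<bar>t - u\<bar> powr (- \<eta>)) \<partial>lborel) \<le> 2 * ennreal (T powr (1 - \<eta>) / (1 - \<eta>))"
proof -
  define g where "g v = ennreal (v powr (- \<eta>)) * indicator {0..T} v" for v :: real
  have g_meas [measurable]: "g \<in> borel_measurable borel" unfolding g_def by measurable
  have g: "(\<integral>\<^sup>+v. g v \<partial>lborel) = ennreal (T powr (1 - \<eta>) / (1 - \<eta>))"
    unfolding g_def using has_integral_powr_from_0[of "- \<eta>" T] \<eta> T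
    by (intro nn_integral_has_integral_lebesgue') auto
  have "(\<integral>\<^sup>+u\<in>{0..T}. ennreal (\<bar>t - u\<bar> powr (- \<eta>)) \<partial>lborel) \<le> (\<integral>\<^sup>+u. g (- t + 1 * u) + g (t + (-1) * u) \<partial>lborel)"
    using t by (intro nn_integral_mono) (auto simp: g_def indicator_def abs_if split: if_splits)
  also have "\<dots> = (\<integral>\<^sup>+u. g (- t + 1 * u) \<partial>lborel) + (\<integral>\<^sup>+u. g (t + (-1) * u) \<partial>lborel)"
    by (rule nn_integral_add) measurable
  also have "\<dots> = 2 * (\<integral>\<^sup>+v. g v \<partial>lborel)"
    using nn_integral_real_affine[of g 1 "- t"] nn_integral_real_affine[of g "-1" t] g_meas by (simp add: mult_2)
  finally show ?thesis by (simp add: g)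
qed

text \<open>The k-th term has expectation at most 2^(k s') * K * 2^(-k s), a geometric sequence
  because s' < s.\<close>

lemma (in prob_space) nn_integral_riesz_kernel_le:
  fixes X :: "'a \<Rightarrow> real"
  assumes X [measurable]: "random_variable borel X" and s: "s' < s" and K: "0 \<le> K"
    and bound: "\<And>r. 0 < r \<Longrightarrow> prob {\<omega> \<in> space M. X \<omega> \<le> r} \<le> K * r powr s"
  shows "(\<integral>\<^sup>+\<omega>. riesz_kernel s' (X \<omega>) \<partial>M) \<le> ennreal (K / (1 - 2 powr (s' - s)))"
proof -
  define \<rho> :: real where "\<rho> = 2 powr (s' - s)"
  have \<rho>: "0 < \<rho>" "\<rho> < 1" unfolding \<rho>_def using s powr_less_mono[of "s' - s" 0 2] by auto
  have "(\<integral>\<^sup>+\<omega>. riesz_kernel s' (X \<omega>) \<partial>M) =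
      (\<Sum>k. \<integral>\<^sup>+\<omega>. ennreal (2 powr (real k * s')) * indicator {..(1/2) ^ k} (X \<omega>) \<partial>M)"
    unfolding riesz_kernel_def by (rule nn_integral_suminf) measurable
  also have "\<dots> \<le> (\<Sum>k. ennreal (K * \<rho> ^ k))"
  proof (rule suminf_le)
    fix k :: nat
    have "(\<integral>\<^sup>+\<omega>. ennreal (2 powr (real k * s')) * indicator {..(1/2) ^ k} (X \<omega>) \<partial>M) =
        (\<integral>\<^sup>+\<omega>. ennreal (2 powr (real k * s')) * indicator {\<omega> \<in> space M. X \<omega> \<le> (1/2) ^ k} \<omega> \<partial>M)"
      by (intro nn_integral_cong) (auto simp: indicator_def)
    also have "\<dots> = ennreal (2 powr (real k * s') * prob {\<omega> \<in> space M. X \<omega> \<le> (1/2) ^ k})"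
      by (simp add: nn_integral_cmult_indicator emeasure_eq_measure ennreal_mult)
    also have "\<dots> \<le> ennreal (2 powr (real k * s') * (K * ((1/2) ^ k) powr s))"
      by (intro ennreal_leI mult_left_mono bound) auto
    also have "2 powr (real k * s') * (K * ((1/2) ^ k) powr s) = K * \<rho> ^ k"
    proof -
      have "((1/2::real) ^ k) = 2 powr (- real k)"
        by (simp add: powr_minus powr_realpow power_one_over inverse_eq_divide)
      then have "2 powr (real k * s') * ((1/2) ^ k) powr s = \<rho> ^ k"
        by (simp add: \<rho>_def powr_powr flip: powr_add powr_realpow) (simp add: algebra_simps)
      then show ?thesis by (simp add: mult_ac)
    qed
    finally show "(\<integral>\<^sup>+\<omega>. ennreal (2 powr (real k * s')) * indicator {..(1/2) ^ k} (X \<omega>) \<partial>M) \<le> ennreal (K * \<rho> ^ k)" .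
  qed auto
  also have "\<dots> = ennreal (K / (1 - \<rho>))"
    using sums_mult[OF geometric_sums[of \<rho>], of K] \<rho> K by (intro suminf_ennreal_eq) auto
  finally show ?thesis by (simp add: \<rho>_def)
qed

text \<open>By Fubini the expected energy of the occupation measure is at most a constant times the
  double integral of |t - u| powr (-\<eta>), finite since \<eta> < 1. Hence the energy is finite
  almost surely and the mass distribution principle applies path by path.\<close>

lemma (in prob_space) AE_hausdorff_measure_image_pos:
  fixes F :: "real \<Rightarrow> 'a \<Rightarrow> 'b::euclidean_space"
  assumes meas: "\<And>t. 0 \<le> t \<Longrightarrow> random_variable borel (F t)"
    and rc: "AE \<omega> in M. \<forall>t\<ge>0. continuous (at_right t) (\<lambda>t. F t \<omega>)"
    and T: "0 < T" and s: "0 < s'" "s' < s" and K: "0 \<le> K" and \<eta>: "\<eta> < 1"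
    and bound: "\<And>u t r. 0 \<le> u \<Longrightarrow> u < t \<Longrightarrow> t \<le> T \<Longrightarrow> 0 < r \<Longrightarrow>
       prob {\<omega> \<in> space M. dist (F u \<omega>) (F t \<omega>) \<le> r} \<le> K * r powr s * (t - u) powr (- \<eta>)"
  shows "AE \<omega> in M. hausdorff_measure s' ((\<lambda>t. F t \<omega>) ` {0..T}) \<noteq> 0"
proof -
  obtain N where N: "N \<in> null_sets M" and rcN: "\<And>\<omega> t. \<omega> \<in> space M - N \<Longrightarrow> 0 \<le> t \<Longrightarrow> continuous (at_right t) (\<lambda>t. F t \<omega>)"
    using AE_E3[OF rc] by metis
  have N_meas [measurable]: "N \<in> sets M" using N by auto
  \<comment> \<open>Joint measurability requires right continuity of every path at every real time,
    so F is replaced by 0 on the exceptional null set and frozen at its initial value for negative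
    times.\<close>
  define G where "G t \<omega> = (if \<omega> \<in> N then 0 else F (max 0 t) \<omega>)" for t \<omega>
  have G_rv [measurable]: "random_variable borel (G t)" for t
    unfolding G_def using meas[of "max 0 t"] by measurable
  have "continuous (at_right t) (\<lambda>t. G t \<omega>)" if "\<omega> \<in> space M" for t \<omega>
  proof (cases "\<omega> \<in> N")
    case True
    then show ?thesis by (simp add: G_def)
  next
    case False
    show ?thesis
    proof (cases "0 \<le> t")
      case True
      have "((\<lambda>t. F t \<omega>) \<longlongrightarrow> F t \<omega>) (at_right t)"
        using rcN[of \<omega> t] that False True by (simp add: continuous_within)
      then have "((\<lambda>t. G t \<omega>) \<longlongrightarrow> F t \<omega>) (at_right t)"
        by (rule Lim_transform_eventually) (use True False in \<open>auto simp: G_def eventually_at_filter\<close>)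
      then show ?thesis using True False by (simp add: continuous_within G_def)
    next
      case neg: False
      have "eventually (\<lambda>u. G t \<omega> = G u \<omega>) (at_right t)"
        using neg False eventually_at_right_real[of t 0] by (auto simp: G_def elim!: eventually_mono)
      then have "((\<lambda>t. G t \<omega>) \<longlongrightarrow> G t \<omega>) (at_right t)" by (rule tendsto_eventually[OF eventually_mono]) auto
      then show ?thesis by (simp add: continuous_within)
    qed
  qed
  then have joint: "(\<lambda>(t, \<omega>). G t \<omega>) \<in> borel_measurable (borel \<Otimes>\<^sub>M M)"
    by (intro right_continuous_imp_jointly_measurable) auto
  have joint' [measurable (raw)]: "(\<lambda>x. G (f x) (g x)) \<in> borel_measurable L"
    if "f \<in> borel_measurable L" "g \<in> L \<rightarrow>\<^sub>M M" for f g and L :: "'c measure"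
    using measurable_compose[OF measurable_Pair[OF that] joint] by simp
  define C where "C = K / (1 - 2 powr (s' - s))"
  define k where "k t u \<omega> = riesz_kernel s' (dist (G t \<omega>) (G u \<omega>)) * indicator {0..T} t * indicator {0..T} u" for t u \<omega>
  have k_meas [measurable (raw)]: "(\<lambda>x. k (f x) (g x) (h x)) \<in> borel_measurable L"
    if [measurable]: "f \<in> borel_measurable L" "g \<in> borel_measurable L" "h \<in> L \<rightarrow>\<^sub>M M" for f g h and L :: "'c measure"
    unfolding k_def by measurable
  have C: "0 \<le> C" unfolding C_def using K s powr_less_mono[of "s' - s" 0 2] by (intro divide_nonneg_nonneg) auto
  have inner: "(\<integral>\<^sup>+\<omega>. k t u \<omega> \<partial>M) \<le> ennreal C * (ennreal (\<bar>t - u\<bar> powr (- \<eta>)) * indicator {0..T} u) * indicator {0..T} t"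
    if "u \<noteq> t" for t u
  proof (cases "t \<in> {0..T} \<and> u \<in> {0..T}")
    case True
    have GF: "AE \<omega> in M. G t \<omega> = F t \<omega> \<and> G u \<omega> = F u \<omega>"
      using AE_not_in[OF N] by eventually_elim (use True in \<open>auto simp: G_def\<close>)
    have "prob {\<omega> \<in> space M. dist (G t \<omega>) (G u \<omega>) \<le> r} \<le> (K * \<bar>t - u\<bar> powr (- \<eta>)) * r powr s" if r: "0 < r" for r
    proof -
      have [measurable]: "random_variable borel (F t)" "random_variable borel (F u)" using meas True by auto
      have "prob {\<omega> \<in> space M. dist (G t \<omega>) (G u \<omega>) \<le> r} = prob {\<omega> \<in> space M. dist (F t \<omega>) (F u \<omega>) \<le> r}"
        using GF by (intro measure_eq_AE) auto
      also have "\<dots> = prob {\<omega> \<in> space M. dist (F (min t u) \<omega>) (F (max t u) \<omega>) \<le> r}"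
        by (auto simp: min_def max_def dist_commute)
      also have "\<dots> \<le> K * r powr s * (max t u - min t u) powr (- \<eta>)"
        using True \<open>u \<noteq> t\<close> r by (intro bound) auto
      also have "max t u - min t u = \<bar>t - u\<bar>" by auto
      finally show ?thesis by (simp add: mult_ac)
    qed
    then have "(\<integral>\<^sup>+\<omega>. riesz_kernel s' (dist (G t \<omega>) (G u \<omega>)) \<partial>M) \<le> ennreal ((K * \<bar>t - u\<bar> powr (- \<eta>)) / (1 - 2 powr (s' - s)))"
      using K s by (intro nn_integral_riesz_kernel_le) auto
    also have "\<dots> = ennreal C * ennreal (\<bar>t - u\<bar> powr (- \<eta>))"
      using C by (simp add: C_def flip: ennreal_mult)
    finally show ?thesis using True by (simp add: k_def)
  next
    case False
    then show ?thesis by (auto simp: k_def indicator_def)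
  qed
  interpret LM: pair_sigma_finite lborel M
    by (simp add: pair_sigma_finite_def sigma_finite_lborel sigma_finite_measure_axioms)
  have "(\<integral>\<^sup>+\<omega>. (\<integral>\<^sup>+t. \<integral>\<^sup>+u. k t u \<omega> \<partial>lborel \<partial>lborel) \<partial>M) = (\<integral>\<^sup>+t. \<integral>\<^sup>+\<omega>. \<integral>\<^sup>+u. k t u \<omega> \<partial>lborel \<partial>M \<partial>lborel)"
    by (intro LM.Fubini') measurable
  also have "\<dots> = (\<integral>\<^sup>+t. \<integral>\<^sup>+u. \<integral>\<^sup>+\<omega>. k t u \<omega> \<partial>M \<partial>lborel \<partial>lborel)"
    by (intro nn_integral_cong LM.Fubini') measurable
  also have "\<dots> \<le> (\<integral>\<^sup>+t. \<integral>\<^sup>+u. ennreal C * (ennreal (\<bar>t - u\<bar> powr (- \<eta>)) * indicator {0..T} u) * indicator {0..T} t \<partial>lborel \<partial>lborel)"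
  proof (rule nn_integral_mono, rule nn_integral_mono_AE)
    fix t
    \<comment> \<open>The small ball bound is available only off the diagonal, which is a null set
      for each t.\<close>
    show "AE u in lborel. (\<integral>\<^sup>+\<omega>. k t u \<omega> \<partial>M) \<le> ennreal C * (ennreal (\<bar>t - u\<bar> powr (- \<eta>)) * indicator {0..T} u) * indicator {0..T} t"
      using AE_lborel_singleton[of t] by eventually_elim (rule inner)
  qed
  also have "\<dots> = (\<integral>\<^sup>+t. ennreal C * (\<integral>\<^sup>+u\<in>{0..T}. ennreal (\<bar>t - u\<bar> powr (- \<eta>)) \<partial>lborel) * indicator {0..T} t \<partial>lborel)"
    by (intro nn_integral_cong) (simp add: nn_integral_multc nn_integral_cmult)
  also have "\<dots> \<le> (\<integral>\<^sup>+t. ennreal C * (2 * ennreal (T powr (1 - \<eta>) / (1 - \<eta>))) * indicator {0..T} t \<partial>lborel)"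
  proof (intro nn_integral_mono)
    fix t
    show "ennreal C * (\<integral>\<^sup>+u\<in>{0..T}. ennreal (\<bar>t - u\<bar> powr (- \<eta>)) \<partial>lborel) * indicator {0..T} t
        \<le> ennreal C * (2 * ennreal (T powr (1 - \<eta>) / (1 - \<eta>))) * indicator {0..T} t"
      using nn_integral_abs_diff_powr_le[OF \<eta> T, of t] by (auto simp: indicator_def intro!: mult_left_mono)
  qed
  also have "\<dots> < \<infinity>"
    using T by (simp add: nn_integral_cmult_indicator ennreal_mult_less_top ennreal_mult_eq_top_iff less_top)
  finally have fin: "(\<integral>\<^sup>+\<omega>. (\<integral>\<^sup>+t. \<integral>\<^sup>+u. k t u \<omega> \<partial>lborel \<partial>lborel) \<partial>M) < \<infinity>" .
  have "AE \<omega> in M. (\<integral>\<^sup>+t. \<integral>\<^sup>+u. k t u \<omega> \<partial>lborel \<partial>lborel) \<noteq> \<infinity>"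
    using fin by (intro nn_integral_PInf_AE) (auto simp: less_top, measurable)
  then show ?thesis using AE_not_in[OF N] AE_space
  proof eventually_elim
    case (elim \<omega>)
    have [measurable]: "(\<lambda>t. G t \<omega>) \<in> borel_measurable borel"
      using elim(3) by (intro joint') auto
    have eq: "(\<integral>\<^sup>+t. \<integral>\<^sup>+u. k t u \<omega> \<partial>lborel \<partial>lborel) =
        (\<integral>\<^sup>+t\<in>{0..T}. (\<integral>\<^sup>+u\<in>{0..T}. riesz_kernel s' (dist (G t \<omega>) (G u \<omega>)) \<partial>lborel) \<partial>lborel)"
      unfolding k_def
      by (intro nn_integral_cong, subst nn_integral_multc[symmetric]) (auto intro!: nn_integral_cong simp: mult_ac)
    have "hausdorff_measure s' ((\<lambda>t. G t \<omega>) ` {0..T}) \<noteq> 0"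
      using elim(1) T s unfolding eq by (intro hausdorff_measure_image_pos) (auto simp: less_top)
    moreover have "(\<lambda>t. G t \<omega>) ` {0..T} = (\<lambda>t. F t \<omega>) ` {0..T}"
      using elim(2) by (intro image_cong) (auto simp: G_def)
    ultimately show ?case by simp
  qed
qed

text \<open>Rational exponents below s give a common null set. A probability bound at an exponent s'
  strictly between q and s leaves room for the geometric series at q.\<close>

lemma (in prob_space) AE_hausdorff_dim_image_ge:
  fixes F :: "real \<Rightarrow> 'a \<Rightarrow> 'b::euclidean_space"
  assumes "\<And>t. 0 \<le> t \<Longrightarrow> random_variable borel (F t)"
    and "AE \<omega> in M. \<forall>t\<ge>0. continuous (at_right t) (\<lambda>t. F t \<omega>)"
    and "0 < T"
    and bound: "\<And>s'. 0 < s' \<Longrightarrow> s' < s \<Longrightarrow> \<exists>K \<eta>. 0 \<le> K \<and> \<eta> < 1 \<and>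
      (\<forall>u t r. 0 \<le> u \<longrightarrow> u < t \<longrightarrow> t \<le> T \<longrightarrow> 0 < r \<longrightarrow>
       prob {\<omega> \<in> space M. dist (F u \<omega>) (F t \<omega>) \<le> r} \<le> K * r powr s' * (t - u) powr (- \<eta>))"
  shows "AE \<omega> in M. ereal s \<le> hausdorff_dim ((\<lambda>t. F t \<omega>) ` {0..T})"
proof -
  have "AE \<omega> in M. \<forall>q\<in>{q\<in>\<rat>. 0 < q \<and> q < s}. hausdorff_measure q ((\<lambda>t. F t \<omega>) ` {0..T}) \<noteq> 0"
  proof (rule AE_ball_countable')
    fix q assume q: "q \<in> {q\<in>\<rat>. 0 < q \<and> q < s}"
    then obtain s' where s': "q < s'" "s' < s" using dense by blast
    from bound[of s'] s' q obtain K \<eta> where "0 \<le> K" "\<eta> < 1"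
      "\<And>u t r. 0 \<le> u \<Longrightarrow> u < t \<Longrightarrow> t \<le> T \<Longrightarrow> 0 < r \<Longrightarrow>
       prob {\<omega> \<in> space M. dist (F u \<omega>) (F t \<omega>) \<le> r} \<le> K * r powr s' * (t - u) powr (- \<eta>)"
      by force
    then show "AE \<omega> in M. hausdorff_measure q ((\<lambda>t. F t \<omega>) ` {0..T}) \<noteq> 0"
      using q s' assms(1-3) by (intro AE_hausdorff_measure_image_pos[where s = s']) auto
  qed (auto intro: countable_subset[OF _ countable_rat])
  then show ?thesis
  proof eventually_elim
    case (elim \<omega>)
    show ?case
    proof (rule hausdorff_dim_geI, rule notI)
      fix s' assume s': "0 < s'" "s' < s" and zero: "hausdorff_measure s' ((\<lambda>t. F t \<omega>) ` {0..T}) = 0"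
      obtain q where "q \<in> \<rat>" "s' < q" "q < s" using Rats_dense_in_real[OF s'(2)] by blast
      with elim s' hausdorff_measure_eq_0_mono[OF zero, of q] show False by force
    qed
  qed
qed

subsection \<open>Visited cells of a random walk\<close>

lemma cell_eq_iff: "cell r x = cell r y \<longleftrightarrow> (\<forall>b\<in>Basis. \<lfloor>(x \<bullet> b) / r\<rfloor> = \<lfloor>(y \<bullet> b) / r\<rfloor>)"
  by (auto simp: cell_def fun_eq_iff restrict_def)

lemma pred_cell_eq [measurable (raw)]:
  fixes X Y :: "'a \<Rightarrow> 'b::euclidean_space"
  assumes [measurable]: "X \<in> borel_measurable M" "Y \<in> borel_measurable M"
  shows "Measurable.pred M (\<lambda>\<omega>. cell r (X \<omega>) = cell r (Y \<omega>))"
  unfolding cell_eq_iff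
proof (rule pred_intros_finite(3))
  fix b :: 'b
  have [measurable]: "(\<lambda>\<omega>. (X \<omega> \<bullet> b) / r) \<in> borel_measurable M" "(\<lambda>\<omega>. (Y \<omega> \<bullet> b) / r) \<in> borel_measurable M"
    by simp_all
  have "(\<lambda>\<omega>. \<lfloor>(Y \<omega> \<bullet> b) / r\<rfloor>) \<in> M \<rightarrow>\<^sub>M count_space UNIV" by measurable
  moreover have "Measurable.pred M (\<lambda>\<omega>. \<lfloor>(X \<omega> \<bullet> b) / r\<rfloor> = i)" for i by measurable
  ultimately show "Measurable.pred M (\<lambda>\<omega>. \<lfloor>(X \<omega> \<bullet> b) / r\<rfloor> = \<lfloor>(Y \<omega> \<bullet> b) / r\<rfloor>)"
    by (rule measurable_compose_countable[rotated])
qed simp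

text \<open>The Markov property is recorded for deterministic times i, with an arbitrary event of
  the past and only ball events for the future. Summing over i turns it into a strong Markov
  property at first visits.\<close>

locale random_walk = prob_space +
  fixes S :: "nat \<Rightarrow> 'a \<Rightarrow> 'b::euclidean_space"
  assumes rv [measurable]: "random_variable borel (S i)"
    and markov: "B \<in> sets (PiM {..i} (\<lambda>_. borel)) \<Longrightarrow>
      prob {\<omega> \<in> space M. (\<lambda>k\<in>{..i}. S k \<omega>) \<in> B \<and> norm (S (i + j) \<omega> - S i \<omega>) \<le> r} =
      prob {\<omega> \<in> space M. (\<lambda>k\<in>{..i}. S k \<omega>) \<in> B} * prob {\<omega> \<in> space M. norm (S j \<omega>) \<le> r}"
begin

definition first_visit :: "real \<Rightarrow> nat \<Rightarrow> 'a \<Rightarrow> bool" where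
  "first_visit r i \<omega> \<longleftrightarrow> (\<forall>k\<in>{..<i}. cell r (S k \<omega>) \<noteq> cell r (S i \<omega>))"

lemma first_visit_measurable [measurable]: "Measurable.pred M (first_visit r i)"
proof -
  have "first_visit r i = (\<lambda>\<omega>. \<forall>k\<in>{..<i}. cell r (S k \<omega>) \<noteq> cell r (S i \<omega>))"
    by (simp add: fun_eq_iff first_visit_def)
  also have "Measurable.pred M \<dots>"
    by (rule pred_intros_finite(3)) (auto intro!: pred_intros_logic pred_cell_eq)
  finally show ?thesis .
qed

text \<open>A first visit at time i is decided by S 0, ..., S i, so it is an admissible past event.
  The set W serves to restrict attention to first visits inside a ball.\<close>

lemma markov_first_visit:
  assumes [measurable]: "W \<in> sets borel"
  shows "prob {\<omega> \<in> space M. first_visit r i \<omega> \<and> S i \<omega> \<in> W \<and> norm (S (i + j) \<omega> - S i \<omega>) \<le> r'} =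
   prob {\<omega> \<in> space M. first_visit r i \<omega> \<and> S i \<omega> \<in> W} * prob {\<omega> \<in> space M. norm (S j \<omega>) \<le> r'}"
proof -
  define B where "B = {p \<in> space (PiM {..i} (\<lambda>_. borel :: 'b measure)).
      (\<forall>k\<in>{..<i}. cell r (p k) \<noteq> cell r (p i)) \<and> p i \<in> W}"
  have [measurable]: "(\<lambda>p. p k) \<in> borel_measurable (PiM {..i} (\<lambda>_. borel :: 'b measure))" if "k \<in> {..i}" for k
    using that by (rule measurable_component_singleton)
  have "Measurable.pred (PiM {..i} (\<lambda>_. borel)) (\<lambda>p :: nat \<Rightarrow> 'b. (\<forall>k\<in>{..<i}. cell r (p k) \<noteq> cell r (p i)) \<and> p i \<in> W)"
    by (auto intro!: pred_intros_finite(3) pred_intros_logic pred_cell_eq pred_sets2[OF assms])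
  then have "B \<in> sets (PiM {..i} (\<lambda>_. borel))" unfolding B_def by (rule predE)
  moreover have "(\<lambda>k\<in>{..i}. S k \<omega>) \<in> B \<longleftrightarrow> first_visit r i \<omega> \<and> S i \<omega> \<in> W" for \<omega>
    by (simp add: B_def first_visit_def space_PiM)
  ultimately show ?thesis using markov[of B i j r'] by (simp only: conj_assoc)
qed

lemma inj_on_first_visit: "inj_on (\<lambda>i. cell r (S i \<omega>)) {i. first_visit r i \<omega>}"
proof (rule inj_onI, rule ccontr)
  fix i k assume *: "i \<in> {i. first_visit r i \<omega>}" "k \<in> {i. first_visit r i \<omega>}" "cell r (S i \<omega>) = cell r (S k \<omega>)" "i \<noteq> k"
  then consider "i < k" | "k < i" by linarith
  then show False by cases (use * in \<open>auto simp: first_visit_def\<close>)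
qed

text \<open>First visits at different times belong to different cells, so this is the number of
  cells reaching into a ball.\<close>

lemma card_first_visit_cball_le:
  assumes r: "0 < r" "0 \<le> R"
  shows "real (card {i\<in>{..<n}. first_visit r i \<omega> \<and> norm (S i \<omega> - y) \<le> R}) \<le> (2 * R / r + 3) ^ DIM('b)"
proof -
  let ?I = "{i\<in>{..<n}. first_visit r i \<omega> \<and> norm (S i \<omega> - y) \<le> R}"
  have inj: "inj_on (cell r \<circ> (\<lambda>i. S i \<omega>)) ?I"
    unfolding comp_def by (rule inj_on_subset[OF inj_on_first_visit]) auto
  have "real (card ((\<lambda>i. S i \<omega>) ` ?I)) \<le> (2 * R / r + 3) ^ DIM('b)"
    using r inj_on_imageI[OF inj] by (intro card_cell_cball_le[where y = y]) auto
  then show ?thesis unfolding card_image[OF inj_on_imageI2[OF inj]] .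
qed

lemma ex_first_visit:
  obtains i where "i \<le> l" "cell r (S i \<omega>) = cell r (S l \<omega>)" "first_visit r i \<omega>"
proof -
  define P where "P i \<longleftrightarrow> cell r (S i \<omega>) = cell r (S l \<omega>)" for i
  have "P l" by (simp add: P_def)
  then have P: "P (Least P)" "Least P \<le> l" by (rule LeastI, rule Least_le)
  have "\<not> P k" if "k < Least P" for k using not_less_Least[OF that] .
  then have "first_visit r (Least P) \<omega>" using P(1) by (auto simp: first_visit_def P_def)
  then show thesis using P that by (simp add: P_def)
qed

lemma visited_cells_eq:
  "(\<lambda>i. cell r (S i \<omega>)) ` {..<n} = (\<lambda>i. cell r (S i \<omega>)) ` {i\<in>{..<n}. first_visit r i \<omega>}"
proof safe
  fix l assume l: "l < n"
  obtain i where "i \<le> l" "cell r (S i \<omega>) = cell r (S l \<omega>)" "first_visit r i \<omega>" using ex_first_visit .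
  then show "cell r (S l \<omega>) \<in> (\<lambda>i. cell r (S i \<omega>)) ` {i \<in> {..<n}. first_visit r i \<omega>}"
    using l by (intro image_eqI[where x = i]) auto
qed auto

lemma card_visited_cells:
  "card ((\<lambda>i. cell r (S i \<omega>)) ` {..<n}) = card {i\<in>{..<n}. first_visit r i \<omega>}"
  unfolding visited_cells_eq by (intro card_image inj_on_subset[OF inj_on_first_visit]) auto

lemma integrable_card:
  assumes [measurable]: "\<And>i. Measurable.pred M (P i)" and "finite I"
  shows "integrable M (\<lambda>\<omega>. real (card {i\<in>I. P i \<omega>}))"
proof (rule integrable_const_bound)
  have "(\<lambda>\<omega>. real (card {i\<in>I. P i \<omega>})) = (\<lambda>\<omega>. \<Sum>i\<in>I. if P i \<omega> then 1 else 0)"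
    using assms(2) by (simp add: sum.If_cases Int_def)
  then show "random_variable borel (\<lambda>\<omega>. real (card {i\<in>I. P i \<omega>}))" by simp
  show "AE \<omega> in M. norm (real (card {i\<in>I. P i \<omega>})) \<le> real (card I)"
    using assms(2) by (auto intro!: card_mono)
qed

lemma sum_prob_eq_expectation_card:
  assumes [measurable]: "\<And>i. Measurable.pred M (P i)" and "finite I"
  shows "(\<Sum>i\<in>I. prob {\<omega> \<in> space M. P i \<omega>}) = expectation (\<lambda>\<omega>. real (card {i\<in>I. P i \<omega>}))"
proof -
  have "(\<Sum>i\<in>I. prob {\<omega> \<in> space M. P i \<omega>}) = (\<Sum>i\<in>I. expectation (indicator {\<omega> \<in> space M. P i \<omega>}))"
    by simp
  also have "\<dots> = expectation (\<lambda>\<omega>. \<Sum>i\<in>I. indicator {\<omega> \<in> space M. P i \<omega>} \<omega>)"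
    by (subst Bochner_Integration.integral_sum) (auto intro!: integrable_real_indicator simp: less_top[symmetric])
  also have "\<dots> = expectation (\<lambda>\<omega>. real (card {i\<in>I. P i \<omega>}))"
    using assms(2) by (intro Bochner_Integration.integral_cong refl) (simp add: indicator_def sum.If_cases Int_def)
  finally show ?thesis .
qed

lemma sum_prob_le:
  assumes [measurable]: "\<And>i. Measurable.pred M (P i)" and I: "finite I" and le: "\<And>\<omega>. \<omega> \<in> space M \<Longrightarrow> real (card {i\<in>I. P i \<omega>}) \<le> c"
  shows "(\<Sum>i\<in>I. prob {\<omega> \<in> space M. P i \<omega>}) \<le> c"
  unfolding sum_prob_eq_expectation_card[OF assms(1,2)]
  using le by (intro integral_le_const integrable_card assms) auto

text \<open>By the Markov property the product is the expected number of pairs (i, j) with a first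
  visit at i and S (i + j) within r of S i. Group the pairs by l = i + j: for each of the n + m
  values of l, the first visits within r of S l number at most 5^d, where 5 = 2 * r / r + 3.
  Dividing by the sojourn sum bounds the expected number of visited cells.\<close>

lemma sum_first_visit_mult_sojourn_le:
  assumes r: "0 < r"
  shows "(\<Sum>i<n. prob {\<omega> \<in> space M. first_visit r i \<omega>}) * (\<Sum>j<m. prob {\<omega> \<in> space M. norm (S j \<omega>) \<le> r})
    \<le> real (n + m) * 5 ^ DIM('b)"
proof -
  define Q where "Q p \<omega> \<longleftrightarrow> first_visit r (fst p) \<omega> \<and> norm (S (fst p + snd p) \<omega> - S (fst p) \<omega>) \<le> r" for p \<omega>
  have [measurable]: "Measurable.pred M (Q p)" for p unfolding Q_def by measurable
  have Q: "prob {\<omega> \<in> space M. Q (i, j) \<omega>} =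
     prob {\<omega> \<in> space M. first_visit r i \<omega>} * prob {\<omega> \<in> space M. norm (S j \<omega>) \<le> r}" for i j
    using markov_first_visit[of UNIV r i j r] by (simp add: Q_def)
  have "(\<Sum>i<n. prob {\<omega> \<in> space M. first_visit r i \<omega>}) * (\<Sum>j<m. prob {\<omega> \<in> space M. norm (S j \<omega>) \<le> r})
     = (\<Sum>i<n. \<Sum>j<m. prob {\<omega> \<in> space M. Q (i, j) \<omega>})"
    unfolding Q by (rule sum_product)
  also have "\<dots> = (\<Sum>p\<in>{..<n} \<times> {..<m}. prob {\<omega> \<in> space M. Q p \<omega>})"
    unfolding sum.cartesian_product by (intro sum.cong) auto
  also have "\<dots> \<le> real (n + m) * 5 ^ DIM('b)"
  proof (rule sum_prob_le)
    fix \<omega> assume "\<omega> \<in> space M"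
    let ?I = "\<lambda>l. {i\<in>{..<n}. first_visit r i \<omega> \<and> norm (S i \<omega> - S l \<omega>) \<le> r}"
    have "card {p \<in> {..<n} \<times> {..<m}. Q p \<omega>} \<le> card (SIGMA l:{..<n + m}. ?I l)"
    proof (rule card_inj_on_le)
      show "inj_on (\<lambda>(i, j). (i + j, i)) {p \<in> {..<n} \<times> {..<m}. Q p \<omega>}" by (auto simp: inj_on_def)
      show "(\<lambda>(i, j). (i + j, i)) ` {p \<in> {..<n} \<times> {..<m}. Q p \<omega>} \<subseteq> (SIGMA l:{..<n + m}. ?I l)"
        by (auto simp: Q_def norm_minus_commute)
    qed auto
    also have "\<dots> = (\<Sum>l<n + m. card (?I l))" by (rule card_SigmaI) auto
    finally have "real (card {p \<in> {..<n} \<times> {..<m}. Q p \<omega>}) \<le> (\<Sum>l<n + m. real (card (?I l)))"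
      by (simp flip: of_nat_sum)
    also have "\<dots> \<le> (\<Sum>l<n + m. 5 ^ DIM('b))"
    proof (rule sum_mono)
      fix l show "real (card (?I l)) \<le> 5 ^ DIM('b)"
        using card_first_visit_cball_le[of r r n \<omega> "S l \<omega>"] r by simp
    qed
    finally show "real (card {p \<in> {..<n} \<times> {..<m}. Q p \<omega>}) \<le> real (n + m) * 5 ^ DIM('b)" by simp
  qed auto
  finally show ?thesis .
qed

text \<open>A time l spent in the large ball is charged to the first visit to the cell of S l
  together with the time elapsed since then. At time l the walk is within d * r of its entry point,
  so each cell accounts for at most one expected sojourn near the origin, and the prefactor counts
  cells.\<close>

lemma sum_prob_ball_le_sojourn:
  fixes r R :: real
  assumes r: "0 < r" "0 \<le> R"
  shows "(\<Sum>l<n. prob {\<omega> \<in> space M. norm (S l \<omega>) \<le> R}) \<le>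
    (2 * (R + DIM('b) * r) / r + 3) ^ DIM('b) * (\<Sum>j<n. prob {\<omega> \<in> space M. norm (S j \<omega>) \<le> DIM('b) * r})"
proof -
  \<comment> \<open>The entry point of a cell may lie outside the ball of radius R, but by at most
    the cell diameter.\<close>
  define R' where "R' = R + DIM('b) * r"
  define Q where "Q p \<omega> \<longleftrightarrow> first_visit r (fst p) \<omega> \<and> norm (S (fst p) \<omega>) \<le> R' \<and>
      norm (S (fst p + snd p) \<omega> - S (fst p) \<omega>) \<le> DIM('b) * r" for p \<omega>
  have [measurable]: "Measurable.pred M (Q p)" for p unfolding Q_def by measurable
  have Q: "prob {\<omega> \<in> space M. Q (i, j) \<omega>} = prob {\<omega> \<in> space M. first_visit r i \<omega> \<and> norm (S i \<omega>) \<le> R'} *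
      prob {\<omega> \<in> space M. norm (S j \<omega>) \<le> DIM('b) * r}" for i j
    using markov_first_visit[of "cball 0 R'" r i j "DIM('b) * r"] by (simp add: Q_def)
  have "(\<Sum>l<n. prob {\<omega> \<in> space M. norm (S l \<omega>) \<le> R}) = expectation (\<lambda>\<omega>. real (card {l\<in>{..<n}. norm (S l \<omega>) \<le> R}))"
    by (rule sum_prob_eq_expectation_card) auto
  also have "\<dots> \<le> expectation (\<lambda>\<omega>. real (card {p\<in>{..<n} \<times> {..<n}. Q p \<omega>}))"
  proof (rule integral_mono[OF integrable_card integrable_card])
    fix \<omega> assume "\<omega> \<in> space M"
    have "\<forall>l. \<exists>i. i \<le> l \<and> cell r (S i \<omega>) = cell r (S l \<omega>) \<and> first_visit r i \<omega>"
      using ex_first_visit by blast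
    then obtain f where "\<forall>l. f l \<le> l \<and> cell r (S (f l) \<omega>) = cell r (S l \<omega>) \<and> first_visit r (f l) \<omega>"
      by (rule choice[THEN exE])
    then have fle: "f l \<le> l" and f: "cell r (S (f l) \<omega>) = cell r (S l \<omega>)" and fv: "first_visit r (f l) \<omega>" for l
      by blast+
    have "card {l\<in>{..<n}. norm (S l \<omega>) \<le> R} \<le> card {p\<in>{..<n} \<times> {..<n}. Q p \<omega>}"
    proof (rule card_inj_on_le)
      show "inj_on (\<lambda>l. (f l, l - f l)) {l\<in>{..<n}. norm (S l \<omega>) \<le> R}"
      proof (rule inj_onI)
        fix k l assume "(f k, k - f k) = (f l, l - f l)"
        then have "f k = f l" "k - f k = l - f l" by auto
        then show "k = l" using fle[of k] fle[of l] by linarith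
      qed
      show "(\<lambda>l. (f l, l - f l)) ` {l\<in>{..<n}. norm (S l \<omega>) \<le> R} \<subseteq> {p\<in>{..<n} \<times> {..<n}. Q p \<omega>}"
      proof (rule image_subsetI)
        fix l assume l: "l \<in> {l\<in>{..<n}. norm (S l \<omega>) \<le> R}"
        have d: "norm (S l \<omega> - S (f l) \<omega>) \<le> DIM('b) * r"
          using cell_eq_imp_dist_less[OF r(1) f[of l]] by (simp add: dist_norm norm_minus_commute)
        then have "norm (S (f l) \<omega>) \<le> R'"
          using norm_triangle_ineq4[of "S l \<omega>" "S l \<omega> - S (f l) \<omega>"] l by (simp add: R'_def)
        then show "(f l, l - f l) \<in> {p\<in>{..<n} \<times> {..<n}. Q p \<omega>}"
          using l d fle[of l] fv[of l] unfolding Q_def by (auto simp only: fst_conv snd_conv le_add_diff_inverse mem_Sigma_iff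
              lessThan_iff mem_Collect_eq intro: le_less_trans less_imp_diff_less)
      qed
    qed auto
    then show "real (card {l\<in>{..<n}. norm (S l \<omega>) \<le> R}) \<le> real (card {p\<in>{..<n} \<times> {..<n}. Q p \<omega>})"
      by (rule of_nat_mono)
  qed auto
  also have "\<dots> = (\<Sum>p\<in>{..<n} \<times> {..<n}. prob {\<omega> \<in> space M. Q p \<omega>})"
    by (rule sum_prob_eq_expectation_card[symmetric]) auto
  also have "\<dots> = (\<Sum>i<n. \<Sum>j<n. prob {\<omega> \<in> space M. Q (i, j) \<omega>})"
    unfolding sum.cartesian_product by (intro sum.cong) auto
  also have "\<dots> = (\<Sum>i<n. prob {\<omega> \<in> space M. first_visit r i \<omega> \<and> norm (S i \<omega>) \<le> R'}) *
      (\<Sum>j<n. prob {\<omega> \<in> space M. norm (S j \<omega>) \<le> DIM('b) * r})"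
    unfolding Q by (rule sum_product[symmetric])
  also have "\<dots> \<le> (2 * R' / r + 3) ^ DIM('b) * (\<Sum>j<n. prob {\<omega> \<in> space M. norm (S j \<omega>) \<le> DIM('b) * r})"
  proof (rule mult_right_mono[OF sum_prob_le])
    show "real (card {i \<in> {..<n}. first_visit r i \<omega> \<and> norm (S i \<omega>) \<le> R'}) \<le> (2 * R' / r + 3) ^ DIM('b)" for \<omega>
      using card_first_visit_cball_le[of r R' n \<omega> 0] r by (simp add: R'_def)
  qed (auto intro: sum_nonneg)
  finally show ?thesis unfolding R'_def .
qed

end

subsection \<open>Dimension upper bound for Levy processes\<close>

lemma levy_processD:
  assumes "levy_process M Y"
  shows "prob_space M"
    and "0 \<le> t \<Longrightarrow> Y t \<in> borel_measurable M"
    and "AE \<omega> in M. Y 0 \<omega> = 0"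
    and "0 \<le> \<tau> 0 \<Longrightarrow> mono_on {..n} \<tau> \<Longrightarrow>
      prob_space.indep_vars M (\<lambda>_. borel) (\<lambda>i \<omega>. Y (\<tau> (Suc i)) \<omega> - Y (\<tau> i) \<omega>) {..<n}"
    and "0 \<le> s \<Longrightarrow> 0 \<le> h \<Longrightarrow> distr M borel (\<lambda>\<omega>. Y (s + h) \<omega> - Y s \<omega>) = distr M borel (Y h)"
    and "AE \<omega> in M. cadlag (\<lambda>t. Y t \<omega>)"
    and "AE \<omega> in M. \<forall>t\<ge>0. continuous (at_right t) (\<lambda>t. Y t \<omega>)"
  using assms unfolding levy_process_def cadlag_def by auto

lemma levy_process_increment_measure:
  assumes Y: "levy_process M Y" and t: "0 \<le> s" "0 \<le> h" and A: "A \<in> sets borel"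
  shows "measure M {\<omega> \<in> space M. Y (s + h) \<omega> - Y s \<omega> \<in> A} = measure M {\<omega> \<in> space M. Y h \<omega> \<in> A}"
proof -
  have [measurable]: "Y (s + h) \<in> borel_measurable M" "Y s \<in> borel_measurable M" "Y h \<in> borel_measurable M"
    using levy_processD(2)[OF Y] t by auto
  have "measure (distr M borel (\<lambda>\<omega>. Y (s + h) \<omega> - Y s \<omega>)) A = measure (distr M borel (Y h)) A"
    using levy_processD(5)[OF Y t] by simp
  then show ?thesis using A by (simp add: measure_distr vimage_def Int_def conj_commute)
qed

text \<open>Past values of the walk are partial sums of increments that are independent of the later
  one. Subtracting Y 0, which vanishes only almost surely, makes the telescoping exact.\<close>

lemma levy_process_random_walk:
  fixes Y :: "real \<Rightarrow> 'w \<Rightarrow> 'b::euclidean_space"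
  assumes Y: "levy_process M Y" and h: "0 < h"
  shows "random_walk M (\<lambda>i \<omega>. Y (real i * h) \<omega> - Y 0 \<omega>)"
proof -
  interpret prob_space M by (rule levy_processD(1)[OF Y])
  have rv [measurable]: "random_variable borel (Y t)" if "0 \<le> t" for t using levy_processD(2)[OF Y that] .
  define S where "S i \<omega> = Y (real i * h) \<omega> - Y 0 \<omega>" for i \<omega>
  have S_rv [measurable]: "random_variable borel (S i)" for i unfolding S_def using rv[of "real i * h"] rv[of 0] h by simp
  have "random_walk M S"
  proof unfold_locales
    fix i j :: nat and B :: "(nat \<Rightarrow> 'b) set" and r :: real
    assume B: "B \<in> sets (PiM {..i} (\<lambda>_. borel))"
    \<comment> \<open>After i equidistant steps the grid jumps straight to (i + j) * h, so that the
      future is the single increment with index i.\<close>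
    define \<tau> where "\<tau> k = (if k \<le> i then real k * h else real (i + j) * h)" for k
    define X where "X k \<omega> = Y (\<tau> (Suc k)) \<omega> - Y (\<tau> k) \<omega>" for k \<omega>
    have "mono_on {..Suc i} \<tau>"
      using h by (auto simp: mono_on_def \<tau>_def intro!: mult_right_mono)
    then have ind: "indep_vars (\<lambda>_. borel) X {..<Suc i}"
      unfolding X_def[abs_def] by (intro levy_processD(4)[OF Y]) (simp add: \<tau>_def, assumption)
    have iv: "indep_var (PiM {..<i} (\<lambda>_. borel)) (\<lambda>\<omega>. \<lambda>k\<in>{..<i}. X k \<omega>) (PiM {i} (\<lambda>_. borel)) (\<lambda>\<omega>. \<lambda>k\<in>{i}. X k \<omega>)"
      by (rule indep_var_restrict[OF ind]) auto
    \<comment> \<open>Rebuilds the walk up to time i from its first i increments, turning a past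
      event B into an event P about increments.\<close>
    define \<phi> where "\<phi> p = (\<lambda>k\<in>{..i}. \<Sum>l<k. p l)" for p :: "nat \<Rightarrow> 'b"
    have [measurable]: "\<phi> \<in> PiM {..<i} (\<lambda>_. borel) \<rightarrow>\<^sub>M PiM {..i} (\<lambda>_. borel)"
      unfolding \<phi>_def
      by (intro measurable_restrict borel_measurable_sum measurable_component_singleton) auto
    define P where "P = \<phi> -` B \<inter> space (PiM {..<i} (\<lambda>_. borel))"
    have P: "P \<in> sets (PiM {..<i} (\<lambda>_. borel))" unfolding P_def using B by measurable
    define F where "F = {q \<in> space (PiM {i} (\<lambda>_. borel :: 'b measure)). norm (q i) \<le> r}"
    have F: "F \<in> sets (PiM {i} (\<lambda>_. borel))" unfolding F_def by measurable
    have sumX: "(\<Sum>l<k. X l \<omega>) = S k \<omega>" if "k \<le> i" for k \<omega>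
    proof -
      have "(\<Sum>l<k. X l \<omega>) = (\<Sum>l<k. Y (\<tau> (Suc l)) \<omega> - Y (\<tau> l) \<omega>)" by (simp add: X_def)
      also have "\<dots> = Y (\<tau> k) \<omega> - Y (\<tau> 0) \<omega>" by (rule sum_lessThan_telescope)
      finally show ?thesis using that by (simp add: S_def \<tau>_def)
    qed
    have memP: "(\<lambda>k\<in>{..<i}. X k \<omega>) \<in> P \<longleftrightarrow> (\<lambda>k\<in>{..i}. S k \<omega>) \<in> B" for \<omega>
    proof -
      have "\<phi> (\<lambda>k\<in>{..<i}. X k \<omega>) = (\<lambda>k\<in>{..i}. S k \<omega>)"
        unfolding \<phi>_def using sumX by (intro restrict_ext) simp
      then show ?thesis by (simp add: P_def space_PiM)
    qed
    have memF: "(\<lambda>k\<in>{i}. X k \<omega>) \<in> F \<longleftrightarrow> norm (S (i + j) \<omega> - S i \<omega>) \<le> r" for \<omega>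
    proof -
      have "X i \<omega> = S (i + j) \<omega> - S i \<omega>" by (simp add: X_def S_def \<tau>_def)
      then show ?thesis by (simp add: F_def space_PiM)
    qed
    have "prob {\<omega> \<in> space M. (\<lambda>k\<in>{..i}. S k \<omega>) \<in> B \<and> norm (S (i + j) \<omega> - S i \<omega>) \<le> r} =
        prob {\<omega> \<in> space M. (\<lambda>k\<in>{..i}. S k \<omega>) \<in> B} * prob {\<omega> \<in> space M. norm (S (i + j) \<omega> - S i \<omega>) \<le> r}"
      using indep_varD[OF iv P F] by (simp add: vimage_def memP memF Int_def conj_commute)
    also have "prob {\<omega> \<in> space M. norm (S (i + j) \<omega> - S i \<omega>) \<le> r} = prob {\<omega> \<in> space M. Y (real j * h) \<omega> \<in> cball 0 r}"
      using levy_process_increment_measure[OF Y, of "real i * h" "real j * h" "cball 0 r"] h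
      by (simp add: S_def distrib_right)
    also have "\<dots> = prob {\<omega> \<in> space M. norm (S j \<omega>) \<le> r}"
    proof (rule measure_eq_AE)
      show "AE \<omega> in M. \<omega> \<in> {\<omega> \<in> space M. Y (real j * h) \<omega> \<in> cball 0 r} \<longleftrightarrow> \<omega> \<in> {\<omega> \<in> space M. norm (S j \<omega>) \<le> r}"
        using levy_processD(3)[OF Y] by eventually_elim (simp add: S_def)
      show "{\<omega> \<in> space M. Y (real j * h) \<omega> \<in> cball 0 r} \<in> events"
        using measurable_sets[OF rv[of "real j * h"], of "cball 0 r"] h by (simp add: vimage_def Int_def conj_commute)
    qed measurable
    finally show "prob {\<omega> \<in> space M. (\<lambda>k\<in>{..i}. S k \<omega>) \<in> B \<and> norm (S (i + j) \<omega> - S i \<omega>) \<le> r} =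
        prob {\<omega> \<in> space M. (\<lambda>k\<in>{..i}. S k \<omega>) \<in> B} * prob {\<omega> \<in> space M. norm (S j \<omega>) \<le> r}" .
  qed (rule S_rv)
  then show ?thesis unfolding S_def .
qed

lemma levy_process_sojourn_eq:
  fixes Y :: "real \<Rightarrow> 'w \<Rightarrow> 'b::euclidean_space"
  assumes Y: "levy_process M Y" and t: "0 \<le> t"
  shows "measure M {\<omega> \<in> space M. norm (Y t \<omega> - Y 0 \<omega>) \<le> r} = measure M {\<omega> \<in> space M. norm (Y t \<omega>) \<le> r}"
proof (rule measure_eq_AE)
  have [measurable]: "Y t \<in> borel_measurable M" "Y 0 \<in> borel_measurable M" using levy_processD(2)[OF Y] t by auto
  show "{\<omega> \<in> space M. norm (Y t \<omega> - Y 0 \<omega>) \<le> r} \<in> sets M" "{\<omega> \<in> space M. norm (Y t \<omega>) \<le> r} \<in> sets M" by measurable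
  show "AE \<omega> in M. \<omega> \<in> {\<omega> \<in> space M. norm (Y t \<omega> - Y 0 \<omega>) \<le> r} \<longleftrightarrow> \<omega> \<in> {\<omega> \<in> space M. norm (Y t \<omega>) \<le> r}"
    using levy_processD(3)[OF Y] by eventually_elim simp
qed

text \<open>The times at which the finitely many points of F are attained can be moved slightly to
  the right onto a dyadic grid. By right continuity the strict separation survives on a fine enough
  grid, and points more than \<delta> apart occupy different cells. The shift y accommodates a walk
  that starts at Z 0.\<close>

lemma separated_image_le_dyadic:
  fixes z :: "real \<Rightarrow> 'b::euclidean_space" and r \<delta> :: real
  assumes rc: "\<And>t. 0 \<le> t \<Longrightarrow> continuous (at_right t) z" and T: "0 \<le> T" and F: "finite F" "F \<subseteq> z ` {0..T}"
    and sep: "\<And>x y. x \<in> F \<Longrightarrow> y \<in> F \<Longrightarrow> x \<noteq> y \<Longrightarrow> \<delta> < dist x y" and r: "0 < r" "DIM('b) * r \<le> \<delta>"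
  shows "\<exists>m. card F \<le> card ((\<lambda>i. cell r (z (real i * (1/2) ^ m) - y)) ` {..<nat \<lceil>(T + 1) * 2 ^ m\<rceil>})"
proof -
  have "\<forall>x\<in>F. \<exists>t\<in>{0..T}. z t = x" using F(2) by blast
  then obtain t where t: "\<And>x. x \<in> F \<Longrightarrow> t x \<in> {0..T}" "\<And>x. x \<in> F \<Longrightarrow> z (t x) = x" by metis
  \<comment> \<open>The added 1 puts the grid point strictly to the right of t x, where right
    continuity can be used.\<close>
  define q where "q m x = nat \<lfloor>2 ^ m * t x\<rfloor> + 1" for m x
  have q: "t x < real (q m x) * (1/2) ^ m" "real (q m x) * (1/2) ^ m \<le> t x + (1/2) ^ m" if "x \<in> F" for m x
  proof -
    have "0 \<le> 2 ^ m * t x" using t(1)[OF that] by simp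
    then have "2 ^ m * t x < real (q m x)" "real (q m x) \<le> 2 ^ m * t x + 1" unfolding q_def by linarith+
    then show "t x < real (q m x) * (1/2) ^ m" "real (q m x) * (1/2) ^ m \<le> t x + (1/2) ^ m"
      by (simp_all add: field_simps power_one_over)
  qed
  have lim: "(\<lambda>m. z (real (q m x) * (1/2) ^ m)) \<longlonglongrightarrow> x" if x: "x \<in> F" for x
  proof -
    have "(\<lambda>m. real (q m x) * (1/2) ^ m) \<longlonglongrightarrow> t x"
    proof (rule tendsto_sandwich[of "\<lambda>_. t x"])
      have "(\<lambda>n. t x + (1/2) ^ n) \<longlonglongrightarrow> t x + 0" by (intro tendsto_intros LIMSEQ_realpow_zero) auto
      then show "(\<lambda>n. t x + (1/2) ^ n) \<longlonglongrightarrow> t x" by simp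
    qed (use q[OF x] in \<open>auto intro!: always_eventually less_imp_le\<close>)
    then have "filterlim (\<lambda>m. real (q m x) * (1/2) ^ m) (at_right (t x)) sequentially"
      using q(1)[OF x] less_imp_neq[OF q(1)[OF x], THEN not_sym] by (auto simp: filterlim_at intro!: always_eventually)
    moreover have "(z \<longlongrightarrow> x) (at_right (t x))" using rc[of "t x"] t[OF x] by (simp add: continuous_within)
    ultimately show ?thesis by (rule filterlim_compose[rotated])
  qed
  have "eventually (\<lambda>m. \<forall>x\<in>F. \<forall>y\<in>F. x \<noteq> y \<longrightarrow> \<delta> < dist (z (real (q m x) * (1/2) ^ m)) (z (real (q m y) * (1/2) ^ m))) sequentially"
  proof (intro eventually_ball_finite ballI F(1))
    fix x y assume xy: "x \<in> F" "y \<in> F"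
    show "eventually (\<lambda>m. x \<noteq> y \<longrightarrow> \<delta> < dist (z (real (q m x) * (1/2) ^ m)) (z (real (q m y) * (1/2) ^ m))) sequentially"
    proof (cases "x = y")
      case False
      have "(\<lambda>m. dist (z (real (q m x) * (1/2) ^ m)) (z (real (q m y) * (1/2) ^ m))) \<longlonglongrightarrow> dist x y"
        by (intro tendsto_dist lim xy)
      from order_tendstoD(1)[OF this sep[OF xy False]] show ?thesis by (rule eventually_mono) simp
    qed simp
  qed
  \<comment> \<open>With m \<ge> 1 the displacement is at most 1/2, so the moved times stay strictly
    below T + 1.\<close>
  moreover have "eventually (\<lambda>m::nat. 1 \<le> m) sequentially" by (rule eventually_ge_at_top)
  ultimately have "eventually (\<lambda>m. 1 \<le> m \<and> (\<forall>x\<in>F. \<forall>y\<in>F. x \<noteq> y \<longrightarrow> \<delta> < dist (z (real (q m x) * (1/2) ^ m)) (z (real (q m y) * (1/2) ^ m)))) sequentially"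
    by eventually_elim simp
  then obtain m where m: "1 \<le> m" and
      d: "\<And>x y. x \<in> F \<Longrightarrow> y \<in> F \<Longrightarrow> x \<noteq> y \<Longrightarrow> \<delta> < dist (z (real (q m x) * (1/2) ^ m)) (z (real (q m y) * (1/2) ^ m))"
    by (auto simp: eventually_sequentially)
  have "card F \<le> card ((\<lambda>i. cell r (z (real i * (1/2) ^ m) - y)) ` {..<nat \<lceil>(T + 1) * 2 ^ m\<rceil>})"
  proof (rule card_inj_on_le)
    show "inj_on (\<lambda>x. cell r (z (real (q m x) * (1/2) ^ m) - y)) F"
    proof (rule inj_onI, rule ccontr)
      fix x x' assume x: "x \<in> F" "x' \<in> F" "x \<noteq> x'"
        "cell r (z (real (q m x) * (1/2) ^ m) - y) = cell r (z (real (q m x') * (1/2) ^ m) - y)"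
      from cell_eq_imp_dist_less[OF r(1) x(4)] d[OF x(1-3)] r(2) show False by (simp add: dist_norm)
    qed
    show "(\<lambda>x. cell r (z (real (q m x) * (1/2) ^ m) - y)) ` F \<subseteq> (\<lambda>i. cell r (z (real i * (1/2) ^ m) - y)) ` {..<nat \<lceil>(T + 1) * 2 ^ m\<rceil>}"
    proof (rule image_subsetI)
      fix x assume x: "x \<in> F"
      have "(1/2::real) ^ m \<le> 1 / 2" using m power_decreasing[of 1 m "1/2::real"] by simp
      then have "real (q m x) * (1/2) ^ m < T + 1" using q(2)[OF x, of m] t(1)[OF x] by simp
      then have "real (q m x) < (T + 1) * 2 ^ m" by (simp add: field_simps power_one_over)
      then have "q m x < nat \<lceil>(T + 1) * 2 ^ m\<rceil>" by linarith
      then show "cell r (z (real (q m x) * (1/2) ^ m) - y) \<in> (\<lambda>i. cell r (z (real i * (1/2) ^ m) - y)) ` {..<nat \<lceil>(T + 1) * 2 ^ m\<rceil>}"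
        by blast
    qed
  qed simp
  then show ?thesis by blast
qed


text \<open>The hypothesis \<open>low\<close> says that, on each dyadic time grid, the expected
  sojourn in a ball of radius r is at least of order r^s. Hence the expected number of visited cells
  of mesh about 2^(-k) is at most C * 2^(k s), uniformly in the time grid. This makes the number
  finite in the limit and, at the cost of an arbitrarily larger exponent, bounded for all k on
  almost every path.\<close>

lemma levy_process_AE_packing_premeasure_eq_0:
  fixes Z :: "real \<Rightarrow> 'w \<Rightarrow> 'b::euclidean_space"
  assumes Z: "levy_process M Z" and c: "0 < c" and s: "0 \<le> s" and T: "0 \<le> T"
    and low: "\<And>r m. 0 < r \<Longrightarrow> r \<le> 1 \<Longrightarrow>
      c * r powr s * 2 ^ m \<le> (\<Sum>j<2 ^ m. measure M {\<omega> \<in> space M. norm (Z (real j * (1/2) ^ m) \<omega>) \<le> r})"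
  shows "AE \<omega> in M. \<forall>s'>s. packing_premeasure s' ((\<lambda>t. Z t \<omega>) ` {0..T}) = 0"
proof -
  interpret prob_space M by (rule levy_processD(1)[OF Z])
  define d where "d = real DIM('b)"
  have d: "1 \<le> d" using DIM_positive[where 'a='b] by (simp add: d_def del: DIM_positive)
  define n where "n m = nat \<lceil>(T + 1) * 2 ^ m\<rceil>" for m :: nat
  have n: "real (n m) \<le> (T + 2) * 2 ^ m" "i < n m \<longleftrightarrow> real i < (T + 1) * 2 ^ m" for m i
  proof -
    have "0 \<le> (T + 1) * 2 ^ m" using T by simp
    then have "real (n m) < (T + 1) * 2 ^ m + 1" unfolding n_def by linarith
    moreover have "(1::real) \<le> 2 ^ m" by simp
    moreover have "(T + 2) * 2 ^ m = (T + 1) * 2 ^ m + 2 ^ m" by (simp add: algebra_simps)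
    ultimately show "real (n m) \<le> (T + 2) * 2 ^ m" by linarith
    show "i < n m \<longleftrightarrow> real i < (T + 1) * 2 ^ m" unfolding n_def by linarith
  qed
  define \<rho> where "\<rho> k = (1/2) ^ k / d" for k :: nat
  have \<rho>: "0 < \<rho> k" "\<rho> k \<le> 1" for k
  proof -
    show "0 < \<rho> k" using d by (simp add: \<rho>_def)
    have "(1/2) ^ k \<le> (1::real)" by (simp add: power_le_one)
    then show "\<rho> k \<le> 1" using d by (simp add: \<rho>_def divide_le_eq)
  qed
  \<comment> \<open>T + 3 bounds (n m + 2^m) / 2^m, the power of 5 is the overlap constant of the
    counting lemma, and d powr s undoes the division by d in \<rho>.\<close>
  define C where "C = (T + 3) * 5 ^ DIM('b) * d powr s / c"
  have C: "0 \<le> C" using T c by (simp add: C_def)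
  define S where "S m i \<omega> = Z (real i * (1/2) ^ m) \<omega> - Z 0 \<omega>" for m i \<omega>
  have rw: "random_walk M (S m)" for m unfolding S_def by (rule levy_process_random_walk[OF Z]) simp
  define V where "V k m \<omega> = card ((\<lambda>i. cell (\<rho> k) (S m i \<omega>)) ` {..<n m})" for k m \<omega>
  have V_eq: "V k m \<omega> = card {i\<in>{..<n m}. random_walk.first_visit (S m) (\<rho> k) i \<omega>}" for k m \<omega>
    unfolding V_def by (rule random_walk.card_visited_cells[OF rw])
  have V_int: "integrable M (\<lambda>\<omega>. real (V k m \<omega>))" for k m
    unfolding V_eq by (intro random_walk.integrable_card[OF rw] random_walk.first_visit_measurable[OF rw]) simp
  have V_exp: "expectation (\<lambda>\<omega>. real (V k m \<omega>)) \<le> C * 2 powr (real k * s)" for k m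
  proof -
    define G where "G = (\<Sum>j<2 ^ m. prob {\<omega> \<in> space M. norm (S m j \<omega>) \<le> \<rho> k})"
    have "expectation (\<lambda>\<omega>. real (V k m \<omega>)) = (\<Sum>i<n m. prob {\<omega> \<in> space M. random_walk.first_visit (S m) (\<rho> k) i \<omega>})"
      unfolding V_eq
      by (intro random_walk.sum_prob_eq_expectation_card[OF rw, symmetric] random_walk.first_visit_measurable[OF rw]) simp
    then have le: "expectation (\<lambda>\<omega>. real (V k m \<omega>)) * G \<le> real (n m + 2 ^ m) * 5 ^ DIM('b)"
      unfolding G_def using random_walk.sum_first_visit_mult_sojourn_le[OF rw \<rho>(1), where n = "n m" and m = "2 ^ m"] by simp
    have "G = (\<Sum>j<2 ^ m. prob {\<omega> \<in> space M. norm (Z (real j * (1/2) ^ m) \<omega>) \<le> \<rho> k})"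
      unfolding G_def S_def by (intro sum.cong levy_process_sojourn_eq[OF Z] refl) simp
    then have G: "c * \<rho> k powr s * 2 ^ m \<le> G" using low[OF \<rho>] by simp
    have "expectation (\<lambda>\<omega>. real (V k m \<omega>)) * (c * \<rho> k powr s * 2 ^ m) \<le> expectation (\<lambda>\<omega>. real (V k m \<omega>)) * G"
      using G by (intro mult_left_mono) auto
    also have "\<dots> \<le> real (n m + 2 ^ m) * 5 ^ DIM('b)" by (rule le)
    also have "\<dots> \<le> ((T + 3) * 2 ^ m) * 5 ^ DIM('b)" using n(1)[of m] by (intro mult_right_mono) (auto simp: algebra_simps)
    finally have "(expectation (\<lambda>\<omega>. real (V k m \<omega>)) * (c * \<rho> k powr s)) * 2 ^ m \<le> ((T + 3) * 5 ^ DIM('b)) * 2 ^ m"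
      by (simp add: mult_ac)
    then have "expectation (\<lambda>\<omega>. real (V k m \<omega>)) * (c * \<rho> k powr s) \<le> (T + 3) * 5 ^ DIM('b)" by simp
    moreover have "0 < c * \<rho> k powr s" using c \<rho>(1)[of k] by simp
    ultimately have "expectation (\<lambda>\<omega>. real (V k m \<omega>)) \<le> (T + 3) * 5 ^ DIM('b) / (c * \<rho> k powr s)" by (simp add: pos_le_divide_eq)
    also have "\<dots> = C * 2 powr (real k * s)"
    proof -
      have "(1/2::real) ^ k = 2 powr (- real k)"
        by (simp add: powr_minus powr_realpow power_one_over inverse_eq_divide)
      then have "\<rho> k powr s = 2 powr (- (real k * s)) / d powr s" using d by (simp add: \<rho>_def powr_divide powr_powr)
      then show ?thesis by (simp add: C_def powr_minus field_simps)
    qed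
    finally show ?thesis .
  qed
  \<comment> \<open>The time grids are nested, so the counts increase with m and monotone
    convergence keeps the bound on the expectation.\<close>
  define W where "W k \<omega> = (SUP m. ennreal (real (V k m \<omega>)))" for k \<omega>
  have V_meas [measurable]: "(\<lambda>\<omega>. real (V k m \<omega>)) \<in> borel_measurable M" for k m
    using V_int[of k m] by auto
  have W_meas [measurable]: "W k \<in> borel_measurable M" for k
    unfolding W_def by measurable
  have V_mono: "V k m \<omega> \<le> V k (Suc m) \<omega>" for k m \<omega>
    unfolding V_def
  proof (rule card_mono)
    show "(\<lambda>i. cell (\<rho> k) (S m i \<omega>)) ` {..<n m} \<subseteq> (\<lambda>i. cell (\<rho> k) (S (Suc m) i \<omega>)) ` {..<n (Suc m)}"
    proof (rule image_subsetI)
      fix i assume "i \<in> {..<n m}"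
      then have "2 * i \<in> {..<n (Suc m)}" using n(2)[of i m] n(2)[of "2 * i" "Suc m"] by simp
      moreover have "S m i \<omega> = S (Suc m) (2 * i) \<omega>" by (simp add: S_def)
      ultimately show "cell (\<rho> k) (S m i \<omega>) \<in> (\<lambda>i. cell (\<rho> k) (S (Suc m) i \<omega>)) ` {..<n (Suc m)}" by auto
    qed
  qed simp
  have W_int: "(\<integral>\<^sup>+\<omega>. W k \<omega> \<partial>M) \<le> ennreal (C * 2 powr (real k * s))" for k
  proof -
    have "(\<integral>\<^sup>+\<omega>. W k \<omega> \<partial>M) = (SUP m. \<integral>\<^sup>+\<omega>. ennreal (real (V k m \<omega>)) \<partial>M)"
      unfolding W_def using V_mono
      by (intro nn_integral_monotone_convergence_SUP incseq_SucI le_funI ennreal_leI of_nat_mono) auto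
    also have "\<dots> \<le> ennreal (C * 2 powr (real k * s))"
    proof (rule SUP_least)
      fix m
      show "(\<integral>\<^sup>+\<omega>. ennreal (real (V k m \<omega>)) \<partial>M) \<le> ennreal (C * 2 powr (real k * s))"
        using V_exp[of k m] by (subst nn_integral_eq_integral[OF V_int]) (auto intro: ennreal_leI)
    qed
    finally show ?thesis .
  qed
  \<comment> \<open>Finiteness of the weighted sum bounds all W k at once, by a multiple of 2^(k q);
    rational q keep the exceptional sets countable.\<close>
  have "AE \<omega> in M. \<forall>q\<in>{q\<in>\<rat>. s < q}. (\<Sum>k. ennreal (2 powr (- real k * q)) * W k \<omega>) \<noteq> \<infinity>"
  proof (rule AE_ball_countable')
    fix q assume "q \<in> {q\<in>\<rat>. s < q}"
    then have q: "s < q" by simp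
    define \<theta> :: real where "\<theta> = 2 powr (s - q)"
    have \<theta>: "0 < \<theta>" "\<theta> < 1" unfolding \<theta>_def using q powr_less_mono[of "s - q" 0 2] by auto
    have "(\<integral>\<^sup>+\<omega>. (\<Sum>k. ennreal (2 powr (- real k * q)) * W k \<omega>) \<partial>M) = (\<Sum>k. ennreal (2 powr (- real k * q)) * (\<integral>\<^sup>+\<omega>. W k \<omega> \<partial>M))"
      by (simp add: nn_integral_suminf nn_integral_cmult)
    also have "\<dots> \<le> (\<Sum>k. ennreal (C * \<theta> ^ k))"
    proof (rule suminf_le)
      fix k
      have "ennreal (2 powr (- real k * q)) * (\<integral>\<^sup>+\<omega>. W k \<omega> \<partial>M) \<le> ennreal (2 powr (- real k * q)) * ennreal (C * 2 powr (real k * s))"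
        by (intro mult_left_mono W_int) simp
      also have "\<dots> = ennreal (C * (2 powr (- real k * q) * 2 powr (real k * s)))" using C by (simp add: mult_ac flip: ennreal_mult)
      also have "2 powr (- real k * q) * 2 powr (real k * s) = \<theta> ^ k"
        by (simp add: \<theta>_def powr_powr flip: powr_add powr_realpow) (simp add: algebra_simps)
      finally show "ennreal (2 powr (- real k * q)) * (\<integral>\<^sup>+\<omega>. W k \<omega> \<partial>M) \<le> ennreal (C * \<theta> ^ k)" .
    qed auto
    also have "\<dots> = ennreal (C / (1 - \<theta>))"
      using sums_mult[OF geometric_sums[of \<theta>], of C] \<theta> C by (intro suminf_ennreal_eq) auto
    finally have "(\<integral>\<^sup>+\<omega>. (\<Sum>k. ennreal (2 powr (- real k * q)) * W k \<omega>) \<partial>M) \<noteq> \<infinity>" by (auto simp: top_unique)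
    then show "AE \<omega> in M. (\<Sum>k. ennreal (2 powr (- real k * q)) * W k \<omega>) \<noteq> \<infinity>"
      by (intro nn_integral_PInf_AE) auto
  qed (auto intro: countable_subset[OF _ countable_rat])
  then show ?thesis using levy_processD(7)[OF Z]
  proof eventually_elim
    case (elim \<omega>)
    show ?case
    proof (intro allI impI)
      fix s' assume "s < s'"
      then obtain q where q: "q \<in> \<rat>" "s < q" "q < s'" using Rats_dense_in_real by blast
      define B where "B = enn2real (\<Sum>k. ennreal (2 powr (- real k * q)) * W k \<omega>)"
      have Bsum: "(\<Sum>k. ennreal (2 powr (- real k * q)) * W k \<omega>) = ennreal B"
        using elim(1) q unfolding B_def by (intro ennreal_enn2real[symmetric]) (auto simp: less_top)
      have VB: "real (V k m \<omega>) \<le> B * 2 powr (real k * q)" for k m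
      proof -
        have "ennreal (2 powr (- real k * q)) * ennreal (real (V k m \<omega>)) \<le> ennreal (2 powr (- real k * q)) * W k \<omega>"
          unfolding W_def by (intro mult_left_mono SUP_upper) auto
        also have "\<dots> \<le> ennreal B"
          unfolding Bsum[symmetric] using sum_le_suminf[of "\<lambda>k. ennreal (2 powr (- real k * q)) * W k \<omega>" "{k}"] by auto
        finally have "2 powr (- real k * q) * real (V k m \<omega>) \<le> B"
          by (simp add: B_def flip: ennreal_mult)
        then show ?thesis by (simp add: powr_minus field_simps)
      qed
      show "packing_premeasure s' ((\<lambda>t. Z t \<omega>) ` {0..T}) = 0"
      proof (rule packing_premeasure_eq_0I[where kmin = 0 and C = B and s = q])
        fix k :: nat and F :: "'b set"
        assume F: "finite F" "F \<subseteq> (\<lambda>t. Z t \<omega>) ` {0..T}"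
          and sep: "\<And>x y. x \<in> F \<Longrightarrow> y \<in> F \<Longrightarrow> x \<noteq> y \<Longrightarrow> (1/2) ^ k < dist x y"
        have "\<exists>m. card F \<le> V k m \<omega>"
          unfolding V_def S_def n_def
        proof (rule separated_image_le_dyadic[OF _ T F sep \<rho>(1)])
          show "real DIM('b) * \<rho> k \<le> (1/2) ^ k" using d by (simp add: \<rho>_def d_def)
        qed (use elim(2) in auto)
        then obtain m where "card F \<le> V k m \<omega>" by blast
        then show "real (card F) \<le> B * 2 powr (real k * q)" using VB[of k m] by linarith
      qed (use q s in \<open>auto simp: B_def\<close>)
    qed
  qed
qed

subsection \<open>Strictly stable processes\<close>

lemma levy_process_indep_increments:
  fixes Y :: "real \<Rightarrow> 'w \<Rightarrow> 'b::euclidean_space"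
  assumes Y: "levy_process M Y" and st: "0 \<le> s" "0 \<le> t"
  shows "prob_space.indep_var M borel (\<lambda>\<omega>. Y s \<omega> - Y 0 \<omega>) borel (\<lambda>\<omega>. Y (s + t) \<omega> - Y s \<omega>)"
proof -
  interpret prob_space M by (rule levy_processD(1)[OF Y])
  define \<tau> where "\<tau> i = (if i = 0 then 0 else if i = 1 then s else s + t)" for i :: nat
  have "mono_on {..2} \<tau>" using st by (auto simp: mono_on_def \<tau>_def)
  then have "indep_vars (\<lambda>_. borel) (\<lambda>i \<omega>. Y (\<tau> (Suc i)) \<omega> - Y (\<tau> i) \<omega>) {..<2}"
    by (intro levy_processD(4)[OF Y]) (simp add: \<tau>_def, assumption)
  from indep_var_restrict[OF this, of "{0}" "{1}"]
  have "indep_var (PiM {0::nat} (\<lambda>_. borel)) (\<lambda>\<omega>. \<lambda>i\<in>{0}. Y (\<tau> (Suc i)) \<omega> - Y (\<tau> i) \<omega>)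
      (PiM {1::nat} (\<lambda>_. borel)) (\<lambda>\<omega>. \<lambda>i\<in>{1}. Y (\<tau> (Suc i)) \<omega> - Y (\<tau> i) \<omega>)" by simp
  from indep_var_compose[OF this, of "\<lambda>p. p 0" borel "\<lambda>p. p 1" borel] show ?thesis
    by (simp add: comp_def \<tau>_def)
qed

lemma path_of_measurable:
  fixes X :: "real \<Rightarrow> 'w \<Rightarrow> 'b::euclidean_space"
  assumes "\<And>t. 0 \<le> t \<Longrightarrow> X t \<in> borel_measurable M"
  shows "path_of X \<in> M \<rightarrow>\<^sub>M path_space"
  unfolding path_of_def using assms by (intro measurable_restrict) auto

lemma same_law_distr_eq:
  fixes X Y :: "real \<Rightarrow> 'w \<Rightarrow> 'b::euclidean_space"
  assumes law: "same_law M X Y" and X: "\<And>t. 0 \<le> t \<Longrightarrow> X t \<in> borel_measurable M" and Y: "\<And>t. 0 \<le> t \<Longrightarrow> Y t \<in> borel_measurable M"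
    and f: "f \<in> path_space \<rightarrow>\<^sub>M N"
  shows "distr M N (\<lambda>\<omega>. f (path_of X \<omega>)) = distr M N (\<lambda>\<omega>. f (path_of Y \<omega>))"
proof -
  have "distr (distr M path_space (path_of X)) N f = distr (distr M path_space (path_of Y)) N f"
    using law by (simp add: same_law_def)
  then show ?thesis
    using path_of_measurable[of X M] path_of_measurable[of Y M] X Y f by (simp add: distr_distr comp_def)
qed

lemma strictly_stable_levyD:
  assumes "strictly_stable_levy M \<alpha> Y"
  shows "levy_process M Y" and "0 < c \<Longrightarrow> same_law M (\<lambda>x. Y (c * x)) (\<lambda>x \<omega>. (c powr (1 / \<alpha>)) *\<^sub>R Y x \<omega>)"
  using assms by (auto simp: strictly_stable_levy_def)

lemma strictly_stable_distr:
  fixes Y :: "real \<Rightarrow> 'w \<Rightarrow> 'b::euclidean_space"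
  assumes Y: "strictly_stable_levy M \<alpha> Y" and t: "0 < t"
  shows "distr M borel (Y t) = distr M borel (\<lambda>\<omega>. (t powr (1 / \<alpha>)) *\<^sub>R Y 1 \<omega>)"
proof -
  have rv: "Y x \<in> borel_measurable M" if "0 \<le> x" for x
    using levy_processD(2)[OF strictly_stable_levyD(1)[OF Y] that] .
  have "distr M borel (\<lambda>\<omega>. (\<lambda>p. p 1) (path_of (\<lambda>x. Y (t * x)) \<omega>)) =
      distr M borel (\<lambda>\<omega>. (\<lambda>p. p 1) (path_of (\<lambda>x \<omega>. (t powr (1 / \<alpha>)) *\<^sub>R Y x \<omega>) \<omega>))"
    using t rv by (intro same_law_distr_eq strictly_stable_levyD(2)[OF Y] measurable_component_singleton) auto
  then show ?thesis by (simp add: path_of_def)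
qed

lemma strictly_stable_measure:
  fixes Y :: "real \<Rightarrow> 'w \<Rightarrow> 'b::euclidean_space"
  assumes Y: "strictly_stable_levy M \<alpha> Y" and t: "0 < t" and A: "A \<in> sets borel"
  shows "measure M {\<omega> \<in> space M. Y t \<omega> \<in> A} = measure M {\<omega> \<in> space M. (t powr (1 / \<alpha>)) *\<^sub>R Y 1 \<omega> \<in> A}"
proof -
  have [measurable]: "Y 1 \<in> borel_measurable M" "Y t \<in> borel_measurable M"
    using levy_processD(2)[OF strictly_stable_levyD(1)[OF Y]] t by auto
  have "measure (distr M borel (Y t)) A = measure (distr M borel (\<lambda>\<omega>. (t powr (1 / \<alpha>)) *\<^sub>R Y 1 \<omega>)) A"
    by (simp add: strictly_stable_distr[OF Y t])
  then show ?thesis using A by (simp add: measure_distr vimage_def Int_def conj_commute)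
qed

lemma strictly_stable_measure_cball:
  fixes Y :: "real \<Rightarrow> 'w \<Rightarrow> 'b::euclidean_space"
  assumes Y: "strictly_stable_levy M \<alpha> Y" and t: "0 < t"
  shows "measure M {\<omega> \<in> space M. norm (Y t \<omega>) \<le> r} = measure M {\<omega> \<in> space M. norm (Y 1 \<omega>) \<le> r * t powr (- (1 / \<alpha>))}"
proof -
  have "(norm ((t powr (1 / \<alpha>)) *\<^sub>R x) \<le> r) = (norm x \<le> r * t powr (- (1 / \<alpha>)))" for x :: 'b
    using t by (simp add: powr_minus field_simps)
  then show ?thesis using strictly_stable_measure[OF Y t, of "cball 0 r"] by simp
qed

lemma levy_process_bounded_linear:
  fixes Y :: "real \<Rightarrow> 'w \<Rightarrow> 'b::euclidean_space" and f :: "'b \<Rightarrow> 'c::euclidean_space"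
  assumes Y: "levy_process M Y" and f: "bounded_linear f"
  shows "levy_process M (\<lambda>t \<omega>. f (Y t \<omega>))"
proof -
  interpret prob_space M by (rule levy_processD(1)[OF Y])
  interpret f: bounded_linear f by (rule f)
  have f_meas [measurable]: "f \<in> borel_measurable borel"
    by (intro borel_measurable_continuous_onI f.continuous_on continuous_on_id)
  have rv: "Y x \<in> borel_measurable M" if "0 \<le> x" for x using levy_processD(2)[OF Y that] .
  show ?thesis unfolding levy_process_def
  proof (intro conjI allI impI)
    show "prob_space M" by (rule prob_space_axioms)
    show "(\<lambda>\<omega>. f (Y t \<omega>)) \<in> borel_measurable M" if "0 \<le> t" for t
      using measurable_compose[OF rv[OF that] f_meas] .
    show "AE \<omega> in M. f (Y 0 \<omega>) = 0" using levy_processD(3)[OF Y] by eventually_elim (simp add: f.zero)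
    show "indep_vars (\<lambda>_. borel) (\<lambda>i \<omega>. f (Y (\<tau> (Suc i)) \<omega>) - f (Y (\<tau> i) \<omega>)) {..<n}"
      if "0 \<le> \<tau> 0 \<and> mono_on {..n} \<tau>" for n \<tau>
    proof -
      have "indep_vars (\<lambda>_. borel) (\<lambda>i \<omega>. Y (\<tau> (Suc i)) \<omega> - Y (\<tau> i) \<omega>) {..<n}"
        using that by (intro levy_processD(4)[OF Y]) auto
      from indep_vars_compose2[OF this, of "\<lambda>_. f" "\<lambda>_. borel"] show ?thesis by (simp add: f.diff)
    qed
    show "distr M borel (\<lambda>\<omega>. f (Y (s + h) \<omega>) - f (Y s \<omega>)) = distr M borel (\<lambda>\<omega>. f (Y h \<omega>))"
      if "0 \<le> s" "0 \<le> h" for s h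
    proof -
      have [measurable]: "Y (s + h) \<in> borel_measurable M" "Y s \<in> borel_measurable M" "Y h \<in> borel_measurable M"
        using rv that by auto
      have "distr (distr M borel (\<lambda>\<omega>. Y (s + h) \<omega> - Y s \<omega>)) borel f = distr (distr M borel (Y h)) borel f"
        using levy_processD(5)[OF Y that] by simp
      then show ?thesis by (simp add: distr_distr comp_def f.diff)
    qed
    show "AE \<omega> in M. cadlag (\<lambda>t. f (Y t \<omega>))"
      using levy_processD(6)[OF Y]
    proof eventually_elim
      case (elim \<omega>)
      have "continuous (at_right t) (\<lambda>t. f (Y t \<omega>))" if "0 \<le> t" for t
        using elim that by (intro f.continuous) (simp add: cadlag_def)
      moreover have "\<exists>l. ((\<lambda>t. f (Y t \<omega>)) \<longlongrightarrow> l) (at_left t)" if t: "0 < t" for t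
      proof -
        obtain l where "((\<lambda>t. Y t \<omega>) \<longlongrightarrow> l) (at_left t)" using elim t by (auto simp: cadlag_def)
        then show ?thesis using f.tendsto by blast
      qed
      ultimately show ?case by (simp add: cadlag_def)
    qed
  qed
qed

lemma strictly_stable_levy_bounded_linear:
  fixes Y :: "real \<Rightarrow> 'w \<Rightarrow> 'b::euclidean_space" and f :: "'b \<Rightarrow> 'c::euclidean_space"
  assumes Y: "strictly_stable_levy M \<alpha> Y" and f: "bounded_linear f"
  shows "strictly_stable_levy M \<alpha> (\<lambda>t \<omega>. f (Y t \<omega>))"
  unfolding strictly_stable_levy_def
proof (intro conjI allI impI)
  interpret f: bounded_linear f by (rule f)
  have f_meas [measurable]: "f \<in> borel_measurable borel"
    by (intro borel_measurable_continuous_onI f.continuous_on continuous_on_id)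
  show "levy_process M (\<lambda>t \<omega>. f (Y t \<omega>))"
    by (rule levy_process_bounded_linear[OF strictly_stable_levyD(1)[OF Y] f])
  fix c :: real assume c: "0 < c"
  have rv: "Y x \<in> borel_measurable M" if "0 \<le> x" for x
    using levy_processD(2)[OF strictly_stable_levyD(1)[OF Y] that] .
  define F where "F p = (\<lambda>t\<in>{0::real..}. f (p t))" for p :: "real \<Rightarrow> 'b"
  have "F \<in> path_space \<rightarrow>\<^sub>M path_space"
    unfolding F_def by (intro measurable_restrict measurable_compose[OF _ f_meas] measurable_component_singleton) auto
  then have "distr M path_space (\<lambda>\<omega>. F (path_of (\<lambda>x. Y (c * x)) \<omega>)) =
      distr M path_space (\<lambda>\<omega>. F (path_of (\<lambda>x \<omega>. (c powr (1 / \<alpha>)) *\<^sub>R Y x \<omega>) \<omega>))"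
    using c rv by (intro same_law_distr_eq strictly_stable_levyD(2)[OF Y]) auto
  moreover have "F (path_of Z \<omega>) = path_of (\<lambda>t \<omega>. f (Z t \<omega>)) \<omega>" for Z :: "real \<Rightarrow> 'w \<Rightarrow> 'b" and \<omega>
    unfolding F_def path_of_def by (intro restrict_ext) simp
  ultimately show "same_law M (\<lambda>x \<omega>. f (Y (c * x) \<omega>)) (\<lambda>x \<omega>. (c powr (1 / \<alpha>)) *\<^sub>R f (Y x \<omega>))"
    unfolding same_law_def by (simp add: f.scaleR)
qed

text \<open>In the next lemmas \<open>W\<close> is real-valued; applied to \<open>u \<bullet> Y\<close> they control the characteristic function of \<open>Y 1\<close>.\<close>

lemma levy_char_add:
  fixes W :: "real \<Rightarrow> 'w \<Rightarrow> real"
  assumes W: "levy_process M W" and st: "0 \<le> s" "0 \<le> t"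
  shows "char (distr M borel (W (s + t))) x = char (distr M borel (W s)) x * char (distr M borel (W t)) x"
proof -
  interpret prob_space M by (rule levy_processD(1)[OF W])
  have [measurable]: "W s \<in> borel_measurable M" "W 0 \<in> borel_measurable M" "W (s + t) \<in> borel_measurable M"
    using levy_processD(2)[OF W] st by auto
  have "distr M borel (W (s + t)) = distr M borel (\<lambda>\<omega>. (W s \<omega> - W 0 \<omega>) + (W (s + t) \<omega> - W s \<omega>))"
    using levy_processD(3)[OF W] by (intro distr_cong_AE) auto
  moreover have "distr M borel (\<lambda>\<omega>. W s \<omega> - W 0 \<omega>) = distr M borel (W s)"
    using levy_processD(3)[OF W] by (intro distr_cong_AE) auto
  ultimately show ?thesis
    using char_distr_add[OF levy_process_indep_increments[OF W st], of x] levy_processD(5)[OF W st] by simp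
qed

lemma levy_char_of_nat:
  fixes W :: "real \<Rightarrow> 'w \<Rightarrow> real"
  assumes W: "levy_process M W"
  shows "char (distr M borel (W (real n))) x = char (distr M borel (W 1)) x ^ n"
proof (induction n)
  case 0
  interpret prob_space M by (rule levy_processD(1)[OF W])
  have [measurable]: "W 0 \<in> borel_measurable M" using levy_processD(2)[OF W] by auto
  have "distr M borel (W 0) = distr M borel (\<lambda>\<omega>. 0 :: real)"
    using levy_processD(3)[OF W] by (intro distr_cong_AE) auto
  moreover have "char (distr M borel (\<lambda>\<omega>. 0 :: real)) x = 1"
    unfolding char_def by (subst integral_distr) (simp_all add: prob_space del: distr_const)
  ultimately show ?case by simp
next
  case (Suc n)
  then show ?case using levy_char_add[OF W, of "real n" 1 x] by (simp add: add.commute mult.commute)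
qed

text \<open>Frequency r at time 1 is frequency 1 at time r powr \<alpha>. That time is cut into
  whole units and a remainder whose factor has modulus at most 1. In the second part it is instead
  an initial piece of the unit interval, which will propagate modulus 1 from frequency 1 down to all
  smaller ones.\<close>

lemma stable_char_le:
  fixes W :: "real \<Rightarrow> 'w \<Rightarrow> real"
  assumes W: "strictly_stable_levy M \<alpha> W" and \<alpha>: "0 < \<alpha>" and r: "0 < r"
  shows "cmod (char (distr M borel (W 1)) r) \<le> cmod (char (distr M borel (W 1)) 1) ^ nat \<lfloor>r powr \<alpha>\<rfloor>"
    and "r \<le> 1 \<Longrightarrow> cmod (char (distr M borel (W 1)) 1) \<le> cmod (char (distr M borel (W 1)) r)"
proof -
  have L: "levy_process M W" by (rule strictly_stable_levyD(1)[OF W])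
  interpret prob_space M by (rule levy_processD(1)[OF L])
  have rv: "random_variable borel (W t)" if "0 \<le> t" for t by (rule levy_processD(2)[OF L that])
  have le1: "cmod (char (distr M borel (W t)) 1) \<le> 1" if "0 \<le> t" for t
  proof -
    interpret D: real_distribution "distr M borel (W t)" using rv[OF that] by (rule real_distribution_distr)
    show ?thesis by (rule D.cmod_char_le_1)
  qed
  have [measurable]: "random_variable borel (W 1)" using rv by simp
  have eq: "char (distr M borel (W 1)) r = char (distr M borel (W (r powr \<alpha>))) 1"
  proof -
    have "distr M borel (W (r powr \<alpha>)) = distr M borel (\<lambda>\<omega>. r * W 1 \<omega>)"
      using strictly_stable_distr[OF W, of "r powr \<alpha>"] r \<alpha> by (simp add: powr_powr)
    then show ?thesis by (simp add: char_def integral_distr)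
  qed
  define n where "n = nat \<lfloor>r powr \<alpha>\<rfloor>"
  have n: "real n \<le> r powr \<alpha>" unfolding n_def by simp
  have "char (distr M borel (W (r powr \<alpha>))) 1 = char (distr M borel (W 1)) 1 ^ n * char (distr M borel (W (r powr \<alpha> - n))) 1"
    using levy_char_add[OF L, of "real n" "r powr \<alpha> - n" 1] n by (simp add: levy_char_of_nat[OF L])
  then have "cmod (char (distr M borel (W 1)) r) = cmod (char (distr M borel (W 1)) 1) ^ n * cmod (char (distr M borel (W (r powr \<alpha> - n))) 1)"
    by (simp add: eq norm_mult norm_power)
  also have "\<dots> \<le> cmod (char (distr M borel (W 1)) 1) ^ n * 1"
    using n by (intro mult_left_mono le1) auto
  finally show "cmod (char (distr M borel (W 1)) r) \<le> cmod (char (distr M borel (W 1)) 1) ^ nat \<lfloor>r powr \<alpha>\<rfloor>"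
    by (simp add: n_def)
  show "cmod (char (distr M borel (W 1)) 1) \<le> cmod (char (distr M borel (W 1)) r)" if "r \<le> 1"
  proof -
    have t: "r powr \<alpha> \<le> 1" using that r \<alpha> by (simp add: powr_le1)
    have "char (distr M borel (W 1)) 1 = char (distr M borel (W (r powr \<alpha>))) 1 * char (distr M borel (W (1 - r powr \<alpha>))) 1"
      using levy_char_add[OF L, of "r powr \<alpha>" "1 - r powr \<alpha>" 1] t by simp
    then have "cmod (char (distr M borel (W 1)) 1) = cmod (char (distr M borel (W 1)) r) * cmod (char (distr M borel (W (1 - r powr \<alpha>))) 1)"
      by (simp add: eq norm_mult)
    also have "\<dots> \<le> cmod (char (distr M borel (W 1)) r) * 1"
      using t by (intro mult_left_mono le1) auto
    finally show ?thesis by simp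
  qed
qed

text \<open>The difference V of two consecutive unit increments has characteristic function |\<phi>
  r|^2, which equals 1 for 0 < r \<le> 1. So r * V is almost surely a multiple of 2 * pi for each r
  = 1 / (k + 1), and for k beyond |V| this leaves only V = 0.\<close>

lemma stable_char_eq_1_imp:
  fixes W :: "real \<Rightarrow> 'w \<Rightarrow> real"
  assumes W: "strictly_stable_levy M \<alpha> W" and \<alpha>: "0 < \<alpha>" and one: "cmod (char (distr M borel (W 1)) 1) = 1"
  shows "AE \<omega> in M. W 2 \<omega> = 2 * W 1 \<omega>"
proof -
  have L: "levy_process M W" by (rule strictly_stable_levyD(1)[OF W])
  interpret prob_space M by (rule levy_processD(1)[OF L])
  have [measurable]: "random_variable borel (W 0)" "random_variable borel (W 1)" "random_variable borel (W 2)"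
    using levy_processD(2)[OF L] by auto
  interpret D: real_distribution "distr M borel (W 1)" by (rule real_distribution_distr) simp
  define V where "V \<omega> = (W 1 \<omega> - W 0 \<omega>) - (W 2 \<omega> - W 1 \<omega>)" for \<omega>
  have [measurable]: "random_variable borel V" unfolding V_def by simp
  have cos1: "AE \<omega> in M. cos (r * V \<omega>) = 1" if r: "0 < r" "r \<le> 1" for r
  proof -
    have abs: "cmod (char (distr M borel (W 1)) r) = 1"
      using stable_char_le(2)[OF W \<alpha> r] one D.cmod_char_le_1[of r] by simp
    have "indep_var borel (\<lambda>\<omega>. W 1 \<omega> - W 0 \<omega>) borel (\<lambda>\<omega>. W 2 \<omega> - W 1 \<omega>)"
      using levy_process_indep_increments[OF L, of 1 1] by simp
    from indep_var_compose[OF this, of "\<lambda>x. x" borel "\<lambda>x. - x" borel]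
    have ind: "indep_var borel (\<lambda>\<omega>. W 1 \<omega> - W 0 \<omega>) borel (\<lambda>\<omega>. - (W 2 \<omega> - W 1 \<omega>))"
      by (simp add: comp_def)
    have d1: "distr M borel (\<lambda>\<omega>. W 1 \<omega> - W 0 \<omega>) = distr M borel (W 1)"
      using levy_processD(3)[OF L] by (intro distr_cong_AE) auto
    have d2: "distr M borel (\<lambda>\<omega>. W 2 \<omega> - W 1 \<omega>) = distr M borel (W 1)"
      using levy_processD(5)[OF L, of 1 1] by simp
    have "char (distr M borel (\<lambda>\<omega>. - (W 2 \<omega> - W 1 \<omega>))) r = (CLINT \<omega>|M. cnj (iexp (r * (W 2 \<omega> - W 1 \<omega>))))"
      by (simp add: char_def integral_distr exp_cnj algebra_simps)
    also have "\<dots> = cnj (CLINT \<omega>|M. iexp (r * (W 2 \<omega> - W 1 \<omega>)))" by simp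
    also have "(CLINT \<omega>|M. iexp (r * (W 2 \<omega> - W 1 \<omega>))) = char (distr M borel (\<lambda>\<omega>. W 2 \<omega> - W 1 \<omega>)) r"
      by (simp add: char_def integral_distr)
    finally have "char (distr M borel V) r = char (distr M borel (W 1)) r * cnj (char (distr M borel (W 1)) r)"
      using char_distr_add[OF ind, of r] unfolding V_def by (simp add: d1 d2)
    also have "\<dots> = 1" using complex_norm_square[of "char (distr M borel (W 1)) r"] abs by simp
    finally have "(CLINT \<omega>|M. iexp (r * V \<omega>)) = 1" by (simp add: char_def integral_distr)
    then have "Re (CLINT \<omega>|M. iexp (r * V \<omega>)) = 1" by simp
    moreover have int: "integrable M (\<lambda>\<omega>. iexp (r * V \<omega>))" by (rule integrable_iexp) auto
    ultimately have "expectation (\<lambda>\<omega>. Re (iexp (r * V \<omega>))) = 1" by simp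
    then have E: "expectation (\<lambda>\<omega>. cos (r * V \<omega>)) = 1" by (simp add: Re_exp)
    have int': "integrable M (\<lambda>\<omega>. cos (r * V \<omega>))" by (rule integrable_const_bound[where B = 1]) auto
    have "expectation (\<lambda>\<omega>. 1 - cos (r * V \<omega>)) = 0" using E int' by (simp add: prob_space)
    then have "AE \<omega> in M. 1 - cos (r * V \<omega>) = 0"
      using int' by (subst (asm) integral_nonneg_eq_0_iff_AE) auto
    then show ?thesis by eventually_elim simp
  qed
  have "AE \<omega> in M. \<forall>k::nat. cos (1 / real (Suc k) * V \<omega>) = 1"
    unfolding AE_all_countable by (intro allI cos1) auto
  then show ?thesis using levy_processD(3)[OF L]
  proof eventually_elim
    case (elim \<omega>)
    obtain k :: nat where k: "\<bar>V \<omega>\<bar> < real k" using reals_Archimedean2 by blast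
    have "V \<omega> = 0"
    proof (rule ccontr)
      assume "V \<omega> \<noteq> 0"
      define x where "x = 1 / real (Suc k) * V \<omega>"
      have x: "\<bar>x\<bar> < 1" "x \<noteq> 0" using k \<open>V \<omega> \<noteq> 0\<close> by (auto simp: x_def abs_mult)
      have "cos x = 1" unfolding x_def using elim(1) by blast
      then obtain i :: int where i: "x = real_of_int i * 2 * pi" using cos_one_2pi_int by blast
      then have "i \<noteq> 0" using x by auto
      then have "1 \<le> \<bar>real_of_int i\<bar>" by linarith
      then have "1 * 1 \<le> \<bar>real_of_int i\<bar> * (2 * pi)" using pi_gt3 by (intro mult_mono) auto
      then show False using x i by (simp add: abs_mult)
    qed
    then show ?case using elim(2) by (simp add: V_def)
  qed
qed

subsection \<open>Small ball estimates\<close>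

text \<open>The normal density is bounded by 1, and what remains is a rescaled Cauchy integral. This
  is the contribution of one coordinate to the averaged characteristic function.\<close>

lemma std_normal_cauchy_integral_le:
  assumes \<epsilon>: "0 < \<epsilon>"
  shows "(\<integral>x. 1 / (1 + (x / \<epsilon>)\<^sup>2) \<partial>std_normal_distribution) \<le> pi * \<epsilon>"
    and "integrable std_normal_distribution (\<lambda>x. 1 / (1 + (x / \<epsilon>)\<^sup>2))"
proof -
  interpret N: real_distribution std_normal_distribution by (rule real_dist_normal_dist)
  have pos: "0 < 1 + y\<^sup>2" for y :: real by (simp add: add_pos_nonneg)
  show int: "integrable std_normal_distribution (\<lambda>x. 1 / (1 + (x / \<epsilon>)\<^sup>2))"
    by (rule N.integrable_const_bound[where B = 1]) (auto simp: divide_le_eq pos)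
  have int1: "integrable lborel (\<lambda>x :: real. 1 / (1 + x\<^sup>2))"
    using integrable_inverse_1_plus_square by (simp add: set_integrable_def inverse_eq_divide)
  have val1: "(\<integral>x. 1 / (1 + x\<^sup>2) \<partial>lborel) = pi"
    using LBINT_inverse_1_plus_square
    by (simp add: interval_lebesgue_integral_def set_lebesgue_integral_def inverse_eq_divide)
  have aff: "integrable lborel (\<lambda>x. 1 / (1 + (x / \<epsilon>)\<^sup>2))" "(\<integral>x. 1 / (1 + (x / \<epsilon>)\<^sup>2) \<partial>lborel) = \<epsilon> * pi"
    using lborel_integrable_real_affine[OF int1, of "1 / \<epsilon>" 0] lborel_integral_real_affine[of "1 / \<epsilon>" "\<lambda>x. 1 / (1 + x\<^sup>2)" 0] \<epsilon> val1
    by (simp_all add: field_simps)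
  have dens: "std_normal_density x \<le> 1" for x
  proof -
    have "1 \<le> sqrt (2 * pi)" using pi_gt3 by (simp add: real_le_rsqrt)
    then have "1 / sqrt (2 * pi) * exp (- x\<^sup>2 / 2) \<le> 1 * 1" by (intro mult_mono) (auto simp: divide_le_eq)
    then show ?thesis by (simp add: std_normal_density_def)
  qed
  have "(\<integral>x. 1 / (1 + (x / \<epsilon>)\<^sup>2) \<partial>std_normal_distribution) = (\<integral>x. std_normal_density x * (1 / (1 + (x / \<epsilon>)\<^sup>2)) \<partial>lborel)"
    by (subst integral_density) auto
  also have "\<dots> \<le> (\<integral>x. 1 / (1 + (x / \<epsilon>)\<^sup>2) \<partial>lborel)"
  proof (rule integral_mono)
    show "integrable lborel (\<lambda>x. std_normal_density x * (1 / (1 + (x / \<epsilon>)\<^sup>2)))"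
      using int by (subst (asm) integrable_density) auto
    show "std_normal_density x * (1 / (1 + (x / \<epsilon>)\<^sup>2)) \<le> 1 / (1 + (x / \<epsilon>)\<^sup>2)" for x
      using mult_right_mono[OF dens[of x], of "1 / (1 + (x / \<epsilon>)\<^sup>2)"] pos[of "x / \<epsilon>"] by simp
  qed (rule aff)
  finally show "(\<integral>x. 1 / (1 + (x / \<epsilon>)\<^sup>2) \<partial>std_normal_distribution) \<le> pi * \<epsilon>" by (simp add: aff mult.commute)
qed

text \<open>Averaging the characteristic function over a Gaussian frequency of variance \<open>1 / \<epsilon>\<^sup>2\<close> gives
  the expectation of a Gaussian bump of width \<open>\<epsilon>\<close>.\<close>

lemma (in prob_space) small_ball_of_char_bound:
  fixes X :: "'a \<Rightarrow> 'b::euclidean_space"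
  assumes X [measurable]: "random_variable borel X" and C: "0 \<le> C"
    and bound: "\<And>\<xi>. cmod (CLINT \<omega>|M. iexp (\<xi> \<bullet> X \<omega>)) \<le> C * (\<Prod>b\<in>Basis. 1 / (1 + (\<xi> \<bullet> b)\<^sup>2))"
    and \<epsilon>: "0 < \<epsilon>"
  shows "prob {\<omega> \<in> space M. \<forall>b\<in>Basis. \<bar>X \<omega> \<bullet> b\<bar> \<le> \<epsilon>} \<le> exp (DIM('b) / 2) * C * pi ^ DIM('b) * \<epsilon> ^ DIM('b)"
proof -
  interpret N: real_distribution std_normal_distribution by (rule real_dist_normal_dist)
  interpret P: product_prob_space "\<lambda>_. std_normal_distribution" "Basis :: 'b set"
    by (intro product_prob_spaceI N.prob_space_axioms)
  interpret PM: pair_prob_space "PiM (Basis :: 'b set) (\<lambda>_. std_normal_distribution)" M ..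
  define G where "G = PiM (Basis :: 'b set) (\<lambda>_. std_normal_distribution)"
  define \<xi> where "\<xi> g = (\<Sum>b\<in>Basis. (g b / \<epsilon>) *\<^sub>R b)" for g :: "'b \<Rightarrow> real"
  have comp [measurable]: "(\<lambda>g. g b) \<in> borel_measurable G" if "b \<in> Basis" for b
    using measurable_component_singleton[OF that, of "\<lambda>_. std_normal_distribution"] by (simp add: G_def)
  have \<xi>_meas [measurable]: "\<xi> \<in> borel_measurable G" unfolding \<xi>_def by measurable
  have \<xi>_b: "\<xi> g \<bullet> b = g b / \<epsilon>" if "b \<in> Basis" for g b
    using that unfolding \<xi>_def by (simp add: inner_sum_left inner_Basis if_distrib sum.If_cases cong: if_cong)
  have iexp_int: "integrable std_normal_distribution (\<lambda>x. iexp (t * x))" for t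
    by (rule N.integrable_iexp) auto
  have gauss: "(CLINT g|G. iexp (\<xi> g \<bullet> x)) = (\<Prod>b\<in>Basis. complex_of_real (exp (- ((x \<bullet> b) / \<epsilon>)\<^sup>2 / 2)))" for x
  proof -
    have "iexp (\<xi> g \<bullet> x) = (\<Prod>b\<in>Basis. iexp ((x \<bullet> b) / \<epsilon> * g b))" for g
    proof -
      have "\<xi> g \<bullet> x = (\<Sum>b\<in>Basis. (x \<bullet> b) / \<epsilon> * g b)"
        unfolding \<xi>_def inner_sum_left by (intro sum.cong refl) (simp add: inner_commute)
      then show ?thesis by (simp only: of_real_sum sum_distrib_left exp_sum[OF finite_Basis])
    qed
    then have "(CLINT g|G. iexp (\<xi> g \<bullet> x)) = (\<Prod>b\<in>Basis. CLINT y|std_normal_distribution. iexp ((x \<bullet> b) / \<epsilon> * y))"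
      unfolding G_def by (simp only:) (intro P.product_integral_prod finite_Basis iexp_int)
    also have "\<dots> = (\<Prod>b\<in>Basis. complex_of_real (exp (- ((x \<bullet> b) / \<epsilon>)\<^sup>2 / 2)))"
      by (intro prod.cong refl fun_cong[OF char_std_normal_distribution, unfolded char_def])
    finally show ?thesis .
  qed
  have int: "integrable (G \<Otimes>\<^sub>M M) (\<lambda>(g, \<omega>). iexp (\<xi> g \<bullet> X \<omega>))"
    unfolding G_def[symmetric] case_prod_beta
  proof (rule PM.integrable_const_bound[folded G_def, where B = 1])
  qed auto
  have swap: "(CLINT \<omega>|M. CLINT g|G. iexp (\<xi> g \<bullet> X \<omega>)) = (CLINT g|G. CLINT \<omega>|M. iexp (\<xi> g \<bullet> X \<omega>))"
    using PM.Fubini_integral[folded G_def, OF int] .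
  define B where "B x = (\<Prod>b\<in>Basis. exp (- ((x \<bullet> b) / \<epsilon>)\<^sup>2 / 2))" for x :: 'b
  have B_meas [measurable]: "B \<in> borel_measurable borel" unfolding B_def by measurable
  have B: "0 \<le> B x" "B x \<le> 1" for x unfolding B_def by (auto intro!: prod_nonneg prod_le_1)
  have B_int: "integrable M (\<lambda>\<omega>. B (X \<omega>))"
    by (rule integrable_const_bound[where B = 1]) (auto simp: B)
  have "complex_of_real (expectation (\<lambda>\<omega>. B (X \<omega>))) = (CLINT \<omega>|M. complex_of_real (B (X \<omega>)))"
    by (rule integral_complex_of_real[symmetric])
  also have "\<dots> = (CLINT g|G. CLINT \<omega>|M. iexp (\<xi> g \<bullet> X \<omega>))"
    unfolding swap[symmetric] gauss B_def by simp
  finally have E: "complex_of_real (expectation (\<lambda>\<omega>. B (X \<omega>))) = (CLINT g|G. CLINT \<omega>|M. iexp (\<xi> g \<bullet> X \<omega>))" .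
  have cauchy_int: "integrable G (\<lambda>g. \<Prod>b\<in>(Basis::'b set). 1 / (1 + (g b / \<epsilon>)\<^sup>2))"
    unfolding G_def by (intro P.product_integrable_prod finite_Basis std_normal_cauchy_integral_le \<epsilon>)
  have "expectation (\<lambda>\<omega>. B (X \<omega>)) = cmod (CLINT g|G. CLINT \<omega>|M. iexp (\<xi> g \<bullet> X \<omega>))"
    unfolding E[symmetric] using B by (simp add: integral_nonneg)
  also have "\<dots> \<le> (LINT g|G. C * (\<Prod>b\<in>(Basis::'b set). 1 / (1 + (g b / \<epsilon>)\<^sup>2)))"
  proof (rule order_trans[OF integral_norm_bound integral_mono])
    show "integrable G (\<lambda>g. cmod (CLINT \<omega>|M. iexp (\<xi> g \<bullet> X \<omega>)))"
      using PM.integrable_fst'[folded G_def, OF int] by (intro integrable_norm) simp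
    show "cmod (CLINT \<omega>|M. iexp (\<xi> g \<bullet> X \<omega>)) \<le> C * (\<Prod>b\<in>(Basis::'b set). 1 / (1 + (g b / \<epsilon>)\<^sup>2))" for g
      using bound[of "\<xi> g"] \<xi>_b by simp
  qed (use cauchy_int in simp)
  also have "\<dots> = C * (\<Prod>b\<in>(Basis::'b set). \<integral>x. 1 / (1 + (x / \<epsilon>)\<^sup>2) \<partial>std_normal_distribution)"
    unfolding G_def by (simp, subst P.product_integral_prod) (auto intro: std_normal_cauchy_integral_le \<epsilon>)
  also have "\<dots> \<le> C * (\<Prod>b\<in>(Basis::'b set). pi * \<epsilon>)"
    using C by (intro mult_left_mono prod_mono conjI std_normal_cauchy_integral_le \<epsilon> integral_nonneg) (auto simp: add_nonneg_nonneg)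
  finally have up: "expectation (\<lambda>\<omega>. B (X \<omega>)) \<le> C * (pi ^ DIM('b) * \<epsilon> ^ DIM('b))" by (simp add: power_mult_distrib)
  let ?A = "{\<omega> \<in> space M. \<forall>b\<in>Basis. \<bar>X \<omega> \<bullet> b\<bar> \<le> \<epsilon>}"
  have A_meas [measurable]: "?A \<in> events" by measurable
  \<comment> \<open>On the event each coordinate contributes at least exp (-1/2) to the Gaussian
    bump B.\<close>
  have "exp (- (DIM('b) / 2)) * prob ?A = expectation (\<lambda>\<omega>. exp (- (DIM('b) / 2)) * indicator ?A \<omega>)" by simp
  also have "\<dots> \<le> expectation (\<lambda>\<omega>. B (X \<omega>))"
  proof (rule integral_mono[OF _ B_int])
    fix \<omega>
    show "exp (- (DIM('b) / 2)) * indicator ?A \<omega> \<le> B (X \<omega>)"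
    proof (cases "\<omega> \<in> ?A")
      case True
      have "(\<Prod>b\<in>(Basis::'b set). exp (- (1 / 2))) \<le> B (X \<omega>)"
        unfolding B_def
      proof (rule prod_mono, intro conjI)
        fix b :: 'b assume b: "b \<in> Basis"
        have "\<bar>(X \<omega> \<bullet> b) / \<epsilon>\<bar> \<le> 1" using True b \<epsilon> by (simp add: divide_le_eq)
        then have "((X \<omega> \<bullet> b) / \<epsilon>)\<^sup>2 \<le> 1" by (simp add: abs_square_le_1)
        then show "exp (- (1 / 2)) \<le> exp (- ((X \<omega> \<bullet> b) / \<epsilon>)\<^sup>2 / 2)" by simp
      qed simp
      moreover have "(\<Prod>b\<in>(Basis::'b set). exp (- (1 / 2))) = exp (- (DIM('b) / 2))"
        by (simp flip: exp_of_nat_mult)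
      ultimately show ?thesis using True by simp
    qed (simp add: B)
  qed (auto intro!: integrable_real_indicator simp: less_top[symmetric])
  also note up
  finally have "exp (DIM('b) / 2) * (exp (- (DIM('b) / 2)) * prob ?A) \<le> exp (DIM('b) / 2) * (C * (pi ^ DIM('b) * \<epsilon> ^ DIM('b)))"
    by (intro mult_left_mono) auto
  then show ?thesis by (simp add: mult.assoc[symmetric] flip: exp_add)
qed

text \<open>Used to dominate stretched exponential decay by a product of Cauchy factors, one for
  each coordinate.\<close>

lemma bounded_poly_times_exp_powr:
  fixes c \<alpha> :: real
  assumes "0 < c" "0 < \<alpha>"
  shows "\<exists>C\<ge>0. \<forall>r\<ge>0. (1 + r\<^sup>2) ^ d * exp (- (c * r powr \<alpha>)) \<le> C"
proof -
  have "((\<lambda>r. (1 + r\<^sup>2) ^ d * exp (- (c * r powr \<alpha>))) \<longlongrightarrow> 0) at_top"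
    using assms by real_asymp
  then have "eventually (\<lambda>r. (1 + r\<^sup>2) ^ d * exp (- (c * r powr \<alpha>)) < 1) at_top"
    by (rule order_tendstoD) simp
  then obtain R where R: "\<And>r. R \<le> r \<Longrightarrow> (1 + r\<^sup>2) ^ d * exp (- (c * r powr \<alpha>)) < 1"
    by (auto simp: eventually_at_top_linorder)
  have "(1 + r\<^sup>2) ^ d * exp (- (c * r powr \<alpha>)) \<le> 1 + (1 + R\<^sup>2) ^ d" if r: "0 \<le> r" for r
  proof (cases "R \<le> r")
    case True
    have "0 \<le> (1 + R\<^sup>2) ^ d" by simp
    then show ?thesis using R[OF True] by linarith
  next
    case False
    then have "(1 + r\<^sup>2) ^ d \<le> (1 + R\<^sup>2) ^ d" using r by (intro power_mono add_left_mono) auto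
    moreover have "exp (- (c * r powr \<alpha>)) \<le> 1" using assms by simp
    ultimately have "(1 + r\<^sup>2) ^ d * exp (- (c * r powr \<alpha>)) \<le> (1 + R\<^sup>2) ^ d * 1" by (intro mult_mono) auto
    then show ?thesis by simp
  qed
  then show ?thesis by (intro exI[of _ "1 + (1 + R\<^sup>2) ^ d"]) (auto intro: add_nonneg_nonneg)
qed

text \<open>Compactness of the unit sphere improves the pointwise condition \<open>nondeg\<close> to
  a uniform \<rho> < 1. In polar coordinates the characteristic function is then at most \<rho>
  raised to the integer part of r powr \<alpha>, which decays faster than the Cauchy product
  required by the Gaussian averaging.\<close>

lemma strictly_stable_small_ball:
  fixes Y :: "real \<Rightarrow> 'w \<Rightarrow> 'b::euclidean_space"
  assumes Y: "strictly_stable_levy M \<alpha> Y" and \<alpha>: "0 < \<alpha>"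
    and nondeg: "\<And>u. u \<noteq> 0 \<Longrightarrow> cmod (char (distr M borel (\<lambda>\<omega>. u \<bullet> Y 1 \<omega>)) 1) < 1"
  shows "\<exists>C\<ge>0. \<forall>\<epsilon>>0. measure M {\<omega> \<in> space M. norm (Y 1 \<omega>) \<le> \<epsilon>} \<le> C * \<epsilon> ^ DIM('b)"
proof -
  have L: "levy_process M Y" by (rule strictly_stable_levyD(1)[OF Y])
  interpret prob_space M by (rule levy_processD(1)[OF L])
  have [measurable]: "random_variable borel (Y 1)" using levy_processD(2)[OF L] by simp
  define f where "f u = (CLINT \<omega>|M. iexp (u \<bullet> Y 1 \<omega>))" for u
  have f: "char (distr M borel (\<lambda>\<omega>. u \<bullet> Y 1 \<omega>)) r = f (r *\<^sub>R u)" for u r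
    by (simp add: f_def char_def integral_distr)
  have "continuous_on (sphere 0 1) f"
    unfolding continuous_on_sequentially comp_def f_def
    by (intro allI ballI impI integral_dominated_convergence[where w = "\<lambda>_. 1"]) (auto intro!: tendsto_intros)
  then have "continuous_on (sphere 0 1) (\<lambda>u. cmod (f u))" by (intro continuous_intros)
  moreover have "sphere (0::'b) 1 \<noteq> {}" by simp
  ultimately obtain u0 where u0: "u0 \<in> sphere 0 1" "\<And>u. u \<in> sphere 0 1 \<Longrightarrow> cmod (f u) \<le> cmod (f u0)"
    using continuous_attains_sup[OF compact_sphere, of 0 1] by metis
  \<comment> \<open>The maximum with 1/2 keeps \<rho> positive, so that its logarithm can serve as
    decay rate.\<close>
  define \<rho> where "\<rho> = max (1/2) (cmod (f u0))"
  have "u0 \<noteq> 0" using u0(1) by auto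
  then have \<rho>: "0 < \<rho>" "\<rho> < 1" using nondeg[of u0] f[of u0 1] by (auto simp: \<rho>_def)
  define c where "c = - ln \<rho>"
  have c: "0 < c" using \<rho> by (simp add: c_def)
  obtain C where C: "0 \<le> C" "\<And>r. 0 \<le> r \<Longrightarrow> (1 + r\<^sup>2) ^ DIM('b) * exp (- (c * r powr \<alpha>)) \<le> C"
    using bounded_poly_times_exp_powr[OF c \<alpha>] by blast
  have bound: "cmod (f \<xi>) \<le> exp c * C * (\<Prod>b\<in>Basis. 1 / (1 + (\<xi> \<bullet> b)\<^sup>2))" for \<xi>
  proof -
    define r where "r = norm \<xi>"
    have "cmod (f \<xi>) \<le> exp c * exp (- (c * r powr \<alpha>))"
    proof (cases "\<xi> = 0")
      case True
      have "1 \<le> exp c" using c by simp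
      then show ?thesis using True \<alpha> by (simp add: f_def r_def prob_space)
    next
      case False
      then have r: "0 < r" by (simp add: r_def)
      define u where "u = (1 / r) *\<^sub>R \<xi>"
      have u: "u \<in> sphere 0 1" "r *\<^sub>R u = \<xi>" using r by (auto simp: u_def r_def)
      have W: "strictly_stable_levy M \<alpha> (\<lambda>t \<omega>. u \<bullet> Y t \<omega>)"
        by (rule strictly_stable_levy_bounded_linear[OF Y bounded_linear_inner_right])
      define n where "n = nat \<lfloor>r powr \<alpha>\<rfloor>"
      have "cmod (f \<xi>) \<le> cmod (f u) ^ n"
        using stable_char_le(1)[OF W \<alpha> r] f[of u r] f[of u 1] u by (simp add: n_def)
      also have "\<dots> \<le> \<rho> ^ n" using u0(2)[OF u(1)] by (intro power_mono) (auto simp: \<rho>_def)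
      also have "\<dots> = exp (- (c * n))" using exp_of_nat_mult[of n "ln \<rho>"] \<rho> by (simp add: c_def mult.commute)
      also have "\<dots> \<le> exp (c - c * r powr \<alpha>)"
      proof -
        have "0 \<le> r powr \<alpha>" by simp
        then have "r powr \<alpha> - 1 \<le> real n" unfolding n_def by linarith
        from mult_left_mono[OF this, of c] c show ?thesis by (simp add: algebra_simps)
      qed
      also have "\<dots> = exp c * exp (- (c * r powr \<alpha>))" by (simp flip: exp_add)
      finally show ?thesis .
    qed
    also have "\<dots> \<le> exp c * (C * (\<Prod>b\<in>Basis. 1 / (1 + (\<xi> \<bullet> b)\<^sup>2)))"
    proof (rule mult_left_mono)
      have pos: "0 < 1 + x\<^sup>2" for x :: real by (simp add: add_pos_nonneg)
      have "(\<Prod>b\<in>(Basis::'b set). 1 + (\<xi> \<bullet> b)\<^sup>2) \<le> (\<Prod>b\<in>(Basis::'b set). 1 + r\<^sup>2)"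
      proof (rule prod_mono, intro conjI)
        fix b :: 'b assume "b \<in> Basis"
        then have "\<bar>\<xi> \<bullet> b\<bar> \<le> r" unfolding r_def by (rule Basis_le_norm)
        then show "1 + (\<xi> \<bullet> b)\<^sup>2 \<le> 1 + r\<^sup>2" using power_mono[of "\<bar>\<xi> \<bullet> b\<bar>" r 2] by simp
      qed simp
      then have "(\<Prod>b\<in>(Basis::'b set). 1 + (\<xi> \<bullet> b)\<^sup>2) * exp (- (c * r powr \<alpha>)) \<le> (1 + r\<^sup>2) ^ DIM('b) * exp (- (c * r powr \<alpha>))"
        by (intro mult_right_mono) auto
      also have "\<dots> \<le> C" by (rule C(2)) (simp add: r_def)
      finally show "exp (- (c * r powr \<alpha>)) \<le> C * (\<Prod>b\<in>Basis. 1 / (1 + (\<xi> \<bullet> b)\<^sup>2))"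
        using pos by (simp add: prod_dividef pos_le_divide_eq prod_pos mult.commute)
    qed simp
    finally show ?thesis by (simp add: mult.assoc)
  qed
  define K where "K = exp (DIM('b) / 2) * (exp c * C) * pi ^ DIM('b)"
  have "prob {\<omega> \<in> space M. norm (Y 1 \<omega>) \<le> \<epsilon>} \<le> K * \<epsilon> ^ DIM('b)" if "0 < \<epsilon>" for \<epsilon>
  proof -
    have "prob {\<omega> \<in> space M. norm (Y 1 \<omega>) \<le> \<epsilon>} \<le> prob {\<omega> \<in> space M. \<forall>b\<in>Basis. \<bar>Y 1 \<omega> \<bullet> b\<bar> \<le> \<epsilon>}"
      by (intro finite_measure_mono) (auto intro: order_trans[OF Basis_le_norm])
    also have "\<dots> \<le> K * \<epsilon> ^ DIM('b)"
      unfolding K_def using C(1) that bound[unfolded f_def] by (intro small_ball_of_char_bound) auto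
    finally show ?thesis .
  qed
  moreover have "0 \<le> K" using C(1) by (simp add: K_def)
  ultimately show ?thesis by blast
qed

text \<open>Scaling transports the null value from time 1 to every positive rational time, and right
  continuity to all times.\<close>

lemma strictly_stable_AE_zero:
  fixes Y :: "real \<Rightarrow> 'w \<Rightarrow> 'b::euclidean_space"
  assumes Y: "strictly_stable_levy M \<alpha> Y" and zero: "AE \<omega> in M. Y 1 \<omega> = 0"
  shows "AE \<omega> in M. \<forall>t\<ge>0. Y t \<omega> = 0"
proof -
  have L: "levy_process M Y" by (rule strictly_stable_levyD(1)[OF Y])
  interpret prob_space M by (rule levy_processD(1)[OF L])
  have rv: "random_variable borel (Y t)" if "0 \<le> t" for t using levy_processD(2)[OF L that] .
  have [measurable]: "random_variable borel (Y 1)" using rv by simp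
  have "AE \<omega> in M. Y q \<omega> = 0" if q: "q \<in> {q\<in>\<rat>. 0 < q}" for q
  proof -
    have [measurable]: "random_variable borel (Y q)" using rv q by simp
    have "prob {\<omega> \<in> space M. Y q \<omega> \<in> {0}} = prob {\<omega> \<in> space M. (q powr (1 / \<alpha>)) *\<^sub>R Y 1 \<omega> \<in> {0}}"
      using q by (intro strictly_stable_measure[OF Y]) auto
    also have "\<dots> = 1" using zero by (subst prob_Collect_eq_1) auto
    finally show ?thesis by (subst (asm) prob_Collect_eq_1) auto
  qed
  then have "AE \<omega> in M. \<forall>q\<in>{q\<in>\<rat>. 0 < q}. Y q \<omega> = 0"
    by (intro AE_ball_countable') (auto intro: countable_subset[OF _ countable_rat])
  then show ?thesis using levy_processD(7)[OF L]
  proof eventually_elim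
    case (elim \<omega>)
    show ?case
    proof (intro allI impI)
      fix t :: real assume t: "0 \<le> t"
      have lim: "((\<lambda>t. Y t \<omega>) \<longlongrightarrow> Y t \<omega>) (at_right t)" using elim(2) t by (simp add: continuous_within)
      show "Y t \<omega> = 0"
      proof (rule ccontr)
        assume "Y t \<omega> \<noteq> 0"
        with lim have "eventually (\<lambda>u. Y u \<omega> \<noteq> 0) (at_right t)" by (rule tendsto_imp_eventually_ne)
        then obtain b where b: "t < b" "\<And>u. t < u \<Longrightarrow> u < b \<Longrightarrow> Y u \<omega> \<noteq> 0" by (auto simp: eventually_at_right_field)
        obtain q where "q \<in> \<rat>" "t < q" "q < b" using Rats_dense_in_real[OF b(1)] by blast
        then show False using b(2)[of q] elim(1) t by auto
      qed
    qed
  qed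
qed

lemma AE_eq_0_of_small_balls:
  fixes X :: "'w \<Rightarrow> 'b::euclidean_space"
  assumes "prob_space M" and [measurable]: "X \<in> borel_measurable M"
    and one: "\<And>\<epsilon>. 0 < \<epsilon> \<Longrightarrow> measure M {\<omega> \<in> space M. norm (X \<omega>) \<le> \<epsilon>} = 1"
  shows "AE \<omega> in M. X \<omega> = 0"
proof -
  interpret prob_space M by fact
  have "AE \<omega> in M. \<forall>n::nat. norm (X \<omega>) \<le> 1 / real (Suc n)"
    unfolding AE_all_countable
  proof
    fix n :: nat
    have "prob {\<omega> \<in> space M. norm (X \<omega>) \<le> 1 / real (Suc n)} = 1" by (rule one) simp
    then show "AE \<omega> in M. norm (X \<omega>) \<le> 1 / real (Suc n)" by (subst (asm) prob_Collect_eq_1) auto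
  qed
  then show ?thesis
  proof eventually_elim
    case (elim \<omega>)
    show ?case
    proof (rule ccontr)
      assume "X \<omega> \<noteq> 0"
      then obtain n where "inverse (real (Suc n)) < norm (X \<omega>)" using reals_Archimedean[of "norm (X \<omega>)"] by auto
      with elim[rule_format, of n] show False by (simp add: inverse_eq_divide)
    qed
  qed
qed

lemma tendsto_prob_norm_le_at_top:
  fixes X :: "'w \<Rightarrow> 'b::euclidean_space"
  assumes "prob_space M" and [measurable]: "X \<in> borel_measurable M"
  shows "(\<lambda>n. measure M {\<omega> \<in> space M. norm (X \<omega>) \<le> real n}) \<longlonglongrightarrow> 1"
proof -
  interpret prob_space M by fact
  have "(\<lambda>n. prob {\<omega> \<in> space M. norm (X \<omega>) \<le> real n}) \<longlonglongrightarrow> prob (\<Union>n. {\<omega> \<in> space M. norm (X \<omega>) \<le> real n})"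
    by (rule finite_Lim_measure_incseq) (auto simp: incseq_def)
  moreover have "(\<Union>n. {\<omega> \<in> space M. norm (X \<omega>) \<le> real n}) = space M" using real_arch_simple by auto
  ultimately show ?thesis by (simp add: prob_space)
qed

text \<open>By scaling, the event at time t is that Y 1 has norm at most r * t powr (-1/\<alpha>).
  If t \<le> R powr (-\<alpha>) * r powr \<alpha>, this threshold is at least R, with R chosen from
  the tail of Y 1 alone.\<close>

lemma strictly_stable_tail:
  fixes Y :: "real \<Rightarrow> 'w \<Rightarrow> 'b::euclidean_space"
  assumes Y: "strictly_stable_levy M \<alpha> Y" and \<alpha>: "0 < \<alpha>" and \<eta>: "0 < \<eta>"
  shows "\<exists>c>0. c \<le> 1 \<and> (\<forall>r>0. \<forall>t\<ge>0. t \<le> c * r powr \<alpha> \<longrightarrow> 1 - \<eta> \<le> measure M {\<omega> \<in> space M. norm (Y t \<omega>) \<le> r})"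
proof -
  have L: "levy_process M Y" by (rule strictly_stable_levyD(1)[OF Y])
  interpret prob_space M by (rule levy_processD(1)[OF L])
  have rv: "random_variable borel (Y t)" if "0 \<le> t" for t using levy_processD(2)[OF L that] .
  have [measurable]: "random_variable borel (Y 1)" "random_variable borel (Y 0)" using rv by auto
  have "eventually (\<lambda>n. 1 - \<eta> < prob {\<omega> \<in> space M. norm (Y 1 \<omega>) \<le> real n}) sequentially"
    using tendsto_prob_norm_le_at_top[OF prob_space_axioms, of "Y 1"] \<eta> by (intro order_tendstoD(1)) auto
  then obtain n where n: "1 - \<eta> < prob {\<omega> \<in> space M. norm (Y 1 \<omega>) \<le> real n}" by (auto simp: eventually_sequentially)
  \<comment> \<open>Adding 1 gives R \<ge> 1 and therefore c \<le> 1.\<close>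
  define R where "R = real n + 1"
  have R: "1 \<le> R" by (simp add: R_def)
  define c where "c = R powr (- \<alpha>)"
  have "0 < c" using R by (simp add: c_def)
  moreover have "c \<le> 1" unfolding c_def using R \<alpha> powr_mono[of "- \<alpha>" 0 R] by simp
  moreover have "1 - \<eta> \<le> prob {\<omega> \<in> space M. norm (Y t \<omega>) \<le> r}" if r: "0 < r" and t: "0 \<le> t" "t \<le> c * r powr \<alpha>" for r t
  proof (cases "t = 0")
    case True
    have "AE \<omega> in M. norm (Y 0 \<omega>) \<le> r" using levy_processD(3)[OF L] by eventually_elim (use r in simp)
    then have "prob {\<omega> \<in> space M. norm (Y 0 \<omega>) \<le> r} = 1" by (subst prob_Collect_eq_1) auto
    then show ?thesis using True \<eta> by simp
  next
    case False
    then have t0: "0 < t" using t by simp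
    have "t powr (1 / \<alpha>) \<le> (c * r powr \<alpha>) powr (1 / \<alpha>)" using t \<alpha> by (intro powr_mono2) auto
    also have "\<dots> = c powr (1 / \<alpha>) * (r powr \<alpha>) powr (1 / \<alpha>)" by (rule powr_mult)
    also have "c powr (1 / \<alpha>) = R powr (- 1)" unfolding c_def powr_powr using \<alpha> by simp
    also have "(r powr \<alpha>) powr (1 / \<alpha>) = r" unfolding powr_powr using \<alpha> r by simp
    also have "R powr (- 1) * r = r / R" using R by (simp add: powr_minus_divide)
    finally have "R * t powr (1 / \<alpha>) \<le> r" using R by (simp add: field_simps)
    then have "R \<le> r * t powr (- (1 / \<alpha>))" using t0 by (simp add: powr_minus field_simps)
    then have "real n \<le> r * t powr (- (1 / \<alpha>))" by (simp add: R_def)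
    then have "prob {\<omega> \<in> space M. norm (Y 1 \<omega>) \<le> real n} \<le> prob {\<omega> \<in> space M. norm (Y 1 \<omega>) \<le> r * t powr (- (1 / \<alpha>))}"
      by (intro finite_measure_mono) auto
    then show ?thesis using n by (simp add: strictly_stable_measure_cball[OF Y t0])
  qed
  ultimately show ?thesis by blast
qed

text \<open>In the degenerate case consecutive increments are almost surely equal although
  independent, so the event |W 1| \<le> \<epsilon> is independent of itself and has probability 0 or
  1. As W is not the zero process, the probability is 0 for some e > 0, and 1 / e serves as
  constant. This includes the pure drift of index 1.\<close>

lemma stable_real_small_ball:
  fixes W :: "real \<Rightarrow> 'w \<Rightarrow> real"
  assumes W: "strictly_stable_levy M \<alpha> W" and \<alpha>: "0 < \<alpha>" and nz: "\<not> (AE \<omega> in M. \<forall>t\<ge>0. W t \<omega> = 0)"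
  shows "\<exists>C\<ge>0. \<forall>\<epsilon>>0. measure M {\<omega> \<in> space M. \<bar>W 1 \<omega>\<bar> \<le> \<epsilon>} \<le> C * \<epsilon>"
proof (cases "\<forall>u. u \<noteq> 0 \<longrightarrow> cmod (char (distr M borel (\<lambda>\<omega>. u \<bullet> W 1 \<omega>)) 1) < 1")
  case True
  then show ?thesis using strictly_stable_small_ball[OF W \<alpha>] by simp
next
  case False
  have L: "levy_process M W" by (rule strictly_stable_levyD(1)[OF W])
  interpret prob_space M by (rule levy_processD(1)[OF L])
  have [measurable]: "random_variable borel (W 0)" "random_variable borel (W 1)" "random_variable borel (W 2)"
    using levy_processD(2)[OF L] by auto
  from False obtain u where u: "u \<noteq> 0" "1 \<le> cmod (char (distr M borel (\<lambda>\<omega>. u \<bullet> W 1 \<omega>)) 1)" by (auto simp: not_less)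
  have uW: "strictly_stable_levy M \<alpha> (\<lambda>t \<omega>. u \<bullet> W t \<omega>)"
    by (rule strictly_stable_levy_bounded_linear[OF W bounded_linear_inner_right])
  interpret D: real_distribution "distr M borel (\<lambda>\<omega>. u \<bullet> W 1 \<omega>)" by (rule real_distribution_distr) simp
  have "cmod (char (distr M borel (\<lambda>\<omega>. u \<bullet> W 1 \<omega>)) 1) = 1" using u(2) D.cmod_char_le_1[of 1] by simp
  from stable_char_eq_1_imp[OF uW \<alpha> this] have "AE \<omega> in M. W 2 \<omega> = 2 * W 1 \<omega>"
    by eventually_elim (use u(1) in simp)
  then have X: "AE \<omega> in M. W 2 \<omega> - W 1 \<omega> = W 1 \<omega> - W 0 \<omega> \<and> W 1 \<omega> - W 0 \<omega> = W 1 \<omega>"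
    using levy_processD(3)[OF L] by eventually_elim simp
  define p where "p \<epsilon> = prob {\<omega> \<in> space M. \<bar>W 1 \<omega>\<bar> \<le> \<epsilon>}" for \<epsilon>
  have p: "p \<epsilon> = 0 \<or> p \<epsilon> = 1" for \<epsilon>
  proof -
    have "indep_var borel (\<lambda>\<omega>. W 1 \<omega> - W 0 \<omega>) borel (\<lambda>\<omega>. W 2 \<omega> - W 1 \<omega>)"
      using levy_process_indep_increments[OF L, of 1 1] by simp
    from indep_varD[OF this, of "{-\<epsilon>..\<epsilon>}" "{-\<epsilon>..\<epsilon>}"]
    have "prob {\<omega> \<in> space M. W 1 \<omega> - W 0 \<omega> \<in> {-\<epsilon>..\<epsilon>} \<and> W 2 \<omega> - W 1 \<omega> \<in> {-\<epsilon>..\<epsilon>}} =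
      prob {\<omega> \<in> space M. W 1 \<omega> - W 0 \<omega> \<in> {-\<epsilon>..\<epsilon>}} * prob {\<omega> \<in> space M. W 2 \<omega> - W 1 \<omega> \<in> {-\<epsilon>..\<epsilon>}}"
      by (simp add: vimage_def Int_def conj_commute del: atLeastAtMost_iff)
    moreover have "prob {\<omega> \<in> space M. W 1 \<omega> - W 0 \<omega> \<in> {-\<epsilon>..\<epsilon>} \<and> W 2 \<omega> - W 1 \<omega> \<in> {-\<epsilon>..\<epsilon>}} = p \<epsilon>"
      unfolding p_def using X by (intro measure_eq_AE) (auto simp: abs_le_iff)
    moreover have "prob {\<omega> \<in> space M. W 1 \<omega> - W 0 \<omega> \<in> {-\<epsilon>..\<epsilon>}} = p \<epsilon>"
      unfolding p_def using X by (intro measure_eq_AE) (auto simp: abs_le_iff)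
    moreover have "prob {\<omega> \<in> space M. W 2 \<omega> - W 1 \<omega> \<in> {-\<epsilon>..\<epsilon>}} = p \<epsilon>"
      unfolding p_def using X by (intro measure_eq_AE) (auto simp: abs_le_iff)
    ultimately have "p \<epsilon> = p \<epsilon> * p \<epsilon>" by simp
    then show ?thesis by simp
  qed
  have "\<exists>\<epsilon>>0. p \<epsilon> = 0"
  proof (rule ccontr)
    assume "\<not> (\<exists>\<epsilon>>0. p \<epsilon> = 0)"
    then have "prob {\<omega> \<in> space M. norm (W 1 \<omega>) \<le> \<epsilon>} = 1" if "0 < \<epsilon>" for \<epsilon> using p[of \<epsilon>] that by (auto simp: p_def)
    then have "AE \<omega> in M. W 1 \<omega> = 0" by (intro AE_eq_0_of_small_balls prob_space_axioms) auto
    with strictly_stable_AE_zero[OF W] nz show False by simp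
  qed
  then obtain e where e: "0 < e" "p e = 0" by blast
  have "p \<epsilon> \<le> 1 / e * \<epsilon>" if "0 < \<epsilon>" for \<epsilon>
  proof (cases "\<epsilon> \<le> e")
    case True
    then have "p \<epsilon> \<le> p e" unfolding p_def by (intro finite_measure_mono) auto
    then have "p \<epsilon> \<le> 0" using e by simp
    also have "0 \<le> 1 / e * \<epsilon>" using e that by simp
    finally show ?thesis .
  next
    case False
    have "p \<epsilon> \<le> 1" by (simp add: p_def)
    also have "1 \<le> 1 / e * \<epsilon>" using False e by (simp add: field_simps)
    finally show ?thesis .
  qed
  then show ?thesis using e unfolding p_def by (intro exI[of _ "1 / e"]) auto
qed

text \<open>Modulus 1 would give W 2 = 2 * W 1 almost surely, whereas scaling gives W 2 the law of 2
  powr (1/\<alpha>) * W 1. The law of |W 1| would then be invariant under dilation by k = 2 powr (1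
  - 1/\<alpha>) > 1 and so sit at 0, confining Y to a hyperplane. At \<alpha> = 1 the ratio k is 1,
  and drifts are genuine exceptions.\<close>

lemma stable_char_less_1:
  fixes Y :: "real \<Rightarrow> 'w \<Rightarrow> 'b::euclidean_space"
  assumes Y: "strictly_stable_levy M \<alpha> Y" and \<alpha>: "1 < \<alpha>" and full: "genuinely_full_dim M Y" and u: "u \<noteq> 0"
  shows "cmod (char (distr M borel (\<lambda>\<omega>. u \<bullet> Y 1 \<omega>)) 1) < 1"
proof (rule ccontr)
  assume *: "\<not> ?thesis"
  have L: "levy_process M Y" by (rule strictly_stable_levyD(1)[OF Y])
  interpret prob_space M by (rule levy_processD(1)[OF L])
  have [measurable]: "random_variable borel (Y 1)" "random_variable borel (Y 2)"
    using levy_processD(2)[OF L] by auto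
  define W where "W t \<omega> = u \<bullet> Y t \<omega>" for t \<omega>
  have W: "strictly_stable_levy M \<alpha> W"
    unfolding W_def by (rule strictly_stable_levy_bounded_linear[OF Y bounded_linear_inner_right])
  have [measurable]: "random_variable borel (W 1)" "random_variable borel (W 2)" unfolding W_def by auto
  interpret D: real_distribution "distr M borel (W 1)" by (rule real_distribution_distr) simp
  have "cmod (char (distr M borel (W 1)) 1) = 1"
    using * D.cmod_char_le_1[of 1] unfolding W_def[symmetric, abs_def] by simp
  then have AE2: "AE \<omega> in M. W 2 \<omega> = 2 * W 1 \<omega>" using \<alpha> by (intro stable_char_eq_1_imp[OF W]) auto
  define k :: real where "k = 2 * 2 powr (- (1 / \<alpha>))"
  have "1 < k"
  proof -
    have "0 < 1 - 1 / \<alpha>" using \<alpha> by simp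
    then have "2 powr 0 < 2 powr (1 - 1 / \<alpha>)" by (intro powr_less_mono) auto
    then show ?thesis by (simp add: k_def powr_diff powr_minus_divide)
  qed
  define p where "p \<epsilon> = prob {\<omega> \<in> space M. norm (W 1 \<omega>) \<le> \<epsilon>}" for \<epsilon>
  have step: "p \<epsilon> = p (k * \<epsilon>)" for \<epsilon>
  proof -
    have "p \<epsilon> = prob {\<omega> \<in> space M. norm (W 2 \<omega>) \<le> 2 * \<epsilon>}"
      unfolding p_def using AE2 by (intro measure_eq_AE) auto
    also have "\<dots> = p (k * \<epsilon>)" using strictly_stable_measure_cball[OF W, of 2 "2 * \<epsilon>"] by (simp add: p_def k_def mult_ac)
    finally show ?thesis .
  qed
  have iter: "p \<epsilon> = p (k ^ n * \<epsilon>)" for \<epsilon> n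
  proof (induction n)
    case (Suc n)
    then show ?case using step[of "k ^ n * \<epsilon>"] by (simp add: mult_ac)
  qed simp
  have "p \<epsilon> = 1" if \<epsilon>: "0 < \<epsilon>" for \<epsilon>
  proof -
    have "p (real n) \<le> p \<epsilon>" for n
    proof -
      obtain m where "real n / \<epsilon> < k ^ m" using real_arch_pow[OF \<open>1 < k\<close>] by blast
      then have "real n \<le> k ^ m * \<epsilon>" using \<epsilon> by (simp add: field_simps)
      then have "p (real n) \<le> p (k ^ m * \<epsilon>)" unfolding p_def by (intro finite_measure_mono) auto
      then show ?thesis using iter[of \<epsilon> m] by simp
    qed
    then have "1 \<le> p \<epsilon>"
      using tendsto_prob_norm_le_at_top[OF prob_space_axioms, of "W 1"] unfolding p_def by (intro LIMSEQ_le_const2) auto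
    then show ?thesis using prob_le_1 by (simp add: p_def order_antisym)
  qed
  then have "AE \<omega> in M. W 1 \<omega> = 0" unfolding p_def by (intro AE_eq_0_of_small_balls prob_space_axioms) auto
  from strictly_stable_AE_zero[OF W this] have "AE \<omega> in M. \<forall>t\<ge>0. Y t \<omega> \<in> {x. u \<bullet> x = 0}" by (simp add: W_def)
  moreover have "subspace {x. u \<bullet> x = 0}" by (rule subspace_hyperplane)
  moreover have "{x. u \<bullet> x = 0} \<noteq> UNIV"
  proof
    assume "{x. u \<bullet> x = 0} = UNIV"
    then have "u \<in> {x. u \<bullet> x = 0}" by blast
    then show False using u by simp
  qed
  ultimately show False using full unfolding genuinely_full_dim_def by blast
qed

subsection \<open>Independent Levy processes\<close>

lemma indep_processesD:
  assumes "prob_space M" "indep_processes M X Y" "A \<in> sets path_space" "B \<in> sets path_space"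
  shows "measure M {\<omega> \<in> space M. path_of X \<omega> \<in> A \<and> path_of Y \<omega> \<in> B} =
    measure M {\<omega> \<in> space M. path_of X \<omega> \<in> A} * measure M {\<omega> \<in> space M. path_of Y \<omega> \<in> B}"
proof -
  interpret prob_space M by fact
  have "prob ((path_of X -` A \<inter> space M) \<inter> (path_of Y -` B \<inter> space M)) = prob (path_of X -` A \<inter> space M) * prob (path_of Y -` B \<inter> space M)"
    using assms(2-4) unfolding indep_processes_def by (intro indep_setD) auto
  moreover have "(path_of X -` A \<inter> space M) \<inter> (path_of Y -` B \<inter> space M) = {\<omega> \<in> space M. path_of X \<omega> \<in> A \<and> path_of Y \<omega> \<in> B}"
    "path_of X -` A \<inter> space M = {\<omega> \<in> space M. path_of X \<omega> \<in> A}" "path_of Y -` B \<inter> space M = {\<omega> \<in> space M. path_of Y \<omega> \<in> B}"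
    by auto
  ultimately show ?thesis by simp
qed

lemma indep_processesI:
  assumes "prob_space M" "path_of X \<in> M \<rightarrow>\<^sub>M path_space" "path_of Y \<in> M \<rightarrow>\<^sub>M path_space"
    and "\<And>A B. A \<in> sets path_space \<Longrightarrow> B \<in> sets path_space \<Longrightarrow>
      measure M {\<omega> \<in> space M. path_of X \<omega> \<in> A \<and> path_of Y \<omega> \<in> B} =
      measure M {\<omega> \<in> space M. path_of X \<omega> \<in> A} * measure M {\<omega> \<in> space M. path_of Y \<omega> \<in> B}"
  shows "indep_processes M X Y"
proof -
  interpret prob_space M by fact
  show ?thesis
    unfolding indep_processes_def indep_sets2_eq
  proof (intro conjI ballI)
    show "{path_of X -` A \<inter> space M |A. A \<in> sets path_space} \<subseteq> events" using assms(2) by auto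
    show "{path_of Y -` A \<inter> space M |A. A \<in> sets path_space} \<subseteq> events" using assms(3) by auto
    fix a b assume "a \<in> {path_of X -` A \<inter> space M |A. A \<in> sets path_space}" "b \<in> {path_of Y -` A \<inter> space M |A. A \<in> sets path_space}"
    then obtain A B where AB: "A \<in> sets path_space" "B \<in> sets path_space" "a = path_of X -` A \<inter> space M" "b = path_of Y -` B \<inter> space M"
      by blast
    have "a = {\<omega> \<in> space M. path_of X \<omega> \<in> A}" "b = {\<omega> \<in> space M. path_of Y \<omega> \<in> B}"
      "a \<inter> b = {\<omega> \<in> space M. path_of X \<omega> \<in> A \<and> path_of Y \<omega> \<in> B}"
      unfolding AB(3,4) by auto
    then show "prob (a \<inter> b) = prob a * prob b" by (simp only: assms(4)[OF AB(1,2)])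
  qed
qed

text \<open>Replacing D by the functional of E changes events only by null sets, so probabilities of
  intersections are unaffected.\<close>

lemma indep_processes_AE_functional:
  fixes D E :: "real \<Rightarrow> 'w \<Rightarrow> 'a::euclidean_space" and Y :: "real \<Rightarrow> 'w \<Rightarrow> 'b::euclidean_space"
  assumes P: "prob_space M" and ind: "indep_processes M E Y" and \<Phi>: "\<Phi> \<in> path_space \<rightarrow>\<^sub>M path_space"
    and E: "\<And>t. 0 \<le> t \<Longrightarrow> E t \<in> borel_measurable M" and D: "\<And>t. 0 \<le> t \<Longrightarrow> D t \<in> borel_measurable M"
    and Y: "\<And>t. 0 \<le> t \<Longrightarrow> Y t \<in> borel_measurable M"
    and eq: "AE \<omega> in M. path_of D \<omega> = \<Phi> (path_of E \<omega>)"
  shows "indep_processes M D Y"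
proof (rule indep_processesI[OF P path_of_measurable path_of_measurable])
  fix A :: "(real \<Rightarrow> 'a) set" and B :: "(real \<Rightarrow> 'b) set"
  assume A: "A \<in> sets path_space" and B: "B \<in> sets path_space"
  define A' where "A' = \<Phi> -` A \<inter> space path_space"
  have A': "A' \<in> sets path_space" unfolding A'_def using \<Phi> A by (rule measurable_sets)
  have [measurable]: "path_of D \<in> M \<rightarrow>\<^sub>M path_space" "path_of E \<in> M \<rightarrow>\<^sub>M path_space" "path_of Y \<in> M \<rightarrow>\<^sub>M path_space"
    using D E Y by (auto intro: path_of_measurable)
  note [measurable] = A B A'
  have memA: "AE \<omega> in M. path_of D \<omega> \<in> A \<longleftrightarrow> path_of E \<omega> \<in> A'"
    using eq by eventually_elim (auto simp: A'_def space_PiM path_of_def)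
  have "measure M {\<omega> \<in> space M. path_of D \<omega> \<in> A \<and> path_of Y \<omega> \<in> B} = measure M {\<omega> \<in> space M. path_of E \<omega> \<in> A' \<and> path_of Y \<omega> \<in> B}"
    using memA by (intro measure_eq_AE) auto
  also have "\<dots> = measure M {\<omega> \<in> space M. path_of E \<omega> \<in> A'} * measure M {\<omega> \<in> space M. path_of Y \<omega> \<in> B}"
    by (rule indep_processesD[OF P ind A' B])
  also have "measure M {\<omega> \<in> space M. path_of E \<omega> \<in> A'} = measure M {\<omega> \<in> space M. path_of D \<omega> \<in> A}"
    using memA by (intro measure_eq_AE) auto
  finally show "measure M {\<omega> \<in> space M. path_of D \<omega> \<in> A \<and> path_of Y \<omega> \<in> B} =
      measure M {\<omega> \<in> space M. path_of D \<omega> \<in> A} * measure M {\<omega> \<in> space M. path_of Y \<omega> \<in> B}" .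
qed (use D Y in auto)

lemma path_component_measurable: "0 \<le> t \<Longrightarrow> (\<lambda>p. p t) \<in> borel_measurable path_space"
  by (rule measurable_component_singleton) simp

lemma indep_processes_increments:
  fixes X :: "real \<Rightarrow> 'w \<Rightarrow> 'a::euclidean_space" and Y :: "real \<Rightarrow> 'w \<Rightarrow> 'b::euclidean_space"
  assumes P: "prob_space M" and ind: "indep_processes M X Y" and t: "0 \<le> s" "0 \<le> t" "0 \<le> s'" "0 \<le> t'"
    and A: "A \<in> sets borel" and B: "B \<in> sets borel"
  shows "measure M {\<omega> \<in> space M. X t \<omega> - X s \<omega> \<in> A \<and> Y t' \<omega> - Y s' \<omega> \<in> B} =
    measure M {\<omega> \<in> space M. X t \<omega> - X s \<omega> \<in> A} * measure M {\<omega> \<in> space M. Y t' \<omega> - Y s' \<omega> \<in> B}"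
proof -
  note [measurable] = A B path_component_measurable[OF t(1)] path_component_measurable[OF t(2)]
    path_component_measurable[OF t(3)] path_component_measurable[OF t(4)]
  have 1: "{p \<in> space (path_space :: (real \<Rightarrow> 'a) measure). p t - p s \<in> A} \<in> sets path_space"
    by measurable
  have 2: "{p \<in> space (path_space :: (real \<Rightarrow> 'b) measure). p t' - p s' \<in> B} \<in> sets path_space"
    by measurable
  show ?thesis using indep_processesD[OF P ind 1 2] t by (simp add: path_of_def space_PiM)
qed

lemma distr_Pair_eq:
  assumes P: "prob_space M" and [measurable]: "X \<in> M \<rightarrow>\<^sub>M S" "Y \<in> M \<rightarrow>\<^sub>M T"
    and ind: "\<And>A B. A \<in> sets S \<Longrightarrow> B \<in> sets T \<Longrightarrow>
      measure M {\<omega> \<in> space M. X \<omega> \<in> A \<and> Y \<omega> \<in> B} = measure M {\<omega> \<in> space M. X \<omega> \<in> A} * measure M {\<omega> \<in> space M. Y \<omega> \<in> B}"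
  shows "distr M S X \<Otimes>\<^sub>M distr M T Y = distr M (S \<Otimes>\<^sub>M T) (\<lambda>\<omega>. (X \<omega>, Y \<omega>))"
proof -
  interpret prob_space M by fact
  interpret DX: prob_space "distr M S X" by (rule prob_space_distr) simp
  interpret DY: prob_space "distr M T Y" by (rule prob_space_distr) simp
  show ?thesis
  proof (rule pair_measure_eqI)
    fix A B assume "A \<in> sets (distr M S X)" "B \<in> sets (distr M T Y)"
    then have [measurable]: "A \<in> sets S" "B \<in> sets T" by auto
    have "X -` A \<inter> space M = {\<omega> \<in> space M. X \<omega> \<in> A}" "Y -` B \<inter> space M = {\<omega> \<in> space M. Y \<omega> \<in> B}"
      "(\<lambda>\<omega>. (X \<omega>, Y \<omega>)) -` (A \<times> B) \<inter> space M = {\<omega> \<in> space M. X \<omega> \<in> A \<and> Y \<omega> \<in> B}" by auto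
    then show "emeasure (distr M S X) A * emeasure (distr M T Y) B = emeasure (distr M (S \<Otimes>\<^sub>M T) (\<lambda>\<omega>. (X \<omega>, Y \<omega>))) (A \<times> B)"
      by (simp add: emeasure_distr emeasure_eq_measure ind ennreal_mult)
  qed (simp_all add: DX.sigma_finite_measure_axioms DY.sigma_finite_measure_axioms)
qed

text \<open>Stationarity holds because the law of an increment of the pair is the product of the two
  marginal laws. For independence, events are tested on rectangles: the X part is split from the Y
  part by independence of the processes, each part is split over time, and the factors are
  recombined at each time.\<close>

lemma levy_process_Pair:
  fixes X :: "real \<Rightarrow> 'w \<Rightarrow> 'a::euclidean_space" and Y :: "real \<Rightarrow> 'w \<Rightarrow> 'b::euclidean_space"
  assumes X: "levy_process M X" and Y: "levy_process M Y" and ind: "indep_processes M X Y"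
  shows "levy_process M (\<lambda>t \<omega>. (X t \<omega>, Y t \<omega>))"
  unfolding levy_process_def
proof (intro conjI allI impI)
  show P: "prob_space M" by (rule levy_processD(1)[OF X])
  interpret prob_space M by (rule P)
  have rX: "random_variable borel (X t)" and rY: "random_variable borel (Y t)" if "0 \<le> t" for t
    using levy_processD(2)[OF X that] levy_processD(2)[OF Y that] .
  show "(\<lambda>\<omega>. (X t \<omega>, Y t \<omega>)) \<in> borel_measurable M" if "0 \<le> t" for t
    using rX[OF that] rY[OF that] by simp
  show "AE \<omega> in M. (X 0 \<omega>, Y 0 \<omega>) = 0"
    using levy_processD(3)[OF X] levy_processD(3)[OF Y] by eventually_elim (simp add: zero_prod_def)
  show "distr M borel (\<lambda>\<omega>. (X (s + h) \<omega>, Y (s + h) \<omega>) - (X s \<omega>, Y s \<omega>)) = distr M borel (\<lambda>\<omega>. (X h \<omega>, Y h \<omega>))"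
    if sh: "0 \<le> s" "0 \<le> h" for s h
  proof -
    have [measurable]: "random_variable borel (X (s + h))" "random_variable borel (X s)" "random_variable borel (X h)"
      "random_variable borel (Y (s + h))" "random_variable borel (Y s)" "random_variable borel (Y h)"
      "random_variable borel (X 0)" "random_variable borel (Y 0)"
      using rX rY sh by auto
    have "distr M (borel \<Otimes>\<^sub>M borel) (\<lambda>\<omega>. (X (s + h) \<omega> - X s \<omega>, Y (s + h) \<omega> - Y s \<omega>)) =
        distr M borel (\<lambda>\<omega>. X (s + h) \<omega> - X s \<omega>) \<Otimes>\<^sub>M distr M borel (\<lambda>\<omega>. Y (s + h) \<omega> - Y s \<omega>)"
      using sh by (intro distr_Pair_eq[symmetric] indep_processes_increments ind P) auto
    also have "\<dots> = distr M borel (\<lambda>\<omega>. X h \<omega> - X 0 \<omega>) \<Otimes>\<^sub>M distr M borel (\<lambda>\<omega>. Y h \<omega> - Y 0 \<omega>)"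
    proof -
      have "distr M borel (\<lambda>\<omega>. X h \<omega> - X 0 \<omega>) = distr M borel (X h)" "distr M borel (\<lambda>\<omega>. Y h \<omega> - Y 0 \<omega>) = distr M borel (Y h)"
        using levy_processD(3)[OF X] levy_processD(3)[OF Y] by (auto intro!: distr_cong_AE)
      then show ?thesis using levy_processD(5)[OF X sh] levy_processD(5)[OF Y sh] by simp
    qed
    also have "\<dots> = distr M (borel \<Otimes>\<^sub>M borel) (\<lambda>\<omega>. (X h \<omega> - X 0 \<omega>, Y h \<omega> - Y 0 \<omega>))"
      using sh by (intro distr_Pair_eq indep_processes_increments ind P) auto
    also have "\<dots> = distr M (borel \<Otimes>\<^sub>M borel) (\<lambda>\<omega>. (X h \<omega>, Y h \<omega>))"
      using levy_processD(3)[OF X] levy_processD(3)[OF Y] by (intro distr_cong_AE) auto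
    finally show ?thesis by (simp add: borel_prod)
  qed
  show "AE \<omega> in M. cadlag (\<lambda>t. (X t \<omega>, Y t \<omega>))"
    using levy_processD(6)[OF X] levy_processD(6)[OF Y]
  proof eventually_elim
    case (elim \<omega>)
    have "\<exists>l. ((\<lambda>t. (X t \<omega>, Y t \<omega>)) \<longlongrightarrow> l) (at_left t)" if t: "0 < t" for t
    proof -
      obtain l l' where "((\<lambda>t. X t \<omega>) \<longlongrightarrow> l) (at_left t)" "((\<lambda>t. Y t \<omega>) \<longlongrightarrow> l') (at_left t)"
        using elim t unfolding cadlag_def by blast
      then show ?thesis using tendsto_Pair by blast
    qed
    then show ?case using elim by (auto simp: cadlag_def intro: continuous_Pair)
  qed
  show "indep_vars (\<lambda>_. borel) (\<lambda>i \<omega>. (X (\<tau> (Suc i)) \<omega>, Y (\<tau> (Suc i)) \<omega>) - (X (\<tau> i) \<omega>, Y (\<tau> i) \<omega>)) {..<n}"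
    if \<tau>: "0 \<le> \<tau> 0 \<and> mono_on {..n} \<tau>" for n \<tau>
  \<comment> \<open>The intersections over {..<n} used below describe events only for a nonempty
    index set.\<close>
  proof (cases "n = 0")
    case True
    then show ?thesis by (simp add: indep_vars_def indep_sets_def)
  next
    case False
    have \<tau>0: "0 \<le> \<tau> i" if "i \<le> n" for i
      using \<tau> that mono_onD[of "{..n}" \<tau> 0 i] by force
    define U where "U i \<omega> = X (\<tau> (Suc i)) \<omega> - X (\<tau> i) \<omega>" for i \<omega>
    define V where "V i \<omega> = Y (\<tau> (Suc i)) \<omega> - Y (\<tau> i) \<omega>" for i \<omega>
    have U_rv [measurable]: "random_variable borel (U i)" and V_rv [measurable]: "random_variable borel (V i)" if "i < n" for i
      unfolding U_def V_def using that rX[OF \<tau>0] rY[OF \<tau>0] by (auto intro!: borel_measurable_diff)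
    have indU: "indep_vars (\<lambda>_. borel) U {..<n}" and indV: "indep_vars (\<lambda>_. borel) V {..<n}"
      unfolding U_def V_def using \<tau> by (auto intro!: levy_processD(4)[OF X] levy_processD(4)[OF Y])
    define R where "R = {A \<times> B | A B. A \<in> sets (borel :: 'a measure) \<and> B \<in> sets (borel :: 'b measure)}"
    have "indep_vars (\<lambda>_. borel \<Otimes>\<^sub>M borel) (\<lambda>i \<omega>. (U i \<omega>, V i \<omega>)) {..<n}"
    proof (subst indep_vars_finite[where E = "\<lambda>_. R"])
      show "sets (borel \<Otimes>\<^sub>M borel :: ('a \<times> 'b) measure) = sigma_sets (space (borel \<Otimes>\<^sub>M borel)) R"
        unfolding R_def by (simp add: sets_pair_measure space_pair_measure)
      show "Int_stable R" unfolding R_def by (rule Int_stable_pair_measure_generator)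
      show "space (borel \<Otimes>\<^sub>M borel :: ('a \<times> 'b) measure) \<in> R"
        unfolding R_def space_pair_measure by (auto intro!: exI[of _ UNIV])
      show "R \<subseteq> Pow (space (borel \<Otimes>\<^sub>M borel))" by (simp add: space_pair_measure)
      show "\<forall>C\<in>{..<n} \<rightarrow> R. prob (\<Inter>j\<in>{..<n}. (\<lambda>\<omega>. (U j \<omega>, V j \<omega>)) -` C j \<inter> space M) =
          (\<Prod>j<n. prob ((\<lambda>\<omega>. (U j \<omega>, V j \<omega>)) -` C j \<inter> space M))"
      proof
        fix C assume "C \<in> {..<n} \<rightarrow> R"
        then have "\<forall>i\<in>{..<n}. \<exists>A B. C i = A \<times> B \<and> A \<in> sets borel \<and> B \<in> sets borel" by (auto simp: R_def Pi_iff)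
        then obtain A B where C: "\<And>i. i < n \<Longrightarrow> C i = A i \<times> B i" "\<And>i. i < n \<Longrightarrow> A i \<in> sets borel" "\<And>i. i < n \<Longrightarrow> B i \<in> sets borel"
          by (metis lessThan_iff)
        define F where "F = {p \<in> space (path_space :: (real \<Rightarrow> 'a) measure). \<forall>i\<in>{..<n}. p (\<tau> (Suc i)) - p (\<tau> i) \<in> A i}"
        define G where "G = {p \<in> space (path_space :: (real \<Rightarrow> 'b) measure). \<forall>i\<in>{..<n}. p (\<tau> (Suc i)) - p (\<tau> i) \<in> B i}"
        have F: "F \<in> sets path_space" unfolding F_def
        proof (rule sets.sets_Collect_finite_All)
          fix i assume i: "i \<in> {..<n}"
          then have [measurable]: "(\<lambda>p. p (\<tau> i) :: 'a) \<in> borel_measurable path_space" "(\<lambda>p. p (\<tau> (Suc i)) :: 'a) \<in> borel_measurable path_space"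
              "A i \<in> sets borel"
            using \<tau>0 C(2) by (auto intro!: path_component_measurable)
          show "{p \<in> space (path_space :: (real \<Rightarrow> 'a) measure). p (\<tau> (Suc i)) - p (\<tau> i) \<in> A i} \<in> sets path_space"
            by measurable
        qed simp
        have G: "G \<in> sets path_space" unfolding G_def
        proof (rule sets.sets_Collect_finite_All)
          fix i assume i: "i \<in> {..<n}"
          then have [measurable]: "(\<lambda>p. p (\<tau> i) :: 'b) \<in> borel_measurable path_space" "(\<lambda>p. p (\<tau> (Suc i)) :: 'b) \<in> borel_measurable path_space"
              "B i \<in> sets borel"
            using \<tau>0 C(3) by (auto intro!: path_component_measurable)
          show "{p \<in> space (path_space :: (real \<Rightarrow> 'b) measure). p (\<tau> (Suc i)) - p (\<tau> i) \<in> B i} \<in> sets path_space"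
            by measurable
        qed simp
        have memF: "path_of X \<omega> \<in> F \<longleftrightarrow> (\<forall>i<n. U i \<omega> \<in> A i)" and memG: "path_of Y \<omega> \<in> G \<longleftrightarrow> (\<forall>i<n. V i \<omega> \<in> B i)" for \<omega>
          using \<tau>0 by (auto simp: F_def G_def path_of_def space_PiM U_def V_def)
        have "(\<Inter>j\<in>{..<n}. (\<lambda>\<omega>. (U j \<omega>, V j \<omega>)) -` C j \<inter> space M) = {\<omega> \<in> space M. path_of X \<omega> \<in> F \<and> path_of Y \<omega> \<in> G}"
          using False C(1) by (auto simp: memF memG)
        then have "prob (\<Inter>j\<in>{..<n}. (\<lambda>\<omega>. (U j \<omega>, V j \<omega>)) -` C j \<inter> space M) =
            prob {\<omega> \<in> space M. path_of X \<omega> \<in> F} * prob {\<omega> \<in> space M. path_of Y \<omega> \<in> G}"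
          using indep_processesD[OF P ind F G] by simp
        also have "{\<omega> \<in> space M. path_of X \<omega> \<in> F} = (\<Inter>j\<in>{..<n}. U j -` A j \<inter> space M)" using False by (auto simp: memF)
        also have "{\<omega> \<in> space M. path_of Y \<omega> \<in> G} = (\<Inter>j\<in>{..<n}. V j -` B j \<inter> space M)" using False by (auto simp: memG)
        also have "prob (\<Inter>j\<in>{..<n}. U j -` A j \<inter> space M) = (\<Prod>j<n. prob (U j -` A j \<inter> space M))"
          using False C(2) by (intro indep_varsD[OF indU]) auto
        also have "prob (\<Inter>j\<in>{..<n}. V j -` B j \<inter> space M) = (\<Prod>j<n. prob (V j -` B j \<inter> space M))"
          using False C(3) by (intro indep_varsD[OF indV]) auto
        also have "(\<Prod>j<n. prob (U j -` A j \<inter> space M)) * (\<Prod>j<n. prob (V j -` B j \<inter> space M)) =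
            (\<Prod>j<n. prob ((\<lambda>\<omega>. (U j \<omega>, V j \<omega>)) -` C j \<inter> space M))"
          unfolding prod.distrib[symmetric]
        proof (intro prod.cong refl)
          fix j assume "j \<in> {..<n}"
          then have j: "j < n" by simp
          have "(\<lambda>\<omega>. (U j \<omega>, V j \<omega>)) -` C j \<inter> space M = {\<omega> \<in> space M. U j \<omega> \<in> A j \<and> V j \<omega> \<in> B j}"
            "U j -` A j \<inter> space M = {\<omega> \<in> space M. U j \<omega> \<in> A j}" "V j -` B j \<inter> space M = {\<omega> \<in> space M. V j \<omega> \<in> B j}"
            using C(1)[OF j] by auto
          then show "prob (U j -` A j \<inter> space M) * prob (V j -` B j \<inter> space M) = prob ((\<lambda>\<omega>. (U j \<omega>, V j \<omega>)) -` C j \<inter> space M)"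
            using indep_processes_increments[OF P ind, of "\<tau> j" "\<tau> (Suc j)" "\<tau> j" "\<tau> (Suc j)" "A j" "B j"] \<tau>0 j C(2,3)[OF j]
            by (simp add: U_def V_def)
        qed
        finally show "prob (\<Inter>j\<in>{..<n}. (\<lambda>\<omega>. (U j \<omega>, V j \<omega>)) -` C j \<inter> space M) =
          (\<Prod>j<n. prob ((\<lambda>\<omega>. (U j \<omega>, V j \<omega>)) -` C j \<inter> space M))" .
      qed
    qed (use False in \<open>auto simp: lessThan_empty_iff\<close>)
    then show ?thesis by (simp add: U_def V_def borel_prod)
  qed
qed



text \<open>Summands are added one at a time: the partial sum is independent of the next process, so
  the pair is a Levy process, and addition is a linear map of the pair. For several distinct indices
  the sum is no longer self-similar, so the Levy property is all that can be transferred.\<close>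

lemma levy_process_weighted_sum:
  fixes D :: "nat \<Rightarrow> real \<Rightarrow> 'w \<Rightarrow> real" and c :: "nat \<Rightarrow> real"
  assumes P: "prob_space M" and n: "1 \<le> n" and D: "\<And>k. k \<in> {1..n} \<Longrightarrow> levy_process M (D k)"
    and ind: "prob_space.indep_vars M (\<lambda>_. path_space) (\<lambda>k. path_of (D k)) {1..n}"
  shows "levy_process M (\<lambda>t \<omega>. \<Sum>k=1..n. c k * D k t \<omega>)"
proof -
  interpret prob_space M by fact
  have "levy_process M (\<lambda>t \<omega>. \<Sum>k=1..Suc m. c k * D k t \<omega>)" if "Suc m \<le> n" for m
    using that
  proof (induction m)
    case 0
    have "levy_process M (\<lambda>t \<omega>. c 1 * D 1 t \<omega>)"
      using n by (intro levy_process_bounded_linear[OF D[of 1] bounded_linear_mult_right]) auto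
    then show ?case by simp
  next
    case (Suc m')
    define m where "m = Suc m'"
    note Suc = Suc[folded m_def]
    define S where "S t \<omega> = (\<Sum>k=1..m. c k * D k t \<omega>)" for t \<omega>
    have S: "levy_process M S" using Suc by (simp add: S_def[abs_def])
    have D': "levy_process M (D (Suc m))" using Suc by (intro D) auto
    have "indep_var (PiM {1..m} (\<lambda>_. path_space)) (\<lambda>\<omega>. \<lambda>k\<in>{1..m}. path_of (D k) \<omega>) (PiM {Suc m} (\<lambda>_. path_space)) (\<lambda>\<omega>. \<lambda>k\<in>{Suc m}. path_of (D k) \<omega>)"
      using Suc.prems by (intro indep_var_restrict[OF ind]) (auto simp: m_def)
    moreover define f where "f p = (\<lambda>t\<in>{0::real..}. \<Sum>k=1..m. c k * p k t)" for p :: "nat \<Rightarrow> real \<Rightarrow> real"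
    have "f \<in> PiM {1..m} (\<lambda>_. path_space) \<rightarrow>\<^sub>M path_space"
      unfolding f_def
    proof (intro measurable_restrict borel_measurable_sum borel_measurable_times borel_measurable_const)
      fix t :: real and k assume "t \<in> {0..}" "k \<in> {1..m}"
      then show "(\<lambda>p. p k t) \<in> borel_measurable (PiM {1..m} (\<lambda>_. path_space :: (real \<Rightarrow> real) measure))"
        using measurable_compose[OF measurable_component_singleton[of k "{1..m}" "\<lambda>_. path_space"] path_component_measurable[of t]] by simp
    qed
    moreover have "(\<lambda>p. p (Suc m)) \<in> PiM {Suc m} (\<lambda>_. path_space) \<rightarrow>\<^sub>M path_space"
      by (intro measurable_component_singleton) auto
    ultimately have iv: "indep_var path_space (f \<circ> (\<lambda>\<omega>. \<lambda>k\<in>{1..m}. path_of (D k) \<omega>))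
        path_space ((\<lambda>p. p (Suc m)) \<circ> (\<lambda>\<omega>. \<lambda>k\<in>{Suc m}. path_of (D k) \<omega>))"
      by (rule indep_var_compose)
    have e1: "f \<circ> (\<lambda>\<omega>. \<lambda>k\<in>{1..m}. path_of (D k) \<omega>) = path_of S"
      by (auto simp: fun_eq_iff f_def path_of_def S_def restrict_def)
    have e2: "(\<lambda>p. p (Suc m)) \<circ> (\<lambda>\<omega>. \<lambda>k\<in>{Suc m}. path_of (D k) \<omega>) = path_of (D (Suc m))"
      by (auto simp: fun_eq_iff)
    have "indep_processes M S (D (Suc m))"
    proof (rule indep_processesI[OF P])
      show "path_of S \<in> M \<rightarrow>\<^sub>M path_space" "path_of (D (Suc m)) \<in> M \<rightarrow>\<^sub>M path_space"
        using levy_processD(2)[OF S] levy_processD(2)[OF D'] by (auto intro!: path_of_measurable)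
      fix A B :: "(real \<Rightarrow> real) set" assume "A \<in> sets path_space" "B \<in> sets path_space"
      from indep_varD[OF iv[unfolded e1 e2] this]
      show "prob {\<omega> \<in> space M. path_of S \<omega> \<in> A \<and> path_of (D (Suc m)) \<omega> \<in> B} =
          prob {\<omega> \<in> space M. path_of S \<omega> \<in> A} * prob {\<omega> \<in> space M. path_of (D (Suc m)) \<omega> \<in> B}"
        by (simp add: vimage_def Int_def conj_commute)
    qed
    then have "levy_process M (\<lambda>t \<omega>. (\<lambda>p. fst p + c (Suc m) * snd p) (S t \<omega>, D (Suc m) t \<omega>))"
      by (intro levy_process_bounded_linear[OF levy_process_Pair[OF S D']] bounded_linear_add bounded_linear_fst
          bounded_linear_compose[OF bounded_linear_mult_right bounded_linear_snd])
    then show ?case by (simp add: S_def m_def)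
  qed
  from this[of "n - 1"] n show ?thesis by simp
qed

subsection \<open>Time changes by first passage times\<close>

text \<open>The inverse for a single fixed path, so that the properties of the time change can be
  proved without probability.\<close>

definition first_passage :: "(real \<Rightarrow> real) \<Rightarrow> real \<Rightarrow> real" where
  "first_passage f t = Inf {x. 0 \<le> x \<and> t < f x}"

lemma inverse_process_eq: "inverse_process D t \<omega> = first_passage (\<lambda>x. D x \<omega>) t"
  by (simp add: inverse_process_def first_passage_def)

text \<open>The path properties that \<open>D\<close> has almost surely; the results of the locale
  are deterministic.\<close>

locale clock =
  fixes f :: "real \<Rightarrow> real"
  assumes zero: "f 0 = 0"
    and right_continuous: "\<And>t. 0 \<le> t \<Longrightarrow> continuous (at_right t) f"
    and strict: "\<And>s t. 0 \<le> s \<Longrightarrow> s < t \<Longrightarrow> f s < f t"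
    and unbounded: "\<And>K. \<exists>x\<ge>0. K < f x"
begin

lemma mono: "0 \<le> s \<Longrightarrow> s \<le> t \<Longrightarrow> f s \<le> f t"
  using strict[of s t] by (cases "s = t") auto

lemma nonneg: "0 \<le> t \<Longrightarrow> 0 \<le> f t"
  using mono[of 0 t] zero by simp

lemma nonempty: "{x. 0 \<le> x \<and> t < f x} \<noteq> {}"
  using unbounded[of t] by auto

lemma first_passage_nonneg: "0 \<le> first_passage f t"
  unfolding first_passage_def using nonempty by (intro cInf_greatest) auto

lemma first_passage_le: "0 \<le> x \<Longrightarrow> t < f x \<Longrightarrow> first_passage f t \<le> x"
  unfolding first_passage_def by (rule cInf_lower) (auto intro!: bdd_belowI[of _ 0])

lemma less_first_passage:
  assumes x: "0 \<le> x" "f x < t"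
  shows "x < first_passage f t"
proof -
  have "(f \<longlongrightarrow> f x) (at_right x)" using right_continuous[OF x(1)] by (simp add: continuous_within)
  then have "eventually (\<lambda>y. f y < t) (at_right x)" using x(2) by (rule order_tendstoD)
  then obtain b where b: "x < b" "\<And>y. x < y \<Longrightarrow> y < b \<Longrightarrow> f y < t" by (auto simp: eventually_at_right_field)
  have "b \<le> first_passage f t" unfolding first_passage_def
  proof (rule cInf_greatest[OF nonempty], safe)
    fix y assume y: "0 \<le> y" "t < f y"
    show "b \<le> y"
    proof (rule ccontr)
      assume "\<not> b \<le> y"
      moreover have "x < y"
      proof (rule ccontr)
        assume "\<not> x < y"
        then have "f y \<le> f x" using y by (intro mono) auto
        then show False using x y by simp
      qed
      ultimately show False using b(2)[of y] y by simp
    qed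
  qed
  then show ?thesis using b by simp
qed

lemma first_passage_at:
  assumes "0 \<le> x"
  shows "first_passage f (f x) = x"
proof (rule antisym)
  show "first_passage f (f x) \<le> x"
  proof (rule field_le_epsilon)
    fix e :: real assume "0 < e"
    then show "first_passage f (f x) \<le> x + e" using assms strict[of x "x + e"] by (intro first_passage_le) auto
  qed
  show "x \<le> first_passage f (f x)" unfolding first_passage_def
  proof (rule cInf_greatest[OF nonempty], safe)
    fix y assume "0 \<le> y" "f x < f y"
    then show "x \<le> y" using mono[of y x] by force
  qed
qed

lemma le_at_first_passage: "t \<le> f (first_passage f t)"
  using less_first_passage[OF first_passage_nonneg, of t t] by force

lemma first_passage_mono: "s \<le> t \<Longrightarrow> first_passage f s \<le> first_passage f t"
  unfolding first_passage_def[of f t] using nonempty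
  by (intro cInf_greatest) (auto intro: first_passage_le)

text \<open>A time t outside the range of the clock lies in the gap left by a jump. The first
  passage time is constant from t up to the end of that gap, and a rational q lies in between. This
  is why countably many horizontal segments suffice for the graph.\<close>

lemma first_passage_cases:
  obtains "t = f (first_passage f t)" | q where "q \<in> \<rat>" "first_passage f q = first_passage f t"
proof (cases "t = f (first_passage f t)")
  case False
  then have "t < f (first_passage f t)" using le_at_first_passage[of t] by simp
  then obtain q where q: "q \<in> \<rat>" "t < q" "q < f (first_passage f t)" using Rats_dense_in_real by blast
  have "first_passage f q = first_passage f t"
    using q first_passage_mono[of t q] first_passage_le[OF first_passage_nonneg, of q t] by simp
  then show thesis using that q by blast
qed

text \<open>From x < first_passage f q follows f x \<le> q, and conversely f x < q gives x <
  first_passage f q. So f x is the infimum of the rationals q with x < first_passage f q, which is a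
  countable and hence measurable expression in the inverse.\<close>

lemma eq_enn2real_INF_first_passage:
  assumes x: "0 \<le> x"
  shows "f x = enn2real (INF q\<in>{q\<in>\<rat>. 0 \<le> q}. if x < first_passage f q then ennreal q else top)"
proof -
  have "(INF q\<in>{q\<in>\<rat>. 0 \<le> q}. if x < first_passage f q then ennreal q else top) = ennreal (f x)"
  proof (rule antisym)
    show "ennreal (f x) \<le> (INF q\<in>{q\<in>\<rat>. 0 \<le> q}. if x < first_passage f q then ennreal q else top)"
    proof (rule INF_greatest)
      fix q :: real
      have "f x \<le> q" if "x < first_passage f q" using first_passage_le[OF x, of q] that by force
      then show "ennreal (f x) \<le> (if x < first_passage f q then ennreal q else top)" by (auto intro: ennreal_leI)
    qed
    show "(INF q\<in>{q\<in>\<rat>. 0 \<le> q}. if x < first_passage f q then ennreal q else top) \<le> ennreal (f x)"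
    proof (rule ennreal_le_epsilon)
      fix e :: real assume e: "0 < e"
      obtain q where q: "q \<in> \<rat>" "f x < q" "q < f x + e" using Rats_dense_in_real[of "f x" "f x + e"] e by auto
      have q0: "0 \<le> q" using q nonneg[OF x] by simp
      have "(INF q\<in>{q\<in>\<rat>. 0 \<le> q}. if x < first_passage f q then ennreal q else top) \<le> (if x < first_passage f q then ennreal q else top)"
        using q q0 by (intro INF_lower) auto
      also have "\<dots> = ennreal q" using less_first_passage[OF x q(2)] by simp
      also have "\<dots> \<le> ennreal (f x) + ennreal e"
        using q nonneg[OF x] e by (simp flip: ennreal_plus)
      finally show "(INF q\<in>{q\<in>\<rat>. 0 \<le> q}. if x < first_passage f q then ennreal q else top) \<le> ennreal (f x) + ennreal e" .
    qed
  qed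
  then show ?thesis using nonneg[OF x] by simp
qed

text \<open>The horizon 1 / (N + 1) depends on the path, but ranges over a countable set; lower
  bounds established almost surely for all N at once can therefore be used at it.\<close>

lemma ex_small_time:
  assumes "0 < K" shows "\<exists>N::nat. f (1 / real (Suc N)) \<le> K"
proof -
  have "(f \<longlongrightarrow> 0) (at_right 0)" using right_continuous[of 0] zero by (simp add: continuous_within)
  then have "eventually (\<lambda>y. f y < K) (at_right 0)" using assms by (rule order_tendstoD)
  then obtain b where b: "0 < b" "\<And>y. 0 < y \<Longrightarrow> y < b \<Longrightarrow> f y < K" by (auto simp: eventually_at_right_field)
  obtain N where "inverse (real (Suc N)) < b" using reals_Archimedean[OF b(1)] by auto
  then show ?thesis using b(2)[of "1 / real (Suc N)"] by (auto simp: inverse_eq_divide intro!: exI[of _ N] less_imp_le)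
qed

lemma range_superset:
  assumes "0 \<le> T" "f T \<le> 1"
  shows "y ` {0..T} \<subseteq> (\<lambda>t. y (first_passage f t)) ` {0..1}"
proof (rule image_subsetI)
  fix x assume x: "x \<in> {0..T}"
  then have "f x \<in> {0..1}" using nonneg[of x] mono[of x T] assms by auto
  then show "y x \<in> (\<lambda>t. y (first_passage f t)) ` {0..1}"
    using first_passage_at[of x] x by (intro image_eqI[where x = "f x"]) auto
qed

lemma graph_superset:
  assumes "0 \<le> T" "f T \<le> 1"
  shows "(\<lambda>x. (f x, y x)) ` {0..T} \<subseteq> (\<lambda>t. (t, y (first_passage f t))) ` {0..1}"
proof (rule image_subsetI)
  fix x assume x: "x \<in> {0..T}"
  then have "f x \<in> {0..1}" using nonneg[of x] mono[of x T] assms by auto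
  then show "(f x, y x) \<in> (\<lambda>t. (t, y (first_passage f t))) ` {0..1}"
    using first_passage_at[of x] x by (intro image_eqI[where x = "f x"]) auto
qed

lemma first_passage_in_nat_interval: "\<exists>n::nat. first_passage f t \<in> {0..real n}"
  using real_arch_simple[of "first_passage f t"] first_passage_nonneg by auto

lemma range_subset: "(\<lambda>t. y (first_passage f t)) ` A \<subseteq> (\<Union>n::nat. y ` {0..real n})"
  using first_passage_in_nat_interval by blast

lemma graph_subset:
  "(\<lambda>t. (t, y (first_passage f t))) ` {0..1} \<subseteq>
    (\<Union>n::nat. (\<lambda>x. (f x, y x)) ` {0..real n}) \<union> (\<Union>q\<in>\<rat>. {0..1} \<times> {y (first_passage f q)})"
proof (rule image_subsetI)
  fix t :: real assume t: "t \<in> {0..1}"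
  show "(t, y (first_passage f t)) \<in>
    (\<Union>n::nat. (\<lambda>x. (f x, y x)) ` {0..real n}) \<union> (\<Union>q\<in>\<rat>. {0..1} \<times> {y (first_passage f q)})"
  proof (cases rule: first_passage_cases[of t])
    case 1
    obtain n :: nat where n: "first_passage f t \<in> {0..real n}" using first_passage_in_nat_interval by blast
    have "(t, y (first_passage f t)) \<in> (\<lambda>x. (f x, y x)) ` {0..real n}"
      using n 1 by (intro image_eqI[where x = "first_passage f t"]) auto
    then show ?thesis by blast
  next
    case (2 q)
    then show ?thesis using t by force
  qed
qed

end

text \<open>A measurable left inverse, on path space, of the passage from a clock to its first
  passage times. The value \<open>top\<close> in \<open>ennreal\<close> removes the rationals that
  do not qualify.\<close>

definition recover_clock :: "(real \<Rightarrow> real) \<Rightarrow> real \<Rightarrow> real" where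
  "recover_clock p = (\<lambda>x\<in>{0..}. enn2real (INF q\<in>{q\<in>\<rat>. 0 \<le> q}. if x < p q then ennreal q else top))"

lemma recover_clock_measurable: "recover_clock \<in> path_space \<rightarrow>\<^sub>M path_space"
  unfolding recover_clock_def
proof (rule measurable_restrict)
  fix x :: real
  have "countable {q\<in>\<rat>. 0 \<le> (q::real)}" by (rule countable_subset[OF _ countable_rat]) auto
  moreover have "(\<lambda>p :: real \<Rightarrow> real. if x < p q then ennreal q else top) \<in> borel_measurable path_space" if "q \<in> {q\<in>\<rat>. 0 \<le> q}" for q
  proof -
    have [measurable]: "(\<lambda>p :: real \<Rightarrow> real. p q) \<in> borel_measurable path_space" using that by (intro path_component_measurable) simp
    show ?thesis by measurable
  qed
  ultimately have "(\<lambda>p :: real \<Rightarrow> real. INF q\<in>{q\<in>\<rat>. 0 \<le> q}. if x < p q then ennreal q else top) \<in> borel_measurable path_space"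
    by (rule borel_measurable_INF)
  then show "(\<lambda>p :: real \<Rightarrow> real. enn2real (INF q\<in>{q\<in>\<rat>. 0 \<le> q}. if x < p q then ennreal q else top)) \<in> borel_measurable path_space"
    by measurable
qed

text \<open>On almost every path D is \<open>recover_clock\<close> applied to its inverse, so
  independence of the inverse from Y passes to D.\<close>

lemma indep_processes_of_inverse:
  fixes D :: "real \<Rightarrow> 'w \<Rightarrow> real" and Y :: "real \<Rightarrow> 'w \<Rightarrow> 'b::euclidean_space"
  assumes P: "prob_space M" and ind: "indep_processes M (inverse_process D) Y"
    and D: "\<And>t. 0 \<le> t \<Longrightarrow> D t \<in> borel_measurable M" and Y: "\<And>t. 0 \<le> t \<Longrightarrow> Y t \<in> borel_measurable M"
    and clock: "AE \<omega> in M. clock (\<lambda>x. D x \<omega>)"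
  shows "indep_processes M D Y"
proof (rule indep_processes_AE_functional[OF P ind recover_clock_measurable _ D Y])
  show "AE \<omega> in M. path_of D \<omega> = recover_clock (path_of (inverse_process D) \<omega>)"
    using clock
  proof eventually_elim
    case (elim \<omega>)
    show ?case unfolding recover_clock_def
    proof (subst path_of_def, rule restrict_ext)
      fix x :: real assume x: "x \<in> {0..}"
      have "D x \<omega> = enn2real (INF q\<in>{q\<in>\<rat>. 0 \<le> q}. if x < first_passage (\<lambda>x. D x \<omega>) q then ennreal q else top)"
        using x by (intro clock.eq_enn2real_INF_first_passage[OF elim]) simp
      also have "(INF q\<in>{q\<in>\<rat>. 0 \<le> q}. if x < first_passage (\<lambda>x. D x \<omega>) q then ennreal q else top) =
        (INF q\<in>{q\<in>\<rat>. 0 \<le> q}. if x < path_of (inverse_process D) \<omega> q then ennreal q else top)"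
        by (intro INF_cong refl) (simp add: path_of_def inverse_process_eq)
      finally show "D x \<omega> = enn2real (INF q\<in>{q\<in>\<rat>. 0 \<le> q}. if x < path_of (inverse_process D) \<omega> q then ennreal q else top)" .
    qed
  qed
  \<comment> \<open>Measurability of the inverse is part of the independence hypothesis, since
    independent families consist of events.\<close>
  show "inverse_process D t \<in> borel_measurable M" if t: "0 \<le> t" for t
  proof (rule measurableI)
    fix A :: "real set" assume A: "A \<in> sets borel"
    interpret prob_space M by (rule P)
    define B where "B = (\<lambda>p. p t) -` A \<inter> space (path_space :: (real \<Rightarrow> real) measure)"
    have "B \<in> sets path_space" unfolding B_def using path_component_measurable[OF t] A by (rule measurable_sets)
    moreover have "{path_of (inverse_process D) -` A \<inter> space M | A. A \<in> sets path_space} \<subseteq> events"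
      using ind unfolding indep_processes_def indep_sets2_eq by blast
    ultimately have "path_of (inverse_process D) -` B \<inter> space M \<in> events" by blast
    moreover have "path_of (inverse_process D) -` B \<inter> space M = inverse_process D t -` A \<inter> space M"
      using t by (auto simp: B_def path_of_def space_PiM)
    ultimately show "inverse_process D t -` A \<inter> space M \<in> events" by simp
  qed simp
qed

subsection \<open>Stable subordinators\<close>

text \<open>Interpolation between the trivial bound 1 and the bound x for a probability p.\<close>

lemma le_powr_of_le_1:
  fixes p x \<gamma> :: real
  assumes "0 \<le> p" "p \<le> 1" "p \<le> x" "0 < \<gamma>" "\<gamma> \<le> 1"
  shows "p \<le> x powr \<gamma>"
proof (cases "p = 0")
  case False
  then have p: "0 < p" using assms by simp
  have "p = p powr 1" using p by simp
  also have "\<dots> \<le> p powr \<gamma>" using p assms by (intro powr_mono') auto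
  also have "\<dots> \<le> x powr \<gamma>" using assms by (intro powr_mono2) auto
  finally show ?thesis .
qed simp

text \<open>The parameter \<gamma> trades decay in r for a milder singularity in t - u: the energy
  argument needs the exponent d * \<gamma> / \<alpha> to stay below 1.\<close>

lemma stable_increment_small_ball:
  fixes Y :: "real \<Rightarrow> 'w \<Rightarrow> 'b::euclidean_space"
  assumes Y: "strictly_stable_levy M \<alpha> Y" and C: "0 \<le> C" "\<And>\<epsilon>. 0 < \<epsilon> \<Longrightarrow> measure M {\<omega> \<in> space M. norm (Y 1 \<omega>) \<le> \<epsilon>} \<le> C * \<epsilon> powr d"
    and ut: "0 \<le> u" "u < t" and r: "0 < r" and \<gamma>: "0 < \<gamma>" "\<gamma> \<le> 1"
  shows "measure M {\<omega> \<in> space M. norm (Y t \<omega> - Y u \<omega>) \<le> r} \<le> C powr \<gamma> * r powr (d * \<gamma>) * (t - u) powr (- (d * \<gamma> / \<alpha>))"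
proof -
  have L: "levy_process M Y" by (rule strictly_stable_levyD(1)[OF Y])
  interpret prob_space M by (rule levy_processD(1)[OF L])
  have h: "0 < t - u" using ut by simp
  have "prob {\<omega> \<in> space M. norm (Y t \<omega> - Y u \<omega>) \<le> r} = prob {\<omega> \<in> space M. norm (Y (t - u) \<omega>) \<le> r}"
    using levy_process_increment_measure[OF L, of u "t - u" "cball 0 r"] ut by simp
  also have "\<dots> = prob {\<omega> \<in> space M. norm (Y 1 \<omega>) \<le> r * (t - u) powr (- (1 / \<alpha>))}"
    by (rule strictly_stable_measure_cball[OF Y h])
  also have "\<dots> \<le> (C * (r * (t - u) powr (- (1 / \<alpha>))) powr d) powr \<gamma>"
    using C(2)[of "r * (t - u) powr (- (1 / \<alpha>))"] r h \<gamma> by (intro le_powr_of_le_1) auto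
  also have "\<dots> = C powr \<gamma> * r powr (d * \<gamma>) * (t - u) powr (- (d * \<gamma> / \<alpha>))"
    by (simp add: powr_mult powr_powr mult_ac)
  finally show ?thesis .
qed

lemma clock_sum:
  assumes n: "1 \<le> (n::nat)" and c: "\<And>k. k \<in> {1..n} \<Longrightarrow> 0 < c k" and f: "\<And>k. k \<in> {1..n} \<Longrightarrow> clock (f k)"
  shows "clock (\<lambda>t. \<Sum>k=1..n. c k * f k t)"
proof
  show "(\<Sum>k=1..n. c k * f k 0) = 0" by (intro sum.neutral) (simp add: clock.zero[OF f])
  show "continuous (at_right t) (\<lambda>t. \<Sum>k=1..n. c k * f k t)" if "0 \<le> t" for t
    by (intro continuous_intros clock.right_continuous[OF f that])
  show "(\<Sum>k=1..n. c k * f k s) < (\<Sum>k=1..n. c k * f k t)" if "0 \<le> s" "s < t" for s t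
    using n c clock.strict[OF f that] by (intro sum_strict_mono) auto
  fix K
  obtain x where x: "0 \<le> x" "K / c 1 < f 1 x" using clock.unbounded[OF f[of 1]] n by auto
  have "K < c 1 * f 1 x" using x c[of 1] n by (simp add: field_simps)
  also have "\<dots> \<le> (\<Sum>k=1..n. c k * f k x)"
    using n less_imp_le[OF c] clock.nonneg[OF f x(1)] by (intro member_le_sum) auto
  finally show "\<exists>x\<ge>0. K < (\<Sum>k=1..n. c k * f k x)" using x(1) by blast
qed

lemma stable_subordinatorD:
  assumes "stable_subordinator M \<beta> S"
  shows "0 < \<beta>" "\<beta> < 1" "strictly_stable_levy M \<beta> S" "AE \<omega> in M. mono_on {0..} (\<lambda>t. S t \<omega>)"
    "\<exists>C\<ge>0. \<forall>\<epsilon>>0. measure M {\<omega> \<in> space M. norm (S 1 \<omega>) \<le> \<epsilon>} \<le> C * \<epsilon> powr 1"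
proof -
  show *: "0 < \<beta>" "\<beta> < 1" "strictly_stable_levy M \<beta> S" "AE \<omega> in M. mono_on {0..} (\<lambda>t. S t \<omega>)"
    using assms by (auto simp: stable_subordinator_def)
  have "\<not> (AE \<omega> in M. \<forall>t\<ge>0. S t \<omega> = 0)" using assms by (auto simp: stable_subordinator_def)
  from stable_real_small_ball[OF *(3,1) this]
  show "\<exists>C\<ge>0. \<forall>\<epsilon>>0. measure M {\<omega> \<in> space M. norm (S 1 \<omega>) \<le> \<epsilon>} \<le> C * \<epsilon> powr 1" by simp
qed

text \<open>Both missing properties come from the linear small ball bound. Letting r tend to 0 shows
  that S differs at any two rational times, and monotonicity makes S strictly increasing. For fixed
  r the bound C * r * m powr (-1/\<beta>) tends to 0, so S cannot stay bounded.\<close>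

lemma stable_subordinator_AE_clock:
  assumes S: "stable_subordinator M \<beta> S"
  shows "AE \<omega> in M. clock (\<lambda>t. S t \<omega>)"
proof -
  note \<beta> = stable_subordinatorD(1,2)[OF S] and st = stable_subordinatorD(3)[OF S]
  have L: "levy_process M S" by (rule strictly_stable_levyD(1)[OF st])
  interpret prob_space M by (rule levy_processD(1)[OF L])
  have rv: "random_variable borel (S t)" if "0 \<le> t" for t using levy_processD(2)[OF L that] .
  obtain C where C: "0 \<le> C" "\<And>\<epsilon>. 0 < \<epsilon> \<Longrightarrow> prob {\<omega> \<in> space M. norm (S 1 \<omega>) \<le> \<epsilon>} \<le> C * \<epsilon> powr 1"
    using stable_subordinatorD(5)[OF S] by blast
  have incr: "prob {\<omega> \<in> space M. norm (S t \<omega> - S u \<omega>) \<le> r} \<le> C * r * (t - u) powr (- (1 / \<beta>))"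
    if "0 \<le> u" "u < t" "0 < r" for u t r
    using stable_increment_small_ball[OF st C that, of 1] C(1) that by simp
  have "AE \<omega> in M. \<forall>p\<in>{p\<in>\<rat>. 0 \<le> p}. \<forall>q\<in>{q\<in>\<rat>. p < q}. S p \<omega> \<noteq> S q \<omega>"
  proof (intro AE_ball_countable')
    fix p q :: real assume pq: "p \<in> {p\<in>\<rat>. 0 \<le> p}" "q \<in> {q\<in>\<rat>. p < q}"
    then have [measurable]: "random_variable borel (S p)" "random_variable borel (S q)" using rv by auto
    have "prob {\<omega> \<in> space M. S q \<omega> - S p \<omega> = 0} \<le> 0 + e" if e: "0 < e" for e
    proof -
      define K where "K = C * (q - p) powr (- (1 / \<beta>)) + 1"
      have K: "0 < K" using C(1) by (simp add: K_def add_nonneg_pos)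
      have "prob {\<omega> \<in> space M. S q \<omega> - S p \<omega> = 0} \<le> prob {\<omega> \<in> space M. norm (S q \<omega> - S p \<omega>) \<le> e / K}"
        using e K by (intro finite_measure_mono) auto
      also have "\<dots> \<le> C * (e / K) * (q - p) powr (- (1 / \<beta>))" using pq e K by (intro incr) auto
      also have "\<dots> = (C * (q - p) powr (- (1 / \<beta>))) * (e / K)" by simp
      also have "\<dots> \<le> K * (e / K)" using e K by (intro mult_right_mono) (auto simp: K_def)
      finally show ?thesis using K by simp
    qed
    then have "prob {\<omega> \<in> space M. S q \<omega> - S p \<omega> = 0} \<le> 0" by (rule field_le_epsilon)
    then have "prob {\<omega> \<in> space M. S q \<omega> - S p \<omega> = 0} = 0" using measure_nonneg by (rule antisym)
    then have "AE \<omega> in M. \<not> (S q \<omega> - S p \<omega> = 0)" by (subst (asm) prob_eq_0) auto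
    then show "AE \<omega> in M. S p \<omega> \<noteq> S q \<omega>" by eventually_elim auto
  qed (auto intro: countable_subset[OF _ countable_rat])
  moreover have "AE \<omega> in M. \<forall>K::nat. \<exists>m::nat. real K < norm (S (real (Suc m)) \<omega> - S 0 \<omega>)"
    unfolding AE_all_countable
  proof
    fix K :: nat
    have [measurable]: "random_variable borel (S (real (Suc m)))" "random_variable borel (S 0)" for m using rv by auto
    \<comment> \<open>Using K + 1 keeps the radius positive when K = 0.\<close>
    let ?A = "{\<omega> \<in> space M. \<forall>m::nat. norm (S (real (Suc m)) \<omega> - S 0 \<omega>) \<le> real K + 1}"
    have "prob ?A \<le> C * (real K + 1) * (real (Suc m)) powr (- (1 / \<beta>))" for m
    proof -
      have "prob ?A \<le> prob {\<omega> \<in> space M. norm (S (real (Suc m)) \<omega> - S 0 \<omega>) \<le> real K + 1}"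
        by (intro finite_measure_mono) (auto simp del: of_nat_Suc)
      also have "\<dots> \<le> C * (real K + 1) * (real (Suc m) - 0) powr (- (1 / \<beta>))" by (intro incr) auto
      finally show ?thesis by simp
    qed
    moreover have "(\<lambda>m. C * (real K + 1) * (real (Suc m)) powr (- (1 / \<beta>))) \<longlonglongrightarrow> C * (real K + 1) * 0"
      using \<beta> by (intro tendsto_intros tendsto_neg_powr filterlim_compose[OF filterlim_real_sequentially filterlim_Suc]) auto
    ultimately have "prob ?A \<le> 0" by (intro LIMSEQ_le_const[where a = "prob ?A"]) auto
    then have "prob ?A = 0" using measure_nonneg by (rule antisym)
    then have "AE \<omega> in M. \<not> (\<forall>m::nat. norm (S (real (Suc m)) \<omega> - S 0 \<omega>) \<le> real K + 1)" by (subst (asm) prob_eq_0) (auto simp del: of_nat_Suc)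
    then show "AE \<omega> in M. \<exists>m::nat. real K < norm (S (real (Suc m)) \<omega> - S 0 \<omega>)"
    proof eventually_elim
      case (elim \<omega>)
      then obtain m where "real K + 1 < norm (S (real (Suc m)) \<omega> - S 0 \<omega>)" unfolding not_all not_le by blast
      then have "real K < norm (S (real (Suc m)) \<omega> - S 0 \<omega>)" by linarith
      then show ?case by blast
    qed
  qed
  ultimately show ?thesis
    using stable_subordinatorD(4)[OF S] levy_processD(3)[OF L] levy_processD(7)[OF L]
  proof eventually_elim
    case (elim \<omega>)
    have mono: "S s \<omega> \<le> S t \<omega>" if "0 \<le> s" "s \<le> t" for s t
      using mono_onD[OF elim(3)] that by simp
    show ?case
    proof
      show "S 0 \<omega> = 0" by (rule elim(4))
      show "continuous (at_right t) (\<lambda>t. S t \<omega>)" if "0 \<le> t" for t using elim(5) that by blast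
      show "S s \<omega> < S t \<omega>" if st: "0 \<le> s" "s < t" for s t
      proof -
        obtain p where p: "p \<in> \<rat>" "s < p" "p < t" using Rats_dense_in_real[OF st(2)] by blast
        obtain q where q: "q \<in> \<rat>" "p < q" "q < t" using Rats_dense_in_real[OF p(3)] by blast
        have "S p \<omega> \<noteq> S q \<omega>" using elim(1) p q st by auto
        moreover have "S s \<omega> \<le> S p \<omega>" "S p \<omega> \<le> S q \<omega>" "S q \<omega> \<le> S t \<omega>" using mono p q st by auto
        ultimately show ?thesis by linarith
      qed
      fix K :: real
      obtain k :: nat where k: "K \<le> real k" using real_arch_simple by blast
      obtain m where m: "real k < norm (S (real (Suc m)) \<omega> - S 0 \<omega>)" using elim(2) by blast
      moreover have "0 \<le> S (real (Suc m)) \<omega>" using mono[of 0 "real (Suc m)"] elim(4) by simp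
      ultimately have "K < S (real (Suc m)) \<omega>" using k elim(4) by simp
      then show "\<exists>x\<ge>0. K < S x \<omega>" by (intro exI[of _ "real (Suc m)"]) simp
    qed
  qed
qed

lemma (in prob_space) prob_finite_Inter_ge:
  assumes "finite I" "\<And>i. i \<in> I \<Longrightarrow> A i \<in> events" "\<And>i. i \<in> I \<Longrightarrow> 1 - \<eta> \<le> prob (A i)"
  shows "1 - real (card I) * \<eta> \<le> prob {\<omega> \<in> space M. \<forall>i\<in>I. \<omega> \<in> A i}"
proof -
  have meas: "{\<omega> \<in> space M. \<forall>i\<in>I. \<omega> \<in> A i} \<in> events"
    using assms(1,2) by (intro sets.sets_Collect_finite_All) auto
  have "space M - {\<omega> \<in> space M. \<forall>i\<in>I. \<omega> \<in> A i} = (\<Union>i\<in>I. space M - A i)" by auto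
  then have "1 - prob {\<omega> \<in> space M. \<forall>i\<in>I. \<omega> \<in> A i} = prob (\<Union>i\<in>I. space M - A i)"
    using prob_compl[OF meas] by simp
  also have "\<dots> \<le> (\<Sum>i\<in>I. prob (space M - A i))"
    using assms by (intro finite_measure_subadditive_finite) auto
  also have "\<dots> \<le> (\<Sum>i\<in>I. \<eta>)"
  proof (rule sum_mono)
    fix i assume i: "i \<in> I"
    show "prob (space M - A i) \<le> \<eta>" using prob_compl[OF assms(2)[OF i]] assms(3)[OF i] by simp
  qed
  finally show ?thesis by simp
qed

text \<open>The ceiling of \<tau> * 2^m counts the grid indices below \<tau> * 2^m, starting with j
  = 0, so at least that many terms are bounded below by a; \<tau> \<le> 1 keeps them inside the
  sum.\<close>

lemma dyadic_sum_ge: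
  fixes g :: "real \<Rightarrow> real"
  assumes \<tau>: "0 \<le> \<tau>" "\<tau> \<le> 1" and a: "0 \<le> a" and g: "\<And>t. 0 \<le> t \<Longrightarrow> t \<le> \<tau> \<Longrightarrow> a \<le> g t" and g0: "\<And>t. 0 \<le> t \<Longrightarrow> 0 \<le> g t"
  shows "a * (\<tau> * 2 ^ m) \<le> (\<Sum>j<2 ^ m. g (real j * (1/2) ^ m))"
proof -
  define J where "J = nat \<lceil>\<tau> * 2 ^ m\<rceil>"
  have "\<tau> * 2 ^ m \<le> 2 ^ m" using \<tau> by simp
  then have "\<lceil>\<tau> * 2 ^ m\<rceil> \<le> 2 ^ m" by (simp add: ceiling_le_iff)
  then have J: "J \<le> 2 ^ m" by (simp add: J_def nat_le_iff)
  have "a * (\<tau> * 2 ^ m) \<le> a * real J" using a real_nat_ceiling_ge[of "\<tau> * 2 ^ m"] by (intro mult_left_mono) (auto simp: J_def)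
  also have "\<dots> = (\<Sum>j<J. a)" by simp
  also have "\<dots> \<le> (\<Sum>j<J. g (real j * (1/2) ^ m))"
  proof (rule sum_mono)
    fix j assume "j \<in> {..<J}"
    then have "real j < \<tau> * 2 ^ m" unfolding J_def by (simp, linarith)
    then show "a \<le> g (real j * (1/2) ^ m)" by (intro g) (auto simp: field_simps power_one_over)
  qed
  also have "\<dots> \<le> (\<Sum>j<2 ^ m. g (real j * (1/2) ^ m))" using J by (intro sum_mono2 g0) auto
  finally show ?thesis .
qed

lemma packing_dim_le_DIM:
  fixes A :: "'a::euclidean_space set"
  shows "packing_dim A \<le> ereal (real DIM('a))"
proof (rule packing_dim_leI[where \<S> = "range (\<lambda>n::nat. cball 0 (real n))"])
  show "A \<subseteq> \<Union> (range (\<lambda>n::nat. cball 0 (real n)))" using real_arch_simple by auto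
  fix S :: "'a set" and s' :: real assume "S \<in> range (\<lambda>n::nat. cball 0 (real n))" "real DIM('a) < s'"
  then obtain n :: nat where "S = cball 0 (real n)" by blast
  then show "packing_premeasure s' S = 0"
    using \<open>real DIM('a) < s'\<close> by (intro packing_premeasure_bounded_eq_0[where R = "real n"]) auto
qed auto

text \<open>The criterion for random images is applied to the identity path over a point mass: there
  a small ball probability is 0 or 1, and it is 1 only if t - u \<le> r.\<close>

lemma hausdorff_dim_unit_interval_ge: "ereal 1 \<le> hausdorff_dim {0..1::real}"
proof -
  interpret prob_space "return borel (0::real)" by (rule prob_space_return) simp
  have "AE \<omega> in return borel (0::real). ereal 1 \<le> hausdorff_dim ((\<lambda>t. t) ` {0..1::real})"
  proof (rule AE_hausdorff_dim_image_ge[where F = "\<lambda>t \<omega>. t"])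
    fix s' :: real assume s': "0 < s'" "s' < 1"
    have "prob {\<omega> \<in> space (return borel 0). dist u t \<le> r} \<le> 1 * r powr s' * (t - u) powr (- s')"
      if "u < t" "0 < r" for u t r :: real
    proof (cases "dist u t \<le> r")
      case True
      have "prob {\<omega> \<in> space (return borel 0). dist u t \<le> r} \<le> 1" by (rule prob_le_1)
      also have "1 \<le> (r / (t - u)) powr s'"
        using True that s' by (intro ge_one_powr_ge_zero) (auto simp: dist_real_def)
      also have "\<dots> = 1 * r powr s' * (t - u) powr (- s')" using that by (simp add: powr_divide powr_minus_divide)
      finally show ?thesis .
    qed simp
    then show "\<exists>K \<eta>. 0 \<le> K \<and> \<eta> < 1 \<and> (\<forall>u t r. 0 \<le> u \<longrightarrow> u < t \<longrightarrow> t \<le> 1 \<longrightarrow> 0 < r \<longrightarrow>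
        prob {\<omega> \<in> space (return borel 0). dist u t \<le> r} \<le> K * r powr s' * (t - u) powr (- \<eta>))"
      using s' by (intro exI[of _ 1] exI[of _ s']) auto
  qed (auto intro!: continuous_intros)
  then show ?thesis by (simp add: AE_return)
qed

subsection \<open>The time-changed stable process\<close>

locale stable_time_change = prob_space M for M :: "'w measure" +
  fixes Y :: "real \<Rightarrow> 'w \<Rightarrow> 'b::euclidean_space" and Ds :: "nat \<Rightarrow> real \<Rightarrow> 'w \<Rightarrow> real" and D :: "real \<Rightarrow> 'w \<Rightarrow> real"
    and \<alpha> :: real and \<beta> c :: "nat \<Rightarrow> real" and n :: nat
  assumes \<alpha>: "0 < \<alpha>"
    and Y: "strictly_stable_levy M \<alpha> Y" and full: "genuinely_full_dim M Y"
    and n: "1 \<le> n" and c: "\<And>k. k \<in> {1..n} \<Longrightarrow> 0 < c k" and \<beta>_mono: "strict_mono_on {1..n} \<beta>"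
    and Ds: "\<And>k. k \<in> {1..n} \<Longrightarrow> stable_subordinator M (\<beta> k) (Ds k)"
    and Ds_indep: "indep_vars (\<lambda>_. path_space) (\<lambda>k. path_of (Ds k)) {1..n}"
    and D_def: "D = (\<lambda>t \<omega>. \<Sum>k=1..n. c k * Ds k t \<omega>)"
    and indep: "indep_processes M (inverse_process D) Y"
begin

lemma Y_levy: "levy_process M Y"
  by (rule strictly_stable_levyD(1)[OF Y])

lemma Y_rv [measurable]: "0 \<le> t \<Longrightarrow> random_variable borel (Y t)"
  by (rule levy_processD(2)[OF Y_levy])

lemma Ds_levy: "k \<in> {1..n} \<Longrightarrow> levy_process M (Ds k)"
  by (rule strictly_stable_levyD(1)[OF stable_subordinatorD(3)[OF Ds]])

lemma D_levy: "levy_process M D"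
  unfolding D_def using n by (intro levy_process_weighted_sum prob_space_axioms Ds_levy Ds_indep)

lemma D_rv [measurable]: "0 \<le> t \<Longrightarrow> random_variable borel (D t)"
  by (rule levy_processD(2)[OF D_levy])

lemma \<beta>_le: "k \<in> {1..n} \<Longrightarrow> \<beta> k \<le> \<beta> n"
  using strict_mono_onD[OF \<beta>_mono, of k n] n by (cases "k = n") auto

lemma \<beta>: "0 < \<beta> n" "\<beta> n < 1"
  using stable_subordinatorD(1,2)[OF Ds[of n]] n by auto

lemma AE_clock: "AE \<omega> in M. clock (\<lambda>t. D t \<omega>)"
proof -
  have "AE \<omega> in M. \<forall>k\<in>{1..n}. clock (\<lambda>t. Ds k t \<omega>)"
    by (intro AE_ball_countable' stable_subordinator_AE_clock[OF Ds]) auto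
  then show ?thesis
  proof eventually_elim
    case (elim \<omega>)
    show ?case unfolding D_def using n c elim by (intro clock_sum) auto
  qed
qed

lemma D_Y_indep: "indep_processes M D Y"
  by (rule indep_processes_of_inverse[OF prob_space_axioms indep D_rv Y_rv AE_clock])

lemma graph_levy: "levy_process M (\<lambda>t \<omega>. (D t \<omega>, Y t \<omega>))"
  by (rule levy_process_Pair[OF D_levy Y_levy D_Y_indep])

text \<open>For r \<le> 1 the power r powr \<beta> n is the smallest of the r powr \<beta> k, so the
  time scale of the largest index is short enough for all summands. An error of 1 / (4 * n) for each
  of them leaves 3/4 by the union bound.\<close>

lemma D_tail:
  "\<exists>a>0. a \<le> 1 \<and> (\<forall>r t. 0 < r \<longrightarrow> r \<le> 1 \<longrightarrow> 0 \<le> t \<longrightarrow> t \<le> a * r powr \<beta> n \<longrightarrow> 3 / 4 \<le> prob {\<omega> \<in> space M. norm (D t \<omega>) \<le> r})"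
proof -
  have n0: "0 < real n" using n by simp
  have "\<forall>k\<in>{1..n}. \<exists>a>0. a \<le> 1 \<and> (\<forall>r>0. \<forall>t\<ge>0. t \<le> a * r powr \<beta> k \<longrightarrow> 1 - 1 / (4 * n) \<le> prob {\<omega> \<in> space M. norm (Ds k t \<omega>) \<le> r})"
  proof
    fix k assume k: "k \<in> {1..n}"
    show "\<exists>a>0. a \<le> 1 \<and> (\<forall>r>0. \<forall>t\<ge>0. t \<le> a * r powr \<beta> k \<longrightarrow> 1 - 1 / (4 * n) \<le> prob {\<omega> \<in> space M. norm (Ds k t \<omega>) \<le> r})"
      using n0 by (intro strictly_stable_tail[OF stable_subordinatorD(3,1)[OF Ds[OF k]]]) simp
  qed
  from bchoice[OF this] obtain a where "\<forall>k\<in>{1..n}. 0 < a k \<and> a k \<le> 1 \<and>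
      (\<forall>r>0. \<forall>t\<ge>0. t \<le> a k * r powr \<beta> k \<longrightarrow> 1 - 1 / (4 * n) \<le> prob {\<omega> \<in> space M. norm (Ds k t \<omega>) \<le> r})" ..
  then have a: "\<And>k. k \<in> {1..n} \<Longrightarrow> 0 < a k"
      "\<And>k r t. k \<in> {1..n} \<Longrightarrow> 0 < r \<Longrightarrow> 0 \<le> t \<Longrightarrow> t \<le> a k * r powr \<beta> k \<Longrightarrow> 1 - 1 / (4 * n) \<le> prob {\<omega> \<in> space M. norm (Ds k t \<omega>) \<le> r}"
    by blast+
  \<comment> \<open>The k-th summand is allowed the share r / n of the radius, that is,
    \<open>Ds k\<close> must stay below r / (n * c k).\<close>
  define b where "b k = a k * (1 / (n * c k)) powr \<beta> k" for k
  have b: "0 < b k" if "k \<in> {1..n}" for k using a(1)[OF that] c[OF that] n0 by (simp add: b_def)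
  define a0 where "a0 = Min (insert 1 (b ` {1..n}))"
  have "0 < a0" "a0 \<le> 1" using b by (auto simp: a0_def)
  moreover have a0: "a0 \<le> b k" if "k \<in> {1..n}" for k using that unfolding a0_def by (intro Min_le) auto
  have "3 / 4 \<le> prob {\<omega> \<in> space M. norm (D t \<omega>) \<le> r}" if r: "0 < r" "r \<le> 1" and t: "0 \<le> t" "t \<le> a0 * r powr \<beta> n" for r t
  proof -
    define A where "A k = {\<omega> \<in> space M. norm (Ds k t \<omega>) \<le> r / (n * c k)}" for k
    have A_meas: "A k \<in> events" if "k \<in> {1..n}" for k
    proof -
      have [measurable]: "random_variable borel (Ds k t)" using levy_processD(2)[OF Ds_levy[OF that] t(1)] .
      show ?thesis unfolding A_def by measurable
    qed
    have A: "1 - 1 / (4 * n) \<le> prob (A k)" if k: "k \<in> {1..n}" for k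
      unfolding A_def
    proof (rule a(2)[OF k _ t(1)])
      show "0 < r / (n * c k)" using r c[OF k] n0 by simp
      have "t \<le> b k * r powr \<beta> n" using t a0[OF k] by (meson mult_right_mono order_trans powr_ge_zero)
      also have "\<dots> \<le> b k * r powr \<beta> k" using b[OF k] r \<beta>_le[OF k] by (intro mult_left_mono powr_mono') auto
      also have "\<dots> = a k * (1 / (n * c k) * r) powr \<beta> k" unfolding b_def powr_mult by (simp add: mult.assoc)
      finally show "t \<le> a k * (r / (n * c k)) powr \<beta> k" by simp
    qed
    have "3 / 4 \<le> prob {\<omega> \<in> space M. \<forall>k\<in>{1..n}. \<omega> \<in> A k}"
      using prob_finite_Inter_ge[of "{1..n}" A "1 / (4 * n)"] A A_meas n0 by simp
    also have "\<dots> \<le> prob {\<omega> \<in> space M. norm (D t \<omega>) \<le> r}"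
    proof (rule finite_measure_mono)
      show "{\<omega> \<in> space M. \<forall>k\<in>{1..n}. \<omega> \<in> A k} \<subseteq> {\<omega> \<in> space M. norm (D t \<omega>) \<le> r}"
      proof safe
        fix \<omega> assume \<omega>: "\<forall>k\<in>{1..n}. \<omega> \<in> A k"
        have "norm (D t \<omega>) \<le> (\<Sum>k=1..n. norm (c k * Ds k t \<omega>))" unfolding D_def by (rule norm_sum)
        also have "\<dots> \<le> (\<Sum>k=1..n. r / n)"
        proof (rule sum_mono)
          fix k assume k: "k \<in> {1..n}"
          have "norm (Ds k t \<omega>) \<le> r / (n * c k)" using \<omega> k by (simp add: A_def)
          then show "norm (c k * Ds k t \<omega>) \<le> r / n"
            using mult_left_mono[of "norm (Ds k t \<omega>)" "r / (n * c k)" "c k"] c[OF k] by (simp add: abs_mult)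
        qed
        finally show "norm (D t \<omega>) \<le> r" using n0 by simp
      qed
      have [measurable]: "random_variable borel (D t)" using t by measurable
      show "{\<omega> \<in> space M. norm (D t \<omega>) \<le> r} \<in> events" by measurable
    qed
    finally show ?thesis .
  qed
  ultimately show ?thesis by blast
qed

lemma prob_norm_D_Y:
  assumes t: "0 \<le> t"
  shows "prob {\<omega> \<in> space M. norm (D t \<omega>) \<le> r / 2} * prob {\<omega> \<in> space M. norm (Y t \<omega>) \<le> r / 2}
    \<le> prob {\<omega> \<in> space M. norm (D t \<omega>, Y t \<omega>) \<le> r}"
proof -
  have [measurable]: "random_variable borel (D t)" "random_variable borel (Y t)" using t by measurable
  note [measurable] = path_component_measurable[OF t]
  have 1: "{p \<in> space (path_space :: (real \<Rightarrow> real) measure). norm (p t) \<le> r / 2} \<in> sets path_space" by measurable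
  have 2: "{p \<in> space (path_space :: (real \<Rightarrow> 'b) measure). norm (p t) \<le> r / 2} \<in> sets path_space" by measurable
  have "prob {\<omega> \<in> space M. norm (D t \<omega>) \<le> r / 2} * prob {\<omega> \<in> space M. norm (Y t \<omega>) \<le> r / 2} =
      prob {\<omega> \<in> space M. norm (D t \<omega>) \<le> r / 2 \<and> norm (Y t \<omega>) \<le> r / 2}"
    using indep_processesD[OF prob_space_axioms D_Y_indep 1 2] t by (simp add: path_of_def space_PiM)
  also have "\<dots> \<le> prob {\<omega> \<in> space M. norm (D t \<omega>, Y t \<omega>) \<le> r}"
  proof (rule finite_measure_mono)
    show "{\<omega> \<in> space M. norm (D t \<omega>) \<le> r / 2 \<and> norm (Y t \<omega>) \<le> r / 2} \<subseteq> {\<omega> \<in> space M. norm (D t \<omega>, Y t \<omega>) \<le> r}"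
    proof safe
      fix \<omega> assume "norm (D t \<omega>) \<le> r / 2" "norm (Y t \<omega>) \<le> r / 2"
      then show "norm (D t \<omega>, Y t \<omega>) \<le> r" using norm_Pair_le[of "D t \<omega>" "Y t \<omega>"] by linarith
    qed
  qed measurable
  finally show ?thesis .
qed

text \<open>Up to time a * r powr \<alpha> the process is within r of 0 with probability at least
  1/2, so the expected sojourn is at least of order r powr \<alpha>.\<close>

lemma Y_packing: "AE \<omega> in M. \<forall>m::nat. \<forall>s'>\<alpha>. packing_premeasure s' ((\<lambda>t. Y t \<omega>) ` {0..real m}) = 0"
  unfolding AE_all_countable[where 'i = nat]
proof
  fix m :: nat
  obtain a where a: "0 < a" "a \<le> 1"
    "\<And>r t. 0 < r \<Longrightarrow> 0 \<le> t \<Longrightarrow> t \<le> a * r powr \<alpha> \<Longrightarrow> 1 - 1 / 2 \<le> prob {\<omega> \<in> space M. norm (Y t \<omega>) \<le> r}"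
    using strictly_stable_tail[OF Y \<alpha>, of "1 / 2"] by auto
  show "AE \<omega> in M. \<forall>s'>\<alpha>. packing_premeasure s' ((\<lambda>t. Y t \<omega>) ` {0..real m}) = 0"
  proof (rule levy_process_AE_packing_premeasure_eq_0[OF Y_levy, of "a / 2"])
    fix r :: real and m :: nat assume r: "0 < r" "r \<le> 1"
    have "a * r powr \<alpha> \<le> 1 * 1" using a r \<alpha> by (intro mult_mono powr_le1) auto
    then have "1 / 2 * ((a * r powr \<alpha>) * 2 ^ m) \<le> (\<Sum>j<2 ^ m. prob {\<omega> \<in> space M. norm (Y (real j * (1/2) ^ m) \<omega>) \<le> r})"
      using a r by (intro dyadic_sum_ge[where g = "\<lambda>t. prob {\<omega> \<in> space M. norm (Y t \<omega>) \<le> r}"]) (auto intro: order_trans[OF _ a(3)])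
    then show "a / 2 * r powr \<alpha> * 2 ^ m \<le> (\<Sum>j<2 ^ m. prob {\<omega> \<in> space M. norm (Y (real j * (1/2) ^ m) \<omega>) \<le> r})"
      by (simp add: mult_ac)
  qed (use a \<alpha> in auto)
qed

text \<open>With s = max 1 \<alpha> and r \<le> 1, a small multiple of r powr s lies below both time
  scales r powr \<beta> n and r powr \<alpha>. Up to that time both components are small together
  with probability at least 9/16, hence at least 1/2.\<close>

lemma graph_packing_low:
  "AE \<omega> in M. \<forall>m::nat. \<forall>s'>max 1 \<alpha>. packing_premeasure s' ((\<lambda>t. (D t \<omega>, Y t \<omega>)) ` {0..real m}) = 0"
  unfolding AE_all_countable[where 'i = nat]
proof
  fix m :: nat
  obtain a where a: "0 < a" "a \<le> 1"
    "\<And>r t. 0 < r \<Longrightarrow> r \<le> 1 \<Longrightarrow> 0 \<le> t \<Longrightarrow> t \<le> a * r powr \<beta> n \<Longrightarrow> 3 / 4 \<le> prob {\<omega> \<in> space M. norm (D t \<omega>) \<le> r}"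
    using D_tail by blast
  obtain b where b: "0 < b" "b \<le> 1"
    "\<And>r t. 0 < r \<Longrightarrow> 0 \<le> t \<Longrightarrow> t \<le> b * r powr \<alpha> \<Longrightarrow> 1 - 1 / 4 \<le> prob {\<omega> \<in> space M. norm (Y t \<omega>) \<le> r}"
    using strictly_stable_tail[OF Y \<alpha>, of "1 / 4"] by auto
  define s where "s = max 1 \<alpha>"
  \<comment> \<open>The power of 1/2 accounts for giving each component only half of the
    radius.\<close>
  define d where "d = min a b * (1 / 2) powr s"
  have d: "0 < d" "d \<le> 1" using a b \<alpha> powr_le1[of s "1/2"] mult_mono[of "min a b" 1 "(1/2) powr s" 1]
    by (auto simp: d_def s_def)
  have half: "1 / 2 \<le> prob {\<omega> \<in> space M. norm (D t \<omega>, Y t \<omega>) \<le> r}"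
    if r: "0 < r" "r \<le> 1" and t: "0 \<le> t" "t \<le> d * r powr s" for r t
  proof -
    have t': "t \<le> min a b * (r / 2) powr s" using t(2) by (simp add: d_def mult.assoc flip: powr_mult)
    have "min a b * (r / 2) powr s \<le> a * (r / 2) powr \<beta> n"
      using r a b \<beta> by (intro mult_mono powr_mono') (auto simp: s_def)
    then have "3 / 4 \<le> prob {\<omega> \<in> space M. norm (D t \<omega>) \<le> r / 2}" using r t t' by (intro a(3)) auto
    moreover have "min a b * (r / 2) powr s \<le> b * (r / 2) powr \<alpha>"
      using r a b by (intro mult_mono powr_mono') (auto simp: s_def)
    then have "1 - 1 / 4 \<le> prob {\<omega> \<in> space M. norm (Y t \<omega>) \<le> r / 2}" using r t t' by (intro b(3)) auto
    ultimately have "3 / 4 * (3 / 4) \<le> prob {\<omega> \<in> space M. norm (D t \<omega>) \<le> r / 2} * prob {\<omega> \<in> space M. norm (Y t \<omega>) \<le> r / 2}"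
      by (intro mult_mono) auto
    with prob_norm_D_Y[OF t(1), of r] show ?thesis by linarith
  qed
  show "AE \<omega> in M. \<forall>s'>max 1 \<alpha>. packing_premeasure s' ((\<lambda>t. (D t \<omega>, Y t \<omega>)) ` {0..real m}) = 0"
    unfolding s_def[symmetric]
  proof (rule levy_process_AE_packing_premeasure_eq_0[OF graph_levy, of "d / 2"])
    fix r :: real and m :: nat assume r: "0 < r" "r \<le> 1"
    have "d * r powr s \<le> 1 * 1" using d r by (intro mult_mono powr_le1) (auto simp: s_def)
    then have "1 / 2 * ((d * r powr s) * 2 ^ m) \<le> (\<Sum>j<2 ^ m. prob {\<omega> \<in> space M. norm (D (real j * (1/2) ^ m) \<omega>, Y (real j * (1/2) ^ m) \<omega>) \<le> r})"
      using d r by (intro dyadic_sum_ge[where g = "\<lambda>t. prob {\<omega> \<in> space M. norm (D t \<omega>, Y t \<omega>) \<le> r}"] half) auto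
    then show "d / 2 * r powr s * 2 ^ m \<le> (\<Sum>j<2 ^ m. prob {\<omega> \<in> space M. norm (D (real j * (1/2) ^ m) \<omega>, Y (real j * (1/2) ^ m) \<omega>) \<le> r})"
      by (simp add: mult_ac)
  qed (use d in \<open>auto simp: s_def\<close>)
qed

text \<open>Here the potential of \<open>Y\<close> near the origin is bounded below by pigeonhole: up to time \<open>\<tau>\<close> the
  process spends half of its expected time in an interval of length of order \<open>\<tau> powr (1 / \<alpha>)\<close>, and the
  strong Markov property makes the cell at the origin the most visited one.\<close>

lemma graph_packing_high:
  assumes \<alpha>1: "1 < \<alpha>" and dim: "DIM('b) = 1"
  shows "AE \<omega> in M. \<forall>m::nat. \<forall>s'>1 + \<beta> n * (1 - 1 / \<alpha>). packing_premeasure s' ((\<lambda>t. (D t \<omega>, Y t \<omega>)) ` {0..real m}) = 0"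
  unfolding AE_all_countable[where 'i = nat]
proof
  fix m :: nat
  obtain a where a: "0 < a" "a \<le> 1"
    "\<And>r t. 0 < r \<Longrightarrow> r \<le> 1 \<Longrightarrow> 0 \<le> t \<Longrightarrow> t \<le> a * r powr \<beta> n \<Longrightarrow> 3 / 4 \<le> prob {\<omega> \<in> space M. norm (D t \<omega>) \<le> r}"
    using D_tail by blast
  obtain b where b: "0 < b" "b \<le> 1"
    "\<And>r t. 0 < r \<Longrightarrow> 0 \<le> t \<Longrightarrow> t \<le> b * r powr \<alpha> \<Longrightarrow> 1 - 1 / 2 \<le> prob {\<omega> \<in> space M. norm (Y t \<omega>) \<le> r}"
    using strictly_stable_tail[OF Y \<alpha>, of "1 / 2"] by auto
  define s where "s = 1 + \<beta> n * (1 - 1 / \<alpha>)"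
  have s: "0 \<le> s" using \<alpha>1 \<beta> by (simp add: s_def)
  define \<kappa> where "\<kappa> = (a / b) powr (1 / \<alpha>)"
  have \<kappa>: "0 < \<kappa>" using a b by (simp add: \<kappa>_def)
  \<comment> \<open>3/8 is the probability 3/4 for D times the 1/2 for Y, and the power of 1/2 turns
    q = r / 2 back into r.\<close>
  define C where "C = 3 / 8 * a / (2 * \<kappa> + 5) * (1 / 2) powr s"
  have C: "0 < C" using a \<kappa> by (simp add: C_def)
  have low: "C * r powr s * 2 ^ m \<le> (\<Sum>j<2 ^ m. prob {\<omega> \<in> space M. norm (D (real j * (1/2) ^ m) \<omega>, Y (real j * (1/2) ^ m) \<omega>) \<le> r})"
    if r: "0 < r" "r \<le> 1" for r m
  proof -
    define q where "q = r / 2"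
    have q: "0 < q" "q \<le> 1" using r by (auto simp: q_def)
    \<comment> \<open>Up to this time D is within q of 0 with probability at least 3/4.\<close>
    define \<tau> where "\<tau> = a * q powr \<beta> n"
    have \<tau>: "0 < \<tau>" "\<tau> \<le> 1"
      using a q \<beta> mult_mono[of a 1 "q powr \<beta> n" 1] by (auto simp: \<tau>_def powr_le1)
    \<comment> \<open>The spread of Y up to time \<tau>: at each such time it is within R of 0 with
      probability at least 1/2.\<close>
    define R where "R = (\<tau> / b) powr (1 / \<alpha>)"
    have R: "0 < R" "b * R powr \<alpha> = \<tau>" using \<tau> b \<alpha> by (auto simp: R_def powr_powr)
    define J where "J = nat \<lceil>\<tau> * 2 ^ m\<rceil>"
    have J1: "\<tau> * 2 ^ m \<le> real J" unfolding J_def by (rule real_nat_ceiling_ge)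
    have "\<tau> * 2 ^ m \<le> 2 ^ m" using \<tau> by simp
    then have "\<lceil>\<tau> * 2 ^ m\<rceil> \<le> 2 ^ m" by (simp add: ceiling_le_iff)
    then have J2: "J \<le> 2 ^ m" by (simp add: J_def nat_le_iff)
    have J3: "real j * (1/2) ^ m \<le> \<tau>" if "j < J" for j
    proof -
      have "real j < \<tau> * 2 ^ m" using that unfolding J_def by linarith
      then show ?thesis by (simp add: field_simps power_one_over)
    qed
    define P where "P j x = prob {\<omega> \<in> space M. norm (Y (real j * (1/2) ^ m) \<omega>) \<le> x}" for j x
    interpret W: random_walk M "\<lambda>i \<omega>. Y (real i * (1/2) ^ m) \<omega> - Y 0 \<omega>"
      by (rule levy_process_random_walk[OF Y_levy]) simp
    have W: "prob {\<omega> \<in> space M. norm (Y (real j * (1/2) ^ m) \<omega> - Y 0 \<omega>) \<le> x} = P j x" for j x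
      unfolding P_def by (rule levy_process_sojourn_eq[OF Y_levy]) simp
    have "real J / 2 = (\<Sum>j<J. 1 / 2)" by simp
    also have "\<dots> \<le> (\<Sum>j<J. P j R)"
    proof (rule sum_mono)
      fix j assume "j \<in> {..<J}"
      then show "1 / 2 \<le> P j R" using b(3)[of R "real j * (1/2) ^ m"] R J3[of j] by (simp add: P_def)
    qed
    also have "\<dots> \<le> (2 * (R + q) / q + 3) * (\<Sum>j<J. P j q)"
      using W.sum_prob_ball_le_sojourn[of q R J] q R unfolding W dim by simp
    also have "2 * (R + q) / q + 3 = 2 * (R / q) + 5" using q by (simp add: field_simps)
    also have "\<dots> \<le> (2 * \<kappa> + 5) * q powr (\<beta> n / \<alpha> - 1)"
    proof -
      have "R = \<kappa> * q powr (\<beta> n / \<alpha>)"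
        unfolding R_def \<kappa>_def \<tau>_def by (simp add: powr_mult powr_divide powr_powr)
      then have "R / q = \<kappa> * q powr (\<beta> n / \<alpha> - 1)" using q by (simp add: powr_diff)
      \<comment> \<open>This absorbs the additive 5 of the cell count: Y spreads over a length at
        least comparable to q, because \<beta> n < \<alpha>.\<close>
      moreover have "1 \<le> q powr (\<beta> n / \<alpha> - 1)"
      proof -
        have "\<beta> n / \<alpha> < 1" using \<beta> \<alpha>1 by (simp add: divide_less_eq)
        then show ?thesis using powr_mono'[of "\<beta> n / \<alpha> - 1" 0 q] q by simp
      qed
      ultimately show ?thesis by (simp add: distrib_right)
    qed
    finally have G: "real J / 2 \<le> (2 * \<kappa> + 5) * q powr (\<beta> n / \<alpha> - 1) * (\<Sum>j<J. P j q)"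
      by (simp add: mult_right_mono sum_nonneg P_def)
    have "C * r powr s * 2 ^ m = 3 / 8 * a / (2 * \<kappa> + 5) * q powr s * 2 ^ m"
      by (simp add: C_def q_def powr_divide)
    also have "q powr s = q powr (1 - \<beta> n / \<alpha>) * q powr \<beta> n"
      unfolding powr_add[symmetric] by (simp add: s_def algebra_simps)
    also have "3 / 8 * a / (2 * \<kappa> + 5) * (q powr (1 - \<beta> n / \<alpha>) * q powr \<beta> n) * 2 ^ m =
        3 / 4 * q powr (1 - \<beta> n / \<alpha>) / (2 * \<kappa> + 5) * (\<tau> * 2 ^ m / 2)" by (simp add: \<tau>_def)
    also have "\<dots> \<le> 3 / 4 * q powr (1 - \<beta> n / \<alpha>) / (2 * \<kappa> + 5) * (real J / 2)"
      using J1 \<kappa> by (intro mult_left_mono) auto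
    also have "\<dots> \<le> 3 / 4 * q powr (1 - \<beta> n / \<alpha>) / (2 * \<kappa> + 5) * ((2 * \<kappa> + 5) * q powr (\<beta> n / \<alpha> - 1) * (\<Sum>j<J. P j q))"
      using G \<kappa> by (intro mult_left_mono) auto
    also have "\<dots> = 3 / 4 * (q powr (1 - \<beta> n / \<alpha>) * q powr (\<beta> n / \<alpha> - 1)) * (\<Sum>j<J. P j q)"
    proof -
      have "3 / 4 * x / K * (K * y * z) = 3 / 4 * (x * y) * z" if "K \<noteq> 0" for K x y z :: real using that by simp
      then show ?thesis using \<kappa> by (metis add_pos_pos less_irrefl mult_pos_pos zero_less_numeral)
    qed
    also have "q powr (1 - \<beta> n / \<alpha>) * q powr (\<beta> n / \<alpha> - 1) = 1" using q by (simp flip: powr_add)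
    also have "3 / 4 * 1 * (\<Sum>j<J. P j q) = (\<Sum>j<J. 3 / 4 * P j q)" by (simp add: sum_distrib_left)
    also have "\<dots> \<le> (\<Sum>j<J. prob {\<omega> \<in> space M. norm (D (real j * (1/2) ^ m) \<omega>, Y (real j * (1/2) ^ m) \<omega>) \<le> r})"
    proof (rule sum_mono)
      fix j assume j: "j \<in> {..<J}"
      have "3 / 4 \<le> prob {\<omega> \<in> space M. norm (D (real j * (1/2) ^ m) \<omega>) \<le> q}"
        using J3[of j] j q by (intro a(3)) (auto simp: \<tau>_def)
      then have "3 / 4 * P j q \<le> prob {\<omega> \<in> space M. norm (D (real j * (1/2) ^ m) \<omega>) \<le> q} * P j q"
        by (intro mult_right_mono) (auto simp: P_def)
      also have "\<dots> \<le> prob {\<omega> \<in> space M. norm (D (real j * (1/2) ^ m) \<omega>, Y (real j * (1/2) ^ m) \<omega>) \<le> r}"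
        unfolding P_def q_def by (rule prob_norm_D_Y) simp
      finally show "3 / 4 * P j q \<le> prob {\<omega> \<in> space M. norm (D (real j * (1/2) ^ m) \<omega>, Y (real j * (1/2) ^ m) \<omega>) \<le> r}" .
    qed
    also have "\<dots> \<le> (\<Sum>j<2 ^ m. prob {\<omega> \<in> space M. norm (D (real j * (1/2) ^ m) \<omega>, Y (real j * (1/2) ^ m) \<omega>) \<le> r})"
      using J2 by (intro sum_mono2) auto
    finally show ?thesis .
  qed
  show "AE \<omega> in M. \<forall>s'>1 + \<beta> n * (1 - 1 / \<alpha>). packing_premeasure s' ((\<lambda>t. (D t \<omega>, Y t \<omega>)) ` {0..real m}) = 0"
    unfolding s_def[symmetric]
    by (rule levy_process_AE_packing_premeasure_eq_0[OF graph_levy C s _ low]) simp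
qed

end

section \<open>Lower bounds for the images of Y and (D, Y)\<close>

context stable_time_change
begin

lemma Y_small_ball:
  assumes "1 < \<alpha>"
  shows "\<exists>C\<ge>0. \<forall>\<epsilon>>0. prob {\<omega> \<in> space M. norm (Y 1 \<omega>) \<le> \<epsilon>} \<le> C * \<epsilon> powr DIM('b)"
proof -
  have "\<exists>C\<ge>0. \<forall>\<epsilon>>0. prob {\<omega> \<in> space M. norm (Y 1 \<omega>) \<le> \<epsilon>} \<le> C * \<epsilon> ^ DIM('b)"
    using strictly_stable_small_ball[OF Y \<alpha> stable_char_less_1[OF Y assms full]] .
  then show ?thesis by (simp add: powr_realpow)
qed

text \<open>For \<open>\<alpha> \<le> 1\<close> a direction may carry a pure drift, so one works with a single coordinate of \<open>Y\<close>.\<close>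

lemma Y_hausdorff:
  assumes T: "0 < T"
  shows "AE \<omega> in M. ereal (min (real DIM('b)) \<alpha>) \<le> hausdorff_dim ((\<lambda>t. Y t \<omega>) ` {0..T})"
proof (cases "1 < \<alpha>")
  case True
  obtain C where C: "0 \<le> C" "\<And>\<epsilon>. 0 < \<epsilon> \<Longrightarrow> prob {\<omega> \<in> space M. norm (Y 1 \<omega>) \<le> \<epsilon>} \<le> C * \<epsilon> powr DIM('b)"
    using Y_small_ball[OF True] by blast
  show ?thesis
  proof (rule AE_hausdorff_dim_image_ge[OF Y_rv levy_processD(7)[OF Y_levy] T])
    fix s' assume s': "0 < s'" "s' < min (real DIM('b)) \<alpha>"
    \<comment> \<open>Lowers the space exponent from d to s', so that the time exponent s' /
      \<alpha> falls below 1.\<close>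
    define \<gamma> where "\<gamma> = s' / DIM('b)"
    have \<gamma>: "0 < \<gamma>" "\<gamma> \<le> 1" "DIM('b) * \<gamma> = s'" using s' by (auto simp: \<gamma>_def divide_le_eq)
    have "prob {\<omega> \<in> space M. dist (Y u \<omega>) (Y t \<omega>) \<le> r} \<le> C powr \<gamma> * r powr s' * (t - u) powr (- (s' / \<alpha>))"
      if "0 \<le> u" "u < t" "0 < r" for u t r
      using stable_increment_small_ball[OF Y C that \<gamma>(1,2)] unfolding \<gamma>(3) by (simp add: dist_norm norm_minus_commute)
    then show "\<exists>K \<eta>. 0 \<le> K \<and> \<eta> < 1 \<and> (\<forall>u t r. 0 \<le> u \<longrightarrow> u < t \<longrightarrow> t \<le> T \<longrightarrow> 0 < r \<longrightarrow>
        prob {\<omega> \<in> space M. dist (Y u \<omega>) (Y t \<omega>) \<le> r} \<le> K * r powr s' * (t - u) powr (- \<eta>))"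
      using s' \<alpha> by (intro exI[of _ "C powr \<gamma>"] exI[of _ "s' / \<alpha>"]) auto
  qed
next
  case False
  obtain b :: 'b where b: "b \<in> Basis" using nonempty_Basis by blast
  define W where "W t \<omega> = b \<bullet> Y t \<omega>" for t \<omega>
  have W: "strictly_stable_levy M \<alpha> W"
    unfolding W_def by (rule strictly_stable_levy_bounded_linear[OF Y bounded_linear_inner_right])
  have LW: "levy_process M W" by (rule strictly_stable_levyD(1)[OF W])
  have "\<not> (AE \<omega> in M. \<forall>t\<ge>0. W t \<omega> = 0)"
  proof
    assume "AE \<omega> in M. \<forall>t\<ge>0. W t \<omega> = 0"
    then have "AE \<omega> in M. \<forall>t\<ge>0. Y t \<omega> \<in> {x. b \<bullet> x = 0}" by (simp add: W_def)
    moreover have "subspace {x. b \<bullet> x = 0}" by (rule subspace_hyperplane)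
    moreover have "{x. b \<bullet> x = 0} \<noteq> UNIV"
    proof
      assume "{x. b \<bullet> x = 0} = UNIV"
      then have "b \<in> {x. b \<bullet> x = 0}" by blast
      then show False using b by simp
    qed
    ultimately show False using full unfolding genuinely_full_dim_def by blast
  qed
  from stable_real_small_ball[OF W \<alpha> this]
  obtain C where C: "0 \<le> C" "\<And>\<epsilon>. 0 < \<epsilon> \<Longrightarrow> prob {\<omega> \<in> space M. norm (W 1 \<omega>) \<le> \<epsilon>} \<le> C * \<epsilon> powr 1" by auto
  have "AE \<omega> in M. ereal \<alpha> \<le> hausdorff_dim ((\<lambda>t. W t \<omega>) ` {0..T})"
  proof (rule AE_hausdorff_dim_image_ge[OF levy_processD(2)[OF LW] levy_processD(7)[OF LW] T])
    fix s' assume s': "0 < s'" "s' < \<alpha>"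
    have "prob {\<omega> \<in> space M. dist (W u \<omega>) (W t \<omega>) \<le> r} \<le> C powr s' * r powr s' * (t - u) powr (- (s' / \<alpha>))"
      if "0 \<le> u" "u < t" "0 < r" for u t r
      using stable_increment_small_ball[OF W C that s'(1)] s' False by (simp add: dist_norm abs_minus_commute)
    then show "\<exists>K \<eta>. 0 \<le> K \<and> \<eta> < 1 \<and> (\<forall>u t r. 0 \<le> u \<longrightarrow> u < t \<longrightarrow> t \<le> T \<longrightarrow> 0 < r \<longrightarrow>
        prob {\<omega> \<in> space M. dist (W u \<omega>) (W t \<omega>) \<le> r} \<le> K * r powr s' * (t - u) powr (- \<eta>))"
      using s' \<alpha> by (intro exI[of _ "C powr s'"] exI[of _ "s' / \<alpha>"]) auto
  qed
  then show ?thesis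
  proof eventually_elim
    case (elim \<omega>)
    have "hausdorff_dim ((\<lambda>t. W t \<omega>) ` {0..T}) \<le> hausdorff_dim ((\<lambda>t. Y t \<omega>) ` {0..T})"
    proof (rule hausdorff_dim_nonexpanding_le[where f = "\<lambda>x. b \<bullet> x"])
      show "dist (b \<bullet> x) (b \<bullet> y) \<le> dist x y" for x y
        using Basis_le_norm[OF b, of "x - y"] unfolding dist_norm inner_commute[of _ b] inner_diff_right by simp
    qed (auto simp: W_def)
    moreover have "min (real DIM('b)) \<alpha> = \<alpha>" using False DIM_positive[where 'a='b] by (simp add: min_def del: DIM_positive)
    ultimately show ?case using elim by (metis order_trans)
  qed
qed

text \<open>All summands of D are nondecreasing, so an increment of D is at least that of c n * Ds
  n, and its small ball bound is governed by \<beta> n. By independence the bounds for D and Y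
  multiply. For s' > 1 the exponent 1 is taken from Y and \<gamma> = s' - 1 from D; the time
  exponent \<gamma> / \<beta> n + 1 / \<alpha> is below 1 exactly when s' < 1 + \<beta> n * (1 - 1 /
  \<alpha>). For s' \<le> 1 the bound for Y alone is integrable.\<close>

lemma graph_hausdorff_high:
  assumes \<alpha>1: "1 < \<alpha>" and dim: "DIM('b) = 1" and T: "0 < T"
  shows "AE \<omega> in M. ereal (1 + \<beta> n * (1 - 1 / \<alpha>)) \<le> hausdorff_dim ((\<lambda>t. (D t \<omega>, Y t \<omega>)) ` {0..T})"
proof -
  obtain C where C: "0 \<le> C" "\<And>\<epsilon>. 0 < \<epsilon> \<Longrightarrow> prob {\<omega> \<in> space M. norm (Y 1 \<omega>) \<le> \<epsilon>} \<le> C * \<epsilon> powr 1"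
    using Y_small_ball[OF \<alpha>1] unfolding dim by auto
  have n': "n \<in> {1..n}" using n by simp
  obtain C' where C': "0 \<le> C'" "\<And>\<epsilon>. 0 < \<epsilon> \<Longrightarrow> prob {\<omega> \<in> space M. norm (Ds n 1 \<omega>) \<le> \<epsilon>} \<le> C' * \<epsilon> powr 1"
    using stable_subordinatorD(5)[OF Ds[OF n']] by blast
  note Dn = stable_subordinatorD(3)[OF Ds[OF n']]
  have clocks: "AE \<omega> in M. \<forall>k\<in>{1..n}. clock (\<lambda>t. Ds k t \<omega>)"
    by (intro AE_ball_countable' stable_subordinator_AE_clock[OF Ds]) auto
  define P where "P u t r = prob {\<omega> \<in> space M. norm (D t \<omega> - D u \<omega>) \<le> r}" for u t r
  define Q where "Q u t r = prob {\<omega> \<in> space M. norm (Y t \<omega> - Y u \<omega>) \<le> r}" for u t r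
  have PQ: "prob {\<omega> \<in> space M. dist (D u \<omega>, Y u \<omega>) (D t \<omega>, Y t \<omega>) \<le> r} \<le> P u t r * Q u t r"
    if "0 \<le> u" "u < t" for u t r
  proof -
    have [measurable]: "random_variable borel (D u)" "random_variable borel (D t)" "random_variable borel (Y u)" "random_variable borel (Y t)"
      using that D_rv Y_rv by auto
    have [measurable]: "cball 0 r \<in> sets (borel :: real measure)" "cball 0 r \<in> sets (borel :: 'b measure)" by auto
    have "prob {\<omega> \<in> space M. dist (D u \<omega>, Y u \<omega>) (D t \<omega>, Y t \<omega>) \<le> r}
      \<le> prob {\<omega> \<in> space M. D t \<omega> - D u \<omega> \<in> cball 0 r \<and> Y t \<omega> - Y u \<omega> \<in> cball 0 r}"
    proof (rule finite_measure_mono)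
      show "{\<omega> \<in> space M. dist (D u \<omega>, Y u \<omega>) (D t \<omega>, Y t \<omega>) \<le> r} \<subseteq>
          {\<omega> \<in> space M. D t \<omega> - D u \<omega> \<in> cball 0 r \<and> Y t \<omega> - Y u \<omega> \<in> cball 0 r}"
      proof safe
        fix \<omega> assume *: "dist (D u \<omega>, Y u \<omega>) (D t \<omega>, Y t \<omega>) \<le> r"
        show "D t \<omega> - D u \<omega> \<in> cball 0 r"
          using order_trans[OF dist_fst_le *] by (simp add: dist_norm norm_minus_commute)
        show "Y t \<omega> - Y u \<omega> \<in> cball 0 r"
          using order_trans[OF dist_snd_le *] by (simp add: dist_norm norm_minus_commute)
      qed
    qed measurable
    also have "\<dots> = prob {\<omega> \<in> space M. D t \<omega> - D u \<omega> \<in> cball 0 r} * prob {\<omega> \<in> space M. Y t \<omega> - Y u \<omega> \<in> cball 0 r}"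
      using that by (intro indep_processes_increments prob_space_axioms D_Y_indep) auto
    finally show ?thesis by (simp add: P_def Q_def)
  qed
  have P_le: "P u t r \<le> C' powr \<gamma> * (r / c n) powr \<gamma> * (t - u) powr (- (\<gamma> / \<beta> n))"
    if ut: "0 \<le> u" "u < t" "0 < r" and \<gamma>: "0 < \<gamma>" "\<gamma> \<le> 1" for u t r \<gamma>
  proof -
    have [measurable]: "random_variable borel (D u)" "random_variable borel (D t)" "random_variable borel (Ds n u)" "random_variable borel (Ds n t)"
      using ut levy_processD(2)[OF Ds_levy[OF n']] by (auto intro: D_rv)
    have "P u t r \<le> prob {\<omega> \<in> space M. norm (Ds n t \<omega> - Ds n u \<omega>) \<le> r / c n}"
      unfolding P_def
    proof (rule finite_measure_mono_AE)
      show "AE \<omega> in M. \<omega> \<in> {\<omega> \<in> space M. norm (D t \<omega> - D u \<omega>) \<le> r} \<longrightarrow> \<omega> \<in> {\<omega> \<in> space M. norm (Ds n t \<omega> - Ds n u \<omega>) \<le> r / c n}"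
        using clocks
      proof eventually_elim
        case (elim \<omega>)
        have incr: "0 \<le> Ds k t \<omega> - Ds k u \<omega>" if "k \<in> {1..n}" for k
          using clock.mono[of "\<lambda>t. Ds k t \<omega>" u t] elim that ut by auto
        have "c n * (Ds n t \<omega> - Ds n u \<omega>) \<le> (\<Sum>k=1..n. c k * (Ds k t \<omega> - Ds k u \<omega>))"
          using n' less_imp_le[OF c] incr by (intro member_le_sum) auto
        also have "\<dots> = D t \<omega> - D u \<omega>" by (simp add: D_def right_diff_distrib sum_subtractf)
        finally show ?case using incr[OF n'] c[OF n'] by (auto simp: pos_le_divide_eq mult.commute)
      qed
    qed measurable
    also have "\<dots> \<le> C' powr \<gamma> * (r / c n) powr (1 * \<gamma>) * (t - u) powr (- (1 * \<gamma> / \<beta> n))"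
      using ut c[OF n'] by (intro stable_increment_small_ball[OF Dn C'] \<gamma>) auto
    finally show ?thesis by simp
  qed
  have Q_le: "Q u t r \<le> C powr \<gamma> * r powr \<gamma> * (t - u) powr (- (\<gamma> / \<alpha>))"
    if ut: "0 \<le> u" "u < t" "0 < r" and \<gamma>: "0 < \<gamma>" "\<gamma> \<le> 1" for u t r \<gamma>
    using stable_increment_small_ball[OF Y C ut \<gamma>] by (simp add: Q_def)
  show ?thesis
  proof (rule AE_hausdorff_dim_image_ge[OF levy_processD(2)[OF graph_levy] levy_processD(7)[OF graph_levy] T])
    fix s' assume s': "0 < s'" "s' < 1 + \<beta> n * (1 - 1 / \<alpha>)"
    show "\<exists>K \<eta>. 0 \<le> K \<and> \<eta> < 1 \<and> (\<forall>u t r. 0 \<le> u \<longrightarrow> u < t \<longrightarrow> t \<le> T \<longrightarrow> 0 < r \<longrightarrow>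
        prob {\<omega> \<in> space M. dist (D u \<omega>, Y u \<omega>) (D t \<omega>, Y t \<omega>) \<le> r} \<le> K * r powr s' * (t - u) powr (- \<eta>))"
    proof (cases "s' \<le> 1")
      case True
      have "prob {\<omega> \<in> space M. dist (D u \<omega>, Y u \<omega>) (D t \<omega>, Y t \<omega>) \<le> r} \<le> C powr s' * r powr s' * (t - u) powr (- (s' / \<alpha>))"
        if ut: "0 \<le> u" "u < t" "0 < r" for u t r
      proof -
        have "P u t r * Q u t r \<le> 1 * Q u t r" by (intro mult_right_mono) (auto simp: P_def Q_def)
        then show ?thesis using PQ[OF ut(1,2), of r] Q_le[OF ut s'(1) True] by linarith
      qed
      then show ?thesis
        using s' \<alpha>1 True by (intro exI[of _ "C powr s'"] exI[of _ "s' / \<alpha>"]) auto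
    next
      case False
      define \<gamma> where "\<gamma> = s' - 1"
      have "\<beta> n * (1 - 1 / \<alpha>) \<le> 1 * 1" using \<beta> \<alpha>1 by (intro mult_mono) auto
      then have \<gamma>: "0 < \<gamma>" "\<gamma> \<le> 1" "\<gamma> < \<beta> n * (1 - 1 / \<alpha>)" using False s' by (auto simp: \<gamma>_def)
      define K where "K = C' powr \<gamma> * (1 / c n) powr \<gamma> * C"
      have "prob {\<omega> \<in> space M. dist (D u \<omega>, Y u \<omega>) (D t \<omega>, Y t \<omega>) \<le> r} \<le> K * r powr s' * (t - u) powr (- (\<gamma> / \<beta> n + 1 / \<alpha>))"
        if ut: "0 \<le> u" "u < t" "0 < r" for u t r
      proof -
        have "P u t r * Q u t r \<le> (C' powr \<gamma> * (r / c n) powr \<gamma> * (t - u) powr (- (\<gamma> / \<beta> n))) * (C powr 1 * r powr 1 * (t - u) powr (- (1 / \<alpha>)))"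
          using C' C by (intro mult_mono P_le Q_le ut \<gamma>) (auto simp: Q_def)
        also have "(r / c n) powr \<gamma> = (1 / c n) powr \<gamma> * r powr \<gamma>" unfolding powr_mult[symmetric] by simp
        also have "(C' powr \<gamma> * ((1 / c n) powr \<gamma> * r powr \<gamma>) * (t - u) powr (- (\<gamma> / \<beta> n))) * (C powr 1 * r powr 1 * (t - u) powr (- (1 / \<alpha>)))
          = K * (r powr \<gamma> * r powr 1) * ((t - u) powr (- (\<gamma> / \<beta> n)) * (t - u) powr (- (1 / \<alpha>)))"
          using C(1) by (simp add: K_def mult_ac)
        also have "\<dots> = K * r powr s' * (t - u) powr (- (\<gamma> / \<beta> n + 1 / \<alpha>))"
          unfolding powr_add[symmetric] by (simp add: \<gamma>_def)
        finally show ?thesis using PQ[OF ut(1,2), of r] by linarith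
      qed
      moreover have "\<gamma> / \<beta> n + 1 / \<alpha> < 1"
      proof -
        have "\<gamma> / \<beta> n < 1 - 1 / \<alpha>" using \<gamma>(3) \<beta> by (simp add: divide_less_eq mult.commute)
        then show ?thesis by simp
      qed
      moreover have "0 \<le> K" using C by (simp add: K_def)
      ultimately show ?thesis by (intro exI[of _ K] exI[of _ "\<gamma> / \<beta> n + 1 / \<alpha>"]) auto
    qed
  qed
qed

section \<open>Dimensions of the range and graph of the time-changed process\<close>

abbreviation changed_Y :: "real \<Rightarrow> 'w \<Rightarrow> 'b" where
  "changed_Y \<equiv> \<lambda>t \<omega>. Y (inverse_process D t \<omega>) \<omega>"

lemma range_on_changed_Y: "range_on changed_Y A \<omega> = (\<lambda>t. Y (first_passage (\<lambda>x. D x \<omega>) t) \<omega>) ` A"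
  by (simp add: range_on_def inverse_process_eq)

lemma graph_on_changed_Y: "graph_on changed_Y A \<omega> = (\<lambda>t. (t, Y (first_passage (\<lambda>x. D x \<omega>) t) \<omega>)) ` A"
  by (simp add: graph_on_def inverse_process_eq)

lemma hausdorff_dim_range_ge: "AE \<omega> in M. ereal (min (real DIM('b)) \<alpha>) \<le> hausdorff_dim (range_on changed_Y {0..1} \<omega>)"
proof -
  have "AE \<omega> in M. \<forall>N::nat. ereal (min (real DIM('b)) \<alpha>) \<le> hausdorff_dim ((\<lambda>t. Y t \<omega>) ` {0..1 / real (Suc N)})"
    unfolding AE_all_countable by (intro allI Y_hausdorff) simp
  then show ?thesis using AE_clock
  proof eventually_elim
    case (elim \<omega>)
    obtain N :: nat where "D (1 / real (Suc N)) \<omega> \<le> 1" using clock.ex_small_time[OF elim(2), of 1] by auto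
    then have "(\<lambda>t. Y t \<omega>) ` {0..1 / real (Suc N)} \<subseteq> range_on changed_Y {0..1} \<omega>"
      unfolding range_on_changed_Y by (intro clock.range_superset[OF elim(2)]) auto
    from hausdorff_dim_mono[OF this] elim(1) show ?case by (meson order_trans)
  qed
qed

lemma packing_dim_range_le: "AE \<omega> in M. packing_dim (range_on changed_Y {0..1} \<omega>) \<le> ereal (min (real DIM('b)) \<alpha>)"
  using Y_packing AE_clock
proof eventually_elim
  case (elim \<omega>)
  have "packing_dim (range_on changed_Y {0..1} \<omega>) \<le> ereal \<alpha>"
  proof (rule packing_dim_leI[where \<S> = "range (\<lambda>m::nat. (\<lambda>t. Y t \<omega>) ` {0..real m})"])
    show "range_on changed_Y {0..1} \<omega> \<subseteq> \<Union> (range (\<lambda>m::nat. (\<lambda>t. Y t \<omega>) ` {0..real m}))"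
      unfolding range_on_changed_Y by (rule clock.range_subset[OF elim(2)])
    show "packing_premeasure s' S = 0" if "S \<in> range (\<lambda>m::nat. (\<lambda>t. Y t \<omega>) ` {0..real m})" "\<alpha> < s'" for S s'
      using that elim(1) by blast
  qed (use \<alpha> in auto)
  then show ?case using packing_dim_le_DIM[of "range_on changed_Y {0..1} \<omega>"] by (simp add: min_def)
qed

lemma dim_range:
  "AE \<omega> in M. hausdorff_dim (range_on changed_Y {0..1} \<omega>) = ereal (min (real DIM('b)) \<alpha>) \<and>
    packing_dim (range_on changed_Y {0..1} \<omega>) = ereal (min (real DIM('b)) \<alpha>)"
  using hausdorff_dim_range_ge packing_dim_range_le
proof eventually_elim
  case (elim \<omega>)
  then show ?case using hausdorff_dim_le_packing_dim[of "range_on changed_Y {0..1} \<omega>"]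
    by (meson order_antisym order_trans)
qed

text \<open>The curve (D, Y) is treated by \<open>null\<close>; the condition s \<ge> 1 takes care
  of the horizontal segments over the jumps of D.\<close>

lemma packing_dim_graph_le:
  assumes s: "1 \<le> s"
    and null: "AE \<omega> in M. \<forall>m::nat. \<forall>s'>s. packing_premeasure s' ((\<lambda>t. (D t \<omega>, Y t \<omega>)) ` {0..real m}) = 0"
  shows "AE \<omega> in M. packing_dim (graph_on changed_Y {0..1} \<omega>) \<le> ereal s"
  using null AE_clock
proof eventually_elim
  case (elim \<omega>)
  let ?\<S> = "range (\<lambda>m::nat. (\<lambda>t. (D t \<omega>, Y t \<omega>)) ` {0..real m}) \<union>
    (\<lambda>q. {0..1} \<times> {Y (first_passage (\<lambda>x. D x \<omega>) q) \<omega>}) ` \<rat>"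
  show ?case
  proof (rule packing_dim_leI[where \<S> = ?\<S>])
    show "graph_on changed_Y {0..1} \<omega> \<subseteq> \<Union> ?\<S>"
      using clock.graph_subset[OF elim(2), of "\<lambda>x. Y x \<omega>"] unfolding graph_on_changed_Y by auto
    fix S and s' :: real assume S: "S \<in> ?\<S>" and s': "s < s'"
    have "1 < s'" using s s' by simp
    then show "packing_premeasure s' S = 0"
      using S s' elim(1) by (auto intro: packing_premeasure_horizontal_segment_eq_0)
  qed (use s countable_rat in auto)
qed

text \<open>For the lower bound the graph is projected: onto the time axis it gives the unit
  interval, onto space the range of X, which has dimension \<alpha> when \<alpha> \<le> d.\<close>

lemma dim_graph_low:
  assumes \<alpha>d: "\<alpha> \<le> real DIM('b)"
  shows "AE \<omega> in M. hausdorff_dim (graph_on changed_Y {0..1} \<omega>) = ereal (max 1 \<alpha>) \<and>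
    packing_dim (graph_on changed_Y {0..1} \<omega>) = ereal (max 1 \<alpha>)"
  using hausdorff_dim_range_ge packing_dim_graph_le[OF max.cobounded1 graph_packing_low]
proof eventually_elim
  case (elim \<omega>)
  let ?G = "graph_on changed_Y {0..1} \<omega>"
  have "hausdorff_dim (range_on changed_Y {0..1} \<omega>) \<le> hausdorff_dim ?G"
    by (rule hausdorff_dim_nonexpanding_le[where f = snd]) (auto simp: range_on_def graph_on_def dist_snd_le image_image)
  then have 1: "ereal \<alpha> \<le> hausdorff_dim ?G" using elim(1) \<alpha>d by (simp add: min_def split: if_splits)
  have "hausdorff_dim {0..1::real} \<le> hausdorff_dim ?G"
    by (rule hausdorff_dim_nonexpanding_le[where f = fst]) (auto simp: graph_on_def dist_fst_le image_image)
  with hausdorff_dim_unit_interval_ge have 2: "ereal 1 \<le> hausdorff_dim ?G" by (rule order_trans)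
  have "ereal (max 1 \<alpha>) \<le> hausdorff_dim ?G" using 1 2 by (simp add: max_def)
  then show ?case using elim(2) hausdorff_dim_le_packing_dim[of ?G] by (meson order_antisym order_trans)
qed

lemma dim_graph_high:
  assumes \<alpha>d: "real DIM('b) < \<alpha>" and dim: "DIM('b) = 1"
  shows "AE \<omega> in M. hausdorff_dim (graph_on changed_Y {0..1} \<omega>) = ereal (1 + \<beta> n * (1 - 1 / \<alpha>)) \<and>
    packing_dim (graph_on changed_Y {0..1} \<omega>) = ereal (1 + \<beta> n * (1 - 1 / \<alpha>))"
proof -
  have \<alpha>1: "1 < \<alpha>" using \<alpha>d dim by simp
  have s: "1 \<le> 1 + \<beta> n * (1 - 1 / \<alpha>)" using \<beta> \<alpha>1 by simp
  have "AE \<omega> in M. \<forall>N::nat. ereal (1 + \<beta> n * (1 - 1 / \<alpha>)) \<le> hausdorff_dim ((\<lambda>t. (D t \<omega>, Y t \<omega>)) ` {0..1 / real (Suc N)})"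
    unfolding AE_all_countable by (intro allI graph_hausdorff_high \<alpha>1 dim) simp
  then show ?thesis using AE_clock packing_dim_graph_le[OF s graph_packing_high[OF \<alpha>1 dim]]
  proof eventually_elim
    case (elim \<omega>)
    obtain N :: nat where "D (1 / real (Suc N)) \<omega> \<le> 1" using clock.ex_small_time[OF elim(2), of 1] by auto
    then have "(\<lambda>t. (D t \<omega>, Y t \<omega>)) ` {0..1 / real (Suc N)} \<subseteq> graph_on changed_Y {0..1} \<omega>"
      unfolding graph_on_changed_Y by (intro clock.graph_superset[OF elim(2)]) auto
    from hausdorff_dim_mono[OF this] elim(1)
    have "ereal (1 + \<beta> n * (1 - 1 / \<alpha>)) \<le> hausdorff_dim (graph_on changed_Y {0..1} \<omega>)" by (meson order_trans)
    then show ?case using elim(3) hausdorff_dim_le_packing_dim[of "graph_on changed_Y {0..1} \<omega>"] by (meson order_antisym order_trans)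
  qed
qed

end

theorem proposition3p5:
  fixes M :: "'w measure"
    and Y :: "real \<Rightarrow> 'w \<Rightarrow> 'a::euclidean_space"
    and X :: "real \<Rightarrow> 'w \<Rightarrow> 'a"
    and Ds :: "nat \<Rightarrow> real \<Rightarrow> 'w \<Rightarrow> real"
    and D E :: "real \<Rightarrow> 'w \<Rightarrow> real"
    and \<alpha> :: real and \<beta> c :: "nat \<Rightarrow> real" and n :: nat
  assumes "prob_space M"
    and "0 < \<alpha>" and "\<alpha> \<le> 2"
    and "strictly_stable_levy M \<alpha> Y"
    and "genuinely_full_dim M Y"
    and "1 \<le> n"
    and "\<forall>k\<in>{1..n}. 0 < c k"
    and "0 < \<beta> 1" and "strict_mono_on {1..n} \<beta>" and "\<beta> n < 1"
    and "\<forall>k\<in>{1..n}. stable_subordinator M (\<beta> k) (Ds k)"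
    and "prob_space.indep_vars M (\<lambda>_. path_space) (\<lambda>k. path_of (Ds k)) {1..n}"
    and "D = (\<lambda>t \<omega>. \<Sum>k=1..n. c k * Ds k t \<omega>)"
    and "E = inverse_process D"
    and "indep_processes M E Y"
    and "X = (\<lambda>t \<omega>. Y (E t \<omega>) \<omega>)"
  shows
    "(AE \<omega> in M.
        hausdorff_dim (range_on X {0..1} \<omega>) = ereal (min (real DIM('a)) \<alpha>) \<and>
        packing_dim (range_on X {0..1} \<omega>) = ereal (min (real DIM('a)) \<alpha>)) \<and>
     (\<alpha> \<le> real DIM('a) \<longrightarrow>
        (AE \<omega> in M.
           hausdorff_dim (graph_on X {0..1} \<omega>) = ereal (max 1 \<alpha>) \<and>
           packing_dim (graph_on X {0..1} \<omega>) = ereal (max 1 \<alpha>))) \<and>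
     (\<alpha> > real DIM('a) \<and> DIM('a) = 1 \<longrightarrow>
        (AE \<omega> in M.
           hausdorff_dim (graph_on X {0..1} \<omega>) = ereal (1 + \<beta> n * (1 - 1 / \<alpha>)) \<and>
           packing_dim (graph_on X {0..1} \<omega>) = ereal (1 + \<beta> n * (1 - 1 / \<alpha>))))"
proof -
  interpret prob_space M by fact
  interpret stable_time_change M Y Ds D \<alpha> \<beta> c n
    using assms by unfold_locales auto
  have X: "X = (\<lambda>t \<omega>. Y (inverse_process D t \<omega>) \<omega>)" using assms by simp
  show ?thesis
    unfolding X using dim_range dim_graph_low dim_graph_high by blast
qed

end
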